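(* Let $\ell\in\frac12\mathbb{N}$, and for $v\in\mathbb{C}^{2\ell+1}$ let $O^\ell(v)=\{D^\ell(g)v: g\in SU(2)\}$ be its orbit. The following things are true. (1) The map $D^\ell_{\bullet,s}:SU(2)\to S^{4\ell+1}\subset\mathbb{C}^{2\ell+1}$, $g\mapsto D^\ell(g)e_s$, induces an embedding $\frac{1}{|s|}S(\mathcal{T}^{\otimes s})\simeq O^\ell(e_s)\subset S^{4\ell+1}$ for all $s\in\{-\ell,\dots,\ell\}\smallsetminus\{0\}$. (2) For $s=0$ there are two cases: if $\ell\in2\mathbb{N}$, then $O^\ell(e_0)\simeq S^1$; while $O^\ell(e_0)\simeq S^2$ otherwise. (3) For almost every $v\in\mathbb{C}^{2\ell+1}$, the orbit $O^\ell(v)$ is diffeomorphic to $SU(2)$ when $\ell\notin\mathbb{N}$ and to $SO(3)$ when $\ell\in\mathbb{N}$. (4) Let $v\in\mathbb{C}^{2\ell+1}$ be any vector and let $n$ be the dimension of its orbit $O^\ell(v)$. If $A\subset O^\ell(v)$ is a measurable subset of positive $n$-dimensional volume, then $\mathrm{span}(A)=\mathbb{C}^{2\ell+1}$.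
   Context: $\frac12\mathbb{N}=\{0,\frac12,1,\dots\}$. $\mathbb{C}^{2\ell+1}$ has canonical basis $e_s$ indexed by $s\in\{-\ell,-\ell+1,\dots,\ell\}$ (so $s=0$ occurs only for $\ell\in\mathbb{N}$). The Wigner matrix $D^\ell=(D^\ell_{m,s})_{m,s}:SU(2)\to U(2\ell+1)$ is the unitary representation defined as follows: with $\psi^\ell_m(z_0,z_1)=\binom{2\ell}{\ell+m}^{1/2}z_0^{\ell+m}z_1^{\ell-m}$ and $g=h(\alpha,\beta)=\begin{pmatrix}\alpha&-\overline\beta\\ \beta&\overline\alpha\end{pmatrix}\in SU(2)$, $\sum_m\psi^\ell_m(z_0,z_1)D^\ell_{m,s}(g)=\psi^\ell_s(\overline\alpha z_0+\overline\beta z_1,-\beta z_0+\alpha z_1)$ for all $z_0,z_1\in\mathbb{C}$. Spin bundles: $\mathcal{T}^{\otimes\frac12}\to\mathbb{CP}^1\cong S^2$ is the tautological complex line bundle (fibre over a line $L\subset\mathbb{C}^2$ is $L$), and for $s\in\frac12\mathbb{Z}$, $\mathcal{T}^{\otimes s}=(\mathcal{T}^{\otimes\frac12})^{\otimes 2s}$ (negative powers are powers of the dual; $v^{\otimes(-1)}$ is the dual element with $\langle v^{\otimes(-1)},v\rangle=1$). For $g=h(\alpha,\beta)$, $\tau_g=(\alpha,\beta)^T$, an element of the fibre of $\mathcal{T}^{\otimes\frac12}$ over $[\alpha:\beta]$. For $s\ne0$, $\mathcal{T}^{\otimes s}$ carries the Hermitian metric with $\|(\tau_g)^{\otimes 2s}\|=\frac1{|s|}$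 for all $g\in SU(2)$, and $\frac1{|s|}S(\mathcal{T}^{\otimes s})=\{v\in\mathcal{T}^{\otimes s}:\|v\|=\frac1{|s|}\}$ is the corresponding circle bundle; the map $g\mapsto(\tau_g)^{\otimes 2s}$ is a $2|s|$-fold covering $SU(2)\to\frac1{|s|}S(\mathcal{T}^{\otimes s})$, through which $D^\ell_{\bullet,s}$ factors. The symbol $\simeq$ denotes a diffeomorphism.
   Formalization: In (2), for even ℓ the orbit of e_0 is the real projective plane, not S¹ (its stabiliser is the normaliser of the torus); ℓ=0 is excluded in (2) and (3), where orbits are points; v=0 is excluded in (4), where A={0} has span 0. *)

theory Defs
  imports "HOL-Analysis.Analysis"
begin

section \<open>Smooth maps between subsets of Euclidean spaces\<close>

text \<open>
  All manifolds below are embedded submanifolds of Euclidean spaces. Smoothness of a map on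
  such a set means that it extends locally to a smooth map of open sets. Accordingly, a subset
  that is diffeomorphic, in this sense, to an embedded submanifold is an embedded submanifold.
\<close>

fun Ck_on :: "nat \<Rightarrow> 'a::euclidean_space set \<Rightarrow> ('a \<Rightarrow> 'b::euclidean_space) \<Rightarrow> bool" where
  "Ck_on 0 U f \<longleftrightarrow> continuous_on U f"
| "Ck_on (Suc k) U f \<longleftrightarrow> (\<forall>x\<in>U. f differentiable (at x)) \<and>
     (\<forall>v. Ck_on k U (\<lambda>x. frechet_derivative f (at x) v))"

definition smooth_map :: "'a::euclidean_space set \<Rightarrow> ('a \<Rightarrow> 'b::euclidean_space) \<Rightarrow> bool" where
  "smooth_map X f \<longleftrightarrow>
     (\<forall>x\<in>X. \<exists>U f'. open U \<and> x \<in> U \<and> (\<forall>k. Ck_on k U f') \<and> (\<forall>y\<in>X \<inter> U. f' y = f y))"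

definition diffeomorphism ::
    "'a::euclidean_space set \<Rightarrow> 'b::euclidean_space set \<Rightarrow> ('a \<Rightarrow> 'b) \<Rightarrow> bool" where
  "diffeomorphism X Y f \<longleftrightarrow> f ` X = Y \<and> smooth_map X f \<and>
     (\<exists>g. smooth_map Y g \<and> (\<forall>x\<in>X. g (f x) = x))"

definition diffeomorphic :: "'a::euclidean_space set \<Rightarrow> 'b::euclidean_space set \<Rightarrow> bool" where
  "diffeomorphic X Y \<longleftrightarrow> (\<exists>f. diffeomorphism X Y f)"

definition smooth_embedding ::
    "'a::euclidean_space set \<Rightarrow> 'b::euclidean_space set \<Rightarrow> ('a \<Rightarrow> 'b) \<Rightarrow> bool" where
  "smooth_embedding X Y f \<longleftrightarrow> f ` X \<subseteq> Y \<and> diffeomorphism X (f ` X) f"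

text \<open>
  The model space \<open>\<real>\<^sup>n\<close> is represented by an \<open>n\<close>-dimensional linear subspace of the ambient
  space, so that \<open>n\<close> can be an ordinary natural number.
\<close>

definition submanifold_of_dim :: "nat \<Rightarrow> 'a::euclidean_space set \<Rightarrow> bool" where
  "submanifold_of_dim n M \<longleftrightarrow>
     (\<forall>x\<in>M. \<exists>V (S::'a set) U f. open V \<and> x \<in> V \<and> subspace S \<and> dim S = n \<and>
        openin (top_of_set S) U \<and> diffeomorphism U (M \<inter> V) f)"


section \<open>\<open>n\<close>-dimensional volume\<close>

text \<open>
  Hausdorff measure, normalised so that it is the Riemannian volume on \<open>n\<close>-dimensional
  submanifolds (and counting measure for \<open>n = 0\<close>).
\<close>

definition hausdorff_outer :: "nat \<Rightarrow> 'a::euclidean_space set \<Rightarrow> ennreal" where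
  "hausdorff_outer n A =
     (SUP \<delta>\<in>{0::real<..}.
        INF U\<in>{U::nat \<Rightarrow> 'a set. A \<subseteq> (\<Union>i. U i) \<and> (\<forall>i. bounded (U i) \<and> diameter (U i) \<le> \<delta>)}.
          (\<Sum>i. if U i = {} then 0
               else ennreal (unit_ball_vol (real n) * (diameter (U i) / 2) ^ n)))"

text \<open>Measurability in the sense of Caratheodory.\<close>

definition hausdorff_measurable :: "nat \<Rightarrow> 'a::euclidean_space set \<Rightarrow> bool" where
  "hausdorff_measurable n A \<longleftrightarrow> A \<in> lambda_system UNIV UNIV (hausdorff_outer n)"


section \<open>The groups and model surfaces\<close>

definition hmat :: "complex \<Rightarrow> complex \<Rightarrow> complex^2^2" where
  "hmat \<alpha> \<beta> = vector [vector [\<alpha>, - cnj \<beta>], vector [\<beta>, cnj \<alpha>]]"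

definition SU2 :: "(complex^2^2) set" where
  "SU2 = {g. (\<chi> i j. cnj (g $ j $ i)) ** g = mat 1 \<and> det g = 1}"

definition SO3 :: "(real^3^3) set" where
  "SO3 = {R. orthogonal_matrix R \<and> det R = 1}"

abbreviation S2 :: "(real^3) set" where
  "S2 \<equiv> sphere 0 1"

text \<open>The real projective plane, a line being represented by its orthogonal projection.\<close>

definition RP2 :: "(real^3^3) set" where
  "RP2 = {(\<chi> i j. x $ i * x $ j) |x. x \<in> S2}"

lemma hmat_nth [simp]:
  "hmat \<alpha> \<beta> $ 1 $ 1 = \<alpha>" "hmat \<alpha> \<beta> $ 1 $ 2 = - cnj \<beta>"
  "hmat \<alpha> \<beta> $ 2 $ 1 = \<beta>" "hmat \<alpha> \<beta> $ 2 $ 2 = cnj \<alpha>"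
  by (simp_all add: hmat_def)

lemma SU2_eq_hmat: "SU2 = {hmat \<alpha> \<beta> |\<alpha> \<beta>. (cmod \<alpha>)\<^sup>2 + (cmod \<beta>)\<^sup>2 = 1}"
proof (intro equalityI subsetI)
  fix g :: "complex^2^2" assume "g \<in> SU2"
  then have u: "(\<chi> i j. cnj (g $ j $ i)) ** g = mat 1" and d: "det g = 1"
    by (auto simp: SU2_def)
  let ?a = "g $ 1 $ 1" and ?b = "g $ 1 $ 2" and ?c = "g $ 2 $ 1" and ?d = "g $ 2 $ 2"
  have 1: "cnj ?a * ?a + cnj ?c * ?c = 1"
    using arg_cong[OF u, of "\<lambda>M. M $ 1 $ 1"] by (simp add: matrix_matrix_mult_def mat_def sum_2)
  have 2: "cnj ?a * ?b + cnj ?c * ?d = 0"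
    using arg_cong[OF u, of "\<lambda>M. M $ 1 $ 2"] by (simp add: matrix_matrix_mult_def mat_def sum_2)
  have 3: "?a * ?d - ?b * ?c = 1"
    using d by (simp add: det_2)
  have b: "?b = - cnj ?c" using 1 2 3 by algebra
  have dd: "?d = cnj ?a" using 1 2 3 by algebra
  have "g = hmat ?a ?c"
    using b dd by (simp add: vec_eq_iff forall_2)
  moreover have "complex_of_real ((cmod ?a)\<^sup>2 + (cmod ?c)\<^sup>2) = 1"
    using 1 by (simp only: of_real_add complex_norm_square) (simp add: mult.commute)
  then have "(cmod ?a)\<^sup>2 + (cmod ?c)\<^sup>2 = 1"
    using of_real_eq_1_iff by blast
  ultimately show "g \<in> {hmat \<alpha> \<beta> |\<alpha> \<beta>. (cmod \<alpha>)\<^sup>2 + (cmod \<beta>)\<^sup>2 = 1}"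
    by blast
next
  fix g assume "g \<in> {hmat \<alpha> \<beta> |\<alpha> \<beta>. (cmod \<alpha>)\<^sup>2 + (cmod \<beta>)\<^sup>2 = 1}"
  then obtain \<alpha> \<beta> where g: "g = hmat \<alpha> \<beta>" and n: "(cmod \<alpha>)\<^sup>2 + (cmod \<beta>)\<^sup>2 = 1"
    by blast
  have "complex_of_real ((cmod \<alpha>)\<^sup>2 + (cmod \<beta>)\<^sup>2) = 1"
    using n by simp
  then have c: "\<alpha> * cnj \<alpha> + \<beta> * cnj \<beta> = 1"
    by (simp only: of_real_add complex_norm_square)
  then show "g \<in> SU2"
    by (simp add: g SU2_def vec_eq_iff forall_2 matrix_matrix_mult_def mat_def sum_2 det_2
        algebra_simps)
qed


section \<open>Wigner matrices\<close>

definition weights :: "real \<Rightarrow> real set" where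
  "weights l = {real k - l |k::nat. real k \<le> 2 * l}"

text \<open>
  The space \<open>\<complex>\<^sup>2\<^sup>l\<^sup>+\<^sup>1\<close> is \<^typ>\<open>complex^'n\<close>, with a bijective labelling \<open>ix\<close> of the coordinates by
  \<^term>\<open>weights l\<close>.
\<close>

definition basis_vec :: "('n \<Rightarrow> real) \<Rightarrow> real \<Rightarrow> complex^'n" where
  "basis_vec ix s = (\<chi> m. if ix m = s then 1 else 0)"

definition psi :: "real \<Rightarrow> real \<Rightarrow> complex \<Rightarrow> complex \<Rightarrow> complex" where
  "psi l m z0 z1 = of_real (sqrt (real (nat \<lfloor>2 * l\<rfloor> choose nat \<lfloor>l + m\<rfloor>))) *
     z0 ^ nat \<lfloor>l + m\<rfloor> * z1 ^ nat \<lfloor>l - m\<rfloor>"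

definition is_wigner :: "real \<Rightarrow> ('n::finite \<Rightarrow> real) \<Rightarrow> complex^2^2 \<Rightarrow> complex^'n^'n \<Rightarrow> bool" where
  "is_wigner l ix g D \<longleftrightarrow>
     (\<forall>s z0 z1. (\<Sum>m\<in>UNIV. psi l (ix m) z0 z1 * D $ m $ s) =
        psi l (ix s) (cnj (g $ 1 $ 1) * z0 + cnj (g $ 2 $ 1) * z1)
          (- (g $ 2 $ 1) * z0 + g $ 1 $ 1 * z1))"

definition wigner :: "real \<Rightarrow> ('n::finite \<Rightarrow> real) \<Rightarrow> complex^2^2 \<Rightarrow> complex^'n^'n" where
  "wigner l ix g = (THE D. is_wigner l ix g D)"

definition wigner_orbit :: "real \<Rightarrow> ('n::finite \<Rightarrow> real) \<Rightarrow> complex^'n \<Rightarrow> (complex^'n) set" where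
  "wigner_orbit l ix v = (\<lambda>g. wigner l ix g *v v) ` SU2"

text \<open>The defining identity does determine the Wigner matrix.\<close>

lemma binary_form_exists:
  "\<exists>C::nat \<Rightarrow> complex. \<forall>x y. (a * x + b * y) ^ p * (c * x + d * y) ^ q =
     (\<Sum>k\<le>p + q. C k * x ^ k * y ^ (p + q - k))"
proof -
  have step: "\<exists>C'::nat \<Rightarrow> complex. \<forall>x y. (e * x + f * y) * F x y =
      (\<Sum>k\<le>Suc n. C' k * x ^ k * y ^ (Suc n - k))"
    if "\<forall>x y. F x y = (\<Sum>k\<le>n. C k * x ^ k * y ^ (n - k))" for F :: "complex \<Rightarrow> complex \<Rightarrow> complex"
      and C :: "nat \<Rightarrow> complex" and n e f
  proof (intro exI[of _ "\<lambda>k. (if k = 0 then 0 else e * C (k - 1)) + (if k \<le> n then f * C k else 0)"]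
      allI)
    fix x y :: complex
    have 1: "(\<Sum>k\<le>Suc n. (if k = 0 then 0 else e * C (k - 1)) * x ^ k * y ^ (Suc n - k)) =
        e * x * F x y"
      by (subst sum.atMost_Suc_shift) (simp add: that sum_distrib_left algebra_simps)
    have 2: "(\<Sum>k\<le>Suc n. (if k \<le> n then f * C k else 0) * x ^ k * y ^ (Suc n - k)) = f * y * F x y"
      by (simp add: that sum_distrib_left Suc_diff_le algebra_simps)
    have "(\<Sum>k\<le>Suc n. ((if k = 0 then 0 else e * C (k - 1)) + (if k \<le> n then f * C k else 0)) *
        x ^ k * y ^ (Suc n - k)) = e * x * F x y + f * y * F x y"
      unfolding 1[symmetric] 2[symmetric] sum.distrib[symmetric]
      by (intro sum.cong refl) (simp add: algebra_simps)
    then show "(e * x + f * y) * F x y = (\<Sum>k\<le>Suc n. ((if k = 0 then 0 else e * C (k - 1)) +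
        (if k \<le> n then f * C k else 0)) * x ^ k * y ^ (Suc n - k))"
      by (simp add: algebra_simps)
  qed
  have q: "\<exists>C::nat \<Rightarrow> complex. \<forall>x y. (c * x + d * y) ^ q = (\<Sum>k\<le>q. C k * x ^ k * y ^ (q - k))"
  proof (induction q)
    case 0
    show ?case by (intro exI[of _ "\<lambda>_. 1"]) simp
  next
    case (Suc q)
    then obtain C where "\<forall>x y. (c * x + d * y) ^ q = (\<Sum>k\<le>q. C k * x ^ k * y ^ (q - k))" by blast
    from step[OF this, of c d] show ?case by simp
  qed
  show ?thesis
  proof (induction p)
    case 0
    show ?case using q by simp
  next
    case (Suc p)
    then obtain C where "\<forall>x y. (a * x + b * y) ^ p * (c * x + d * y) ^ q =
        (\<Sum>k\<le>p + q. C k * x ^ k * y ^ (p + q - k))" by blast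
    from step[OF this, of a b] show ?case by (simp add: mult.assoc)
  qed
qed

lemma is_wigner_ex1:
  fixes ix :: "'n::finite \<Rightarrow> real"
  assumes l: "2 * l \<in> \<nat>" and ix: "bij_betw ix UNIV (weights l)"
  shows "\<exists>!D. is_wigner l ix g D"
proof -
  obtain N :: nat where N: "2 * l = real N" using l by (auto elim: Nats_cases)
  define k where "k m = nat \<lfloor>l + ix m\<rfloor>" for m
  have ixk: "ix m = real (k m) - l \<and> k m \<le> N" for m
  proof -
    have "ix m \<in> weights l" using ix by (auto simp: bij_betw_def)
    then obtain j :: nat where "ix m = real j - l" "real j \<le> 2 * l" by (auto simp: weights_def)
    then show ?thesis by (simp add: k_def N)
  qed
  have e2: "nat \<lfloor>l - ix m\<rfloor> = N - k m" for m
  proof -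
    have "l - ix m = real (N - k m)" using ixk[of m] N by (simp add: of_nat_diff)
    then show ?thesis by simp
  qed
  have bij: "bij_betw k UNIV {..N}"
    unfolding bij_betw_def
  proof (intro conjI equalityI subsetI)
    show "inj_on k UNIV"
      using ix ixk by (metis bij_betw_def inj_on_def)
  next
    fix j assume "j \<in> {..N}"
    then have "real j - l \<in> weights l" using N by (auto simp: weights_def)
    then obtain m where "ix m = real j - l" using ix by (metis bij_betw_def imageE)
    then have "k m = j" using ixk[of m] by simp
    then show "j \<in> range k" by blast
  qed (use ixk in auto)
  define w where "w m = complex_of_real (sqrt (real (N choose k m)))" for m
  have w0: "w m \<noteq> 0" for m using ixk[of m] by (simp add: w_def)
  have psi: "psi l (ix m) x y = w m * x ^ k m * y ^ (N - k m)" for m x y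
    unfolding psi_def k_def[symmetric] e2 w_def using N by simp
  have reindex: "(\<Sum>m\<in>UNIV. h (k m)) = (\<Sum>j\<le>N. h j)" for h :: "nat \<Rightarrow> complex"
    by (rule sum.reindex_bij_betw[OF bij])
  show ?thesis
  proof (rule ex_ex1I)
    have "\<exists>C::nat \<Rightarrow> complex. \<forall>x y.
        psi l (ix s) (cnj (g $ 1 $ 1) * x + cnj (g $ 2 $ 1) * y) (- (g $ 2 $ 1) * x + g $ 1 $ 1 * y)
        = (\<Sum>j\<le>N. C j * x ^ j * y ^ (N - j))" for s
    proof -
      obtain C where C: "\<forall>x y. (cnj (g $ 1 $ 1) * x + cnj (g $ 2 $ 1) * y) ^ k s *
          (- (g $ 2 $ 1) * x + g $ 1 $ 1 * y) ^ (N - k s) =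
          (\<Sum>j\<le>k s + (N - k s). C j * x ^ j * y ^ (k s + (N - k s) - j))"
        using binary_form_exists by blast
      show ?thesis
      proof (intro exI[of _ "\<lambda>j. w s * C j"] allI)
        fix x y :: complex
        have "k s + (N - k s) = N" using ixk[of s] by simp
        then show "psi l (ix s) (cnj (g $ 1 $ 1) * x + cnj (g $ 2 $ 1) * y)
            (- (g $ 2 $ 1) * x + g $ 1 $ 1 * y) = (\<Sum>j\<le>N. w s * C j * x ^ j * y ^ (N - j))"
          unfolding psi mult.assoc using C by (simp add: sum_distrib_left mult.assoc)
      qed
    qed
    then obtain C where C: "\<And>s x y.
        psi l (ix s) (cnj (g $ 1 $ 1) * x + cnj (g $ 2 $ 1) * y) (- (g $ 2 $ 1) * x + g $ 1 $ 1 * y)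
        = (\<Sum>j\<le>N. C s j * x ^ j * y ^ (N - j))" by metis
    show "\<exists>D. is_wigner l ix g D"
    proof (intro exI[of _ "\<chi> m s. C s (k m) / w m"])
      have "(\<Sum>m\<in>UNIV. psi l (ix m) x y * (C s (k m) / w m)) =
          (\<Sum>m\<in>UNIV. C s (k m) * x ^ k m * y ^ (N - k m))" for x y s
        using w0 by (intro sum.cong) (simp_all add: psi)
      then show "is_wigner l ix g (\<chi> m s. C s (k m) / w m)"
        unfolding is_wigner_def C reindex[symmetric] by simp
    qed
  next
    fix D E assume D: "is_wigner l ix g D" and E: "is_wigner l ix g E"
    define i where "i = inv_into UNIV k"
    have i: "i (k m) = m" for m
      using bij by (simp add: i_def bij_betw_def)
    have "D $ m $ s = E $ m $ s" for m s
    proof -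
      define c where "c j = w (i j) * (D $ i j $ s - E $ i j $ s)" for j
      have "(\<Sum>j\<le>N. c j * x ^ j) = 0" for x
      proof -
        have "(\<Sum>j\<le>N. c j * x ^ j) = (\<Sum>m\<in>UNIV. c (k m) * x ^ k m)"
          by (simp add: reindex[of "\<lambda>j. c j * x ^ j"])
        also have "\<dots> = (\<Sum>m\<in>UNIV. psi l (ix m) x 1 * D $ m $ s) -
            (\<Sum>m\<in>UNIV. psi l (ix m) x 1 * E $ m $ s)"
          by (simp add: sum_subtractf[symmetric] c_def i psi algebra_simps)
        also have "\<dots> = 0"
          using D E by (simp add: is_wigner_def)
        finally show ?thesis .
      qed
      then have "c (k m) = 0"
        using polyfun_eq_0[of c N] ixk[of m] by blast
      then show ?thesis using w0 by (simp add: c_def i)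
    qed
    then show "D = E" by (simp add: vec_eq_iff)
  qed
qed


section \<open>Spin bundles\<close>

text \<open>
  A point of the projective line is the orthogonal projection onto a line of \<open>\<complex>\<^sup>2\<close>.
\<close>

definition line_proj :: "complex^2 \<Rightarrow> complex^2^2" where
  "line_proj v = (\<chi> i j. v $ i * cnj (v $ j) / of_real ((norm v)\<^sup>2))"

definition CP1 :: "(complex^2^2) set" where
  "CP1 = {line_proj v |v. v \<noteq> 0}"

text \<open>
  The dual of a line is identified with the space of linear functionals on \<open>\<complex>\<^sup>2\<close> vanishing on
  the Hermitian complement of the line (the identification being restriction); a functional is
  represented by its coefficients. Thus \<open>dual_elt v\<close> takes the value 1 at \<open>v\<close>.
\<close>

definition line_of :: "complex^2^2 \<Rightarrow> (complex^2) set" where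
  "line_of P = {v. P *v v = v}"

definition dual_line_of :: "complex^2^2 \<Rightarrow> (complex^2) set" where
  "dual_line_of P = {\<phi>. \<forall>v. P *v v = 0 \<longrightarrow> (\<Sum>i\<in>UNIV. \<phi> $ i * v $ i) = 0}"

definition dual_elt :: "complex^2 \<Rightarrow> complex^2" where
  "dual_elt v = (\<chi> i. cnj (v $ i) / of_real ((norm v)\<^sup>2))"

text \<open>
  Tensors in the \<open>n\<close>-th tensor power of \<open>\<complex>\<^sup>2\<close>, where \<open>n = CARD('k)\<close>, are given by their
  coordinates in the product basis. The bundles with parameter \<open>s\<close> are meant to be used with
  \<open>CARD('k) = 2 * \<bar>s\<bar>\<close>.
\<close>

definition tensor :: "('k::finite \<Rightarrow> complex^2) \<Rightarrow> complex^('k \<Rightarrow> 2)" where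
  "tensor u = (\<chi> i. \<Prod>j\<in>UNIV. u j $ i j)"

definition spin_fibre :: "real \<Rightarrow> complex^2^2 \<Rightarrow> (complex^('k::finite \<Rightarrow> 2)) set" where
  "spin_fibre s P =
     vec.span {tensor u |u. \<forall>j. u j \<in> (if s > 0 then line_of P else dual_line_of P)}"

definition spin_bundle :: "real \<Rightarrow> ((complex^2^2) \<times> (complex^('k::finite \<Rightarrow> 2))) set" where
  "spin_bundle s = (SIGMA P:CP1. spin_fibre s P)"

definition spin_norm :: "real \<Rightarrow> complex^('k::finite \<Rightarrow> 2) \<Rightarrow> real" where
  "spin_norm s w = norm w / \<bar>s\<bar>"

definition circle_bundle :: "real \<Rightarrow> ((complex^2^2) \<times> (complex^('k::finite \<Rightarrow> 2))) set" where
  "circle_bundle s = {p \<in> spin_bundle s. spin_norm s (snd p) = 1 / \<bar>s\<bar>}"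

text \<open>
  \<open>tau g\<close> is an element of the tautological line over \<open>line_proj (tau g)\<close>, and \<open>tau_power s g\<close>
  is the point \<open>(tau g)\<^sup>2\<^sup>s\<close> (tensor power) of the bundle.
\<close>

definition tau :: "complex^2^2 \<Rightarrow> complex^2" where
  "tau g = column 1 g"

definition tau_power :: "real \<Rightarrow> complex^2^2 \<Rightarrow> (complex^2^2) \<times> (complex^('k::finite \<Rightarrow> 2))" where
  "tau_power s g =
     (line_proj (tau g), tensor (\<lambda>_. if s > 0 then tau g else dual_elt (tau g)))"

lemma sqrt_prod: "sqrt (\<Prod>j\<in>A. f j) = (\<Prod>j\<in>A. sqrt (f j))"
  by (induction A rule: infinite_finite_induct) (auto simp: real_sqrt_mult)

lemma norm_tensor: "norm (tensor u) = (\<Prod>j\<in>UNIV. norm (u j))"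
proof -
  have "(\<Sum>i\<in>UNIV. \<Prod>j\<in>UNIV. (norm (u j $ i j))\<^sup>2) = (\<Prod>j\<in>UNIV. \<Sum>i\<in>UNIV. (norm (u j $ i))\<^sup>2)"
    using prod_sum_PiE[of UNIV "\<lambda>_. UNIV" "\<lambda>j i. (norm (u j $ i))\<^sup>2"] by simp
  then show ?thesis
    by (simp add: norm_vec_def L2_set_def tensor_def sqrt_prod prod_norm[symmetric]
        prod_power_distrib)
qed

lemma norm_sq_complex2: "complex_of_real ((norm v)\<^sup>2) = (\<Sum>i\<in>UNIV. cnj (v $ i) * v $ i)"
  for v :: "complex^2"
  by (simp add: norm_vec_def L2_set_def sum_nonneg complex_norm_square mult.commute
      del: of_real_power)

lemma norm_tau: "g \<in> SU2 \<Longrightarrow> norm (tau g) = 1"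
  by (auto simp: SU2_eq_hmat tau_def column_def norm_vec_def L2_set_def sum_2)

lemma dual_elt_apply: "v \<noteq> 0 \<Longrightarrow> (\<Sum>i\<in>UNIV. dual_elt v $ i * v $ i) = 1"
  unfolding dual_elt_def by (simp add: norm_sq_complex2[symmetric] sum_divide_distrib[symmetric]
      del: of_real_power)

lemma line_proj_mult: "line_proj v *v x =
    ((\<Sum>j\<in>UNIV. cnj (v $ j) * x $ j) / of_real ((norm v)\<^sup>2)) *s v"
  by (simp add: line_proj_def matrix_vector_mult_def vec_eq_iff sum_distrib_left
      sum_divide_distrib sum_distrib_right mult_ac)

lemma tau_power_in_spin_bundle:
  assumes "g \<in> SU2"
  shows "tau_power s g \<in> spin_bundle s"
proof -
  let ?v = "tau g"
  have nz: "?v \<noteq> 0" using norm_tau[OF assms] by auto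
  have "?v \<in> line_of (line_proj ?v)"
    using nz unfolding line_of_def
    by (simp add: line_proj_mult norm_sq_complex2[symmetric] del: of_real_power)
  moreover have "dual_elt ?v \<in> dual_line_of (line_proj ?v)"
    using nz by (auto simp: dual_line_of_def dual_elt_def line_proj_mult
        sum_divide_distrib[symmetric])
  ultimately have "snd (tau_power s g) \<in> spin_fibre s (line_proj ?v)"
    by (auto simp: spin_fibre_def tau_power_def intro!: vec.span_base)
  then show ?thesis
    using nz by (auto simp: spin_bundle_def tau_power_def CP1_def)
qed

text \<open>The normalisation of the metric.\<close>

lemma spin_norm_tau_power:
  assumes "g \<in> SU2"
  shows "spin_norm s (snd (tau_power s g)) = 1 / \<bar>s\<bar>"
proof -
  have "norm (dual_elt (tau g)) = 1"
    using norm_tau[OF assms] by (simp add: dual_elt_def norm_vec_def L2_set_def)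
  then show ?thesis
    using norm_tau[OF assms] by (simp add: spin_norm_def tau_power_def norm_tensor)
qed

end

theory Submission
  imports Defs
begin

text \<open>
  A vector is read as a binary form of degree \<open>2 l\<close>, on which a quaternion \<open>q\<close> acts by substitution,
  so \<open>D q\<close> is polynomial in \<open>q\<close>. No inverse function theorem is needed, because every inverse map is
  an explicit polynomial. The moment map sends the orbit point \<open>D q e\<^sub>s\<close> to \<open>- 2 s q i q\<^sup>*\<close>, which
  determines the line, and for \<open>s \<noteq> 0\<close> pairing with the orbit point then determines the tensor in the
  fibre. For \<open>s = 0\<close> the norms of the derivatives of the orbit map determine the line spanned by the
  unit vector \<open>n = q i q\<^sup>*\<close>, and for odd \<open>l\<close> also its sign.

  For generic \<open>v\<close>, the adjoint of multiplication by a power of the quadratic form of the moment map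
  is an equivariant polynomial map to spinors or to symmetric 2-tensors, depending on the parity of
  \<open>2 l\<close>. It is nonzero at \<open>e\<^sub>1\<^sub>/\<^sub>2\<close> or nondegenerate at \<open>e\<^sub>1\<close>, so off the zero set of a nonzero polynomial
  it recovers the group element.

  For the last claim, a linear functional vanishing on \<open>A\<close> pulls back to a homogeneous polynomial on
  the quaternions. It is nonzero by irreducibility, so its zeros form a null cone, and the base of a null
  cone has Hausdorff measure zero in the dimension of the sphere. Orbits of dimension at most 2 consist of
  multiples of rotated \<open>e\<^sub>0\<close>, where the same argument applies on \<open>\<real>\<^sup>3\<close>.
\<close>


section \<open>Polynomial maps\<close>

text \<open>The element -1 of SU(2) acts by the sign (-1)^N with \<open>N = 2 * l\<close>, so for
  integer \<open>l\<close> an orbit point determines at most a rotation. The covariants take values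
  in degree 1 or 2 because these are the smallest representations that separate SU(2) and SO(3),
  respectively. Multiplying by a power of one fixed quadratic form would not be equivariant; the
  form of the moment map is, but it vanishes at weight 0, which is why the test vectors have weights
  1/2 and 1, the least positive ones.

  The form of the weight 0 vector is the \<open>l\<close>-th power of a quadratic form that changes
  sign with \<open>n\<close>. Hence antipodal \<open>n\<close> give the same orbit point exactly for
  even \<open>l\<close>, and the orbit is then a projective plane.

  Hausdorff measure is defined through coverings, so nullity has to become a bound on the number of
  small pieces. Cones supply it, and the base of a cone in \<real>^(n+1) has dimension n. The
  quaternions therefore serve for n \<ge> 3 only, and an orbit with a one-dimensional stabiliser
  must first be written as an image of a sphere in \<real>^3.\<close>

named_theorems poly_intros

lemma polynomial_function_linear_compose:
  assumes "bounded_linear h" "polynomial_function f"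
  shows "polynomial_function (\<lambda>x. h (f x))"
  using assms unfolding polynomial_function_def
  by (auto simp: o_def intro: bounded_linear_compose)

lemmas [poly_intros] = polynomial_function_const polynomial_function_id polynomial_function_add
  polynomial_function_diff polynomial_function_minus polynomial_function_mult

lemma polynomial_function_sum' [poly_intros]:
  "(\<And>i. i \<in> I \<Longrightarrow> polynomial_function (\<lambda>x. f x i)) \<Longrightarrow> polynomial_function (\<lambda>x. \<Sum>i\<in>I. f x i)"
  by (induction I rule: infinite_finite_induct) (simp_all add: poly_intros)

lemma polynomial_function_Re [poly_intros]:
  "polynomial_function f \<Longrightarrow> polynomial_function (\<lambda>x. Re (f x))"
  by (rule polynomial_function_linear_compose[OF bounded_linear_Re])

lemma polynomial_function_Im [poly_intros]:
  "polynomial_function f \<Longrightarrow> polynomial_function (\<lambda>x. Im (f x))"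
  by (rule polynomial_function_linear_compose[OF bounded_linear_Im])

lemma polynomial_function_cnj [poly_intros]:
  "polynomial_function f \<Longrightarrow> polynomial_function (\<lambda>x. cnj (f x))"
  by (rule polynomial_function_linear_compose[OF bounded_linear_cnj])

lemma polynomial_function_of_real [poly_intros]:
  "polynomial_function f \<Longrightarrow> polynomial_function (\<lambda>x. complex_of_real (f x))"
  by (rule polynomial_function_linear_compose[OF bounded_linear_of_real])

lemma polynomial_function_fst [poly_intros]:
  "polynomial_function f \<Longrightarrow> polynomial_function (\<lambda>x. fst (f x))"
  by (rule polynomial_function_linear_compose[OF bounded_linear_fst])

lemma polynomial_function_snd [poly_intros]:
  "polynomial_function f \<Longrightarrow> polynomial_function (\<lambda>x. snd (f x))"
  by (rule polynomial_function_linear_compose[OF bounded_linear_snd])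

lemma polynomial_function_vec_nth [poly_intros]:
  "polynomial_function f \<Longrightarrow> polynomial_function (\<lambda>x. f x $ i)"
  by (rule polynomial_function_linear_compose[OF bounded_linear_vec_nth])

text \<open>\<open>polynomial_function_mult\<close> multiplies by real scalars only, so one complex
  factor is split into its real and imaginary parts.\<close>

lemma polynomial_function_times_complex [poly_intros]:
  fixes f g :: "'a::real_normed_vector \<Rightarrow> complex"
  assumes "polynomial_function f" "polynomial_function g"
  shows "polynomial_function (\<lambda>x. f x * g x)"
proof -
  have "polynomial_function (\<lambda>x. Re (f x) *\<^sub>R g x + Im (f x) *\<^sub>R (\<i> * g x))"
    by (intro poly_intros assms polynomial_function_linear_compose[OF bounded_linear_mult_right])
  moreover have "Re a *\<^sub>R b + Im a *\<^sub>R (\<i> * b) = a * b" for a b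
    by (simp add: complex_eq_iff)
  ultimately show ?thesis by simp
qed

lemma polynomial_function_times_real [poly_intros]:
  fixes f g :: "'a::real_normed_vector \<Rightarrow> real"
  assumes "polynomial_function f" "polynomial_function g"
  shows "polynomial_function (\<lambda>x. f x * g x)"
  using polynomial_function_mult[OF assms] by simp

lemma polynomial_function_divide_complex [poly_intros]:
  fixes f :: "'a::real_normed_vector \<Rightarrow> complex"
  assumes "polynomial_function f"
  shows "polynomial_function (\<lambda>x. f x / c)"
  by (rule polynomial_function_linear_compose[OF bounded_linear_divide assms])

lemma polynomial_function_divide_real [poly_intros]:
  fixes f :: "'a::real_normed_vector \<Rightarrow> real"
  assumes "polynomial_function f"
  shows "polynomial_function (\<lambda>x. f x / c)"
  by (rule polynomial_function_linear_compose[OF bounded_linear_divide assms])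

lemma polynomial_function_power_complex [poly_intros]:
  fixes f :: "'a::real_normed_vector \<Rightarrow> complex"
  assumes "polynomial_function f"
  shows "polynomial_function (\<lambda>x. f x ^ n)"
  by (induction n) (auto simp: poly_intros assms)

lemma polynomial_function_power_real [poly_intros]:
  fixes f :: "'a::real_normed_vector \<Rightarrow> real"
  assumes "polynomial_function f"
  shows "polynomial_function (\<lambda>x. f x ^ n)"
  by (induction n) (auto simp: poly_intros assms)

lemma polynomial_function_prod_complex [poly_intros]:
  fixes f :: "'a::real_normed_vector \<Rightarrow> 'i \<Rightarrow> complex"
  assumes "\<And>i. i \<in> I \<Longrightarrow> polynomial_function (\<lambda>x. f x i)"
  shows "polynomial_function (\<lambda>x. \<Prod>i\<in>I. f x i)"
  using assms by (induction I rule: infinite_finite_induct) (simp_all add: poly_intros)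

lemma polynomial_function_Pair [poly_intros]:
  assumes "polynomial_function f" "polynomial_function g"
  shows "polynomial_function (\<lambda>x. (f x, g x))"
proof -
  have "polynomial_function (\<lambda>x. (f x, 0) + (0, g x))"
    by (intro polynomial_function_add
        polynomial_function_linear_compose[of "\<lambda>y. (y, 0)", OF _ assms(1)]
        polynomial_function_linear_compose[of "\<lambda>y. (0, y)", OF _ assms(2)]
        bounded_linear_Pair bounded_linear_ident bounded_linear_zero)
  then show ?thesis by simp
qed

lemma polynomial_function_vec_lambda [poly_intros]:
  fixes f :: "'a::real_normed_vector \<Rightarrow> 'n::finite \<Rightarrow> 'b::euclidean_space"
  assumes "\<And>i. polynomial_function (\<lambda>x. f x i)"
  shows "polynomial_function (\<lambda>x. \<chi> i. f x i)"
proof -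
  have "polynomial_function (\<lambda>x. \<Sum>i\<in>UNIV. axis i (f x i))"
    by (intro poly_intros polynomial_function_linear_compose[OF _ assms(1)])
      (simp add: linear_linear linear_iff axis_def vec_eq_iff)
  moreover have "(\<Sum>i\<in>UNIV. axis i (y i)) = (\<chi> i. y i)" for y :: "'n \<Rightarrow> 'b"
    by (simp add: vec_eq_iff axis_def if_distrib cong: if_cong)
  ultimately show ?thesis by simp
qed

lemma polynomial_function_matrix_vector_mult [poly_intros]:
  fixes f :: "'a::real_normed_vector \<Rightarrow> complex^'n^'m"
  assumes "polynomial_function f" "polynomial_function g"
  shows "polynomial_function (\<lambda>x. f x *v g x)"
  unfolding matrix_vector_mult_def by (intro poly_intros assms)

lemma polynomial_function_inner_both [poly_intros]:
  fixes f g :: "'a::real_normed_vector \<Rightarrow> 'b::euclidean_space"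
  assumes "polynomial_function f" "polynomial_function g"
  shows "polynomial_function (\<lambda>x. f x \<bullet> g x)"
  by (subst euclidean_inner) (intro poly_intros polynomial_function_inner assms)

lemma polynomial_function_comp:
  "polynomial_function g \<Longrightarrow> polynomial_function f \<Longrightarrow> polynomial_function (\<lambda>x. f (g x))"
  using polynomial_function_compose[of g f] by (simp add: o_def)

text \<open>\<open>real_polynomial_function\<close> carries the induction, but all closure rules
  speak of \<open>polynomial_function\<close>; this transports the one to the other.\<close>

lemma polynomial_function_induct_real [consumes 1, case_names linear const add mult]:
  fixes p :: "'a::real_normed_vector \<Rightarrow> real"
  assumes "polynomial_function p"
    and "\<And>f. bounded_linear f \<Longrightarrow> P f"
    and "\<And>c. P (\<lambda>x. c)"
    and "\<And>f g. \<lbrakk>polynomial_function f; polynomial_function g; P f; P g\<rbrakk> \<Longrightarrow> P (\<lambda>x. f x + g x)"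
    and "\<And>f g. \<lbrakk>polynomial_function f; polynomial_function g; P f; P g\<rbrakk> \<Longrightarrow> P (\<lambda>x. f x * g x)"
  shows "P p"
proof -
  have "real_polynomial_function p" using assms(1) by (simp add: real_polynomial_function_eq)
  then show ?thesis
    by induction (auto intro: assms simp: real_polynomial_function_eq)
qed

lemma polynomial_function_real_derivative:
  fixes p :: "'a::euclidean_space \<Rightarrow> real"
  assumes "polynomial_function p"
  shows "\<exists>p'. (\<forall>x. (p has_derivative p' x) (at x)) \<and> (\<forall>v. polynomial_function (\<lambda>x. p' x v))"
  using assms
proof (induction rule: polynomial_function_induct_real)
  case (linear f)
  then show ?case
    by (intro exI[of _ "\<lambda>x. f"]) (auto intro: bounded_linear_imp_has_derivative)
next
  case (const c)
  show ?case
    by (intro exI[of _ "\<lambda>x v. 0"]) auto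
next
  case (add f g)
  then obtain f' g' where "\<forall>x. (f has_derivative f' x) (at x)" "\<forall>v. polynomial_function (\<lambda>x. f' x v)"
    "\<forall>x. (g has_derivative g' x) (at x)" "\<forall>v. polynomial_function (\<lambda>x. g' x v)"
    by blast
  then show ?case
    by (intro exI[of _ "\<lambda>x v. f' x v + g' x v"]) (auto intro!: has_derivative_add poly_intros)
next
  case (mult f g)
  then obtain f' g' where "\<forall>x. (f has_derivative f' x) (at x)" "\<forall>v. polynomial_function (\<lambda>x. f' x v)"
    "\<forall>x. (g has_derivative g' x) (at x)" "\<forall>v. polynomial_function (\<lambda>x. g' x v)"
    by blast
  then show ?case using mult(1,2)
    by (intro exI[of _ "\<lambda>x v. f x * g' x v + f' x v * g x"])
      (auto intro!: has_derivative_mult poly_intros)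
qed

lemma polynomial_function_derivative:
  fixes p :: "'a::euclidean_space \<Rightarrow> 'b::euclidean_space"
  assumes "polynomial_function p"
  obtains p' where "\<And>x. (p has_derivative p' x) (at x)" "\<And>v. polynomial_function (\<lambda>x. p' x v)"
proof -
  have "\<forall>b\<in>Basis. \<exists>p'. (\<forall>x. ((\<lambda>x. p x \<bullet> b) has_derivative p' x) (at x)) \<and>
      (\<forall>v. polynomial_function (\<lambda>x. p' x v))"
    using assms by (auto intro!: polynomial_function_real_derivative poly_intros)
  then obtain p' where p': "\<And>b x. b \<in> Basis \<Longrightarrow> ((\<lambda>x. p x \<bullet> b) has_derivative p' b x) (at x)"
    "\<And>b v. b \<in> Basis \<Longrightarrow> polynomial_function (\<lambda>x. p' b x v)"
    by metis
  show thesis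
  proof
    fix x show "(p has_derivative (\<lambda>v. \<Sum>b\<in>Basis. p' b x v *\<^sub>R b)) (at x)"
    proof (subst has_derivative_componentwise_within, intro ballI)
      fix i :: 'b assume i: "i \<in> Basis"
      have "(\<Sum>b\<in>Basis. p' b x v *\<^sub>R b) \<bullet> i = p' i x v" for v
        using i by (simp add: inner_sum_left inner_Basis if_distrib cong: if_cong)
      then show "((\<lambda>x. p x \<bullet> i) has_derivative (\<lambda>v. (\<Sum>b\<in>Basis. p' b x v *\<^sub>R b) \<bullet> i)) (at x)"
        using p'(1)[OF i] by simp
    qed
  next
    fix v show "polynomial_function (\<lambda>x. \<Sum>b\<in>Basis. p' b x v *\<^sub>R b)"
      by (intro poly_intros p')
  qed
qed

lemma polynomial_function_differentiable:
  fixes p :: "'a::euclidean_space \<Rightarrow> 'b::euclidean_space"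
  assumes "polynomial_function p"
  shows "p differentiable (at x)"
  using polynomial_function_derivative[OF assms] by (metis differentiableI)

text \<open>A directional derivative of a polynomial is again one, so the induction on
  \<open>k\<close> goes through once \<open>p\<close> is arbitrary.\<close>

lemma polynomial_function_Ck_on:
  fixes p :: "'a::euclidean_space \<Rightarrow> 'b::euclidean_space"
  shows "polynomial_function p \<Longrightarrow> Ck_on k U p"
proof (induction k arbitrary: p)
  case 0
  then show ?case by (simp add: continuous_on_polymonial_function)
next
  case (Suc k)
  obtain p' where p': "\<And>x. (p has_derivative p' x) (at x)" "\<And>v. polynomial_function (\<lambda>x. p' x v)"
    using polynomial_function_derivative[OF Suc.prems] by blast
  have "frechet_derivative p (at x) = p' x" for x
    using frechet_derivative_at[OF p'(1)] by simp
  then show ?case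
    using Suc.IH p' polynomial_function_differentiable[OF Suc.prems] by simp
qed

lemma smooth_map_polynomial:
  assumes "polynomial_function p" "\<And>x. x \<in> X \<Longrightarrow> f x = p x"
  shows "smooth_map X f"
  unfolding smooth_map_def
  using assms by (metis IntD1 UNIV_I open_UNIV polynomial_function_Ck_on)

text \<open>All diffeomorphisms constructed below have this shape: both directions are restrictions
  of global polynomial maps, and \<open>r\<close> inverts \<open>p\<close> on \<open>X\<close>
  alone.\<close>

lemma diffeomorphism_polynomial:
  assumes "polynomial_function p" "polynomial_function r" "p ` X = Y" "\<And>x. x \<in> X \<Longrightarrow> r (p x) = x"
  shows "diffeomorphism X Y p"
  unfolding diffeomorphism_def
  using assms smooth_map_polynomial[OF assms(1) refl] smooth_map_polynomial[OF assms(2) refl]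
  by auto

text \<open>Modulo products of two coordinates, which are polynomials in \<open>S q\<close>, every
  polynomial is affine in \<open>q\<close> with coefficients polynomial in \<open>S q\<close>. The
  product of two linear parts consists of such products and so moves into \<open>r\<close>.\<close>

lemma polynomial_function_sq_expansion:
  fixes p :: "'a::euclidean_space \<Rightarrow> real" and S :: "'a \<Rightarrow> 'b::euclidean_space"
  assumes p: "polynomial_function p"
    and S: "\<And>i j. i \<in> Basis \<Longrightarrow> j \<in> Basis \<Longrightarrow>
      \<exists>r. polynomial_function r \<and> (\<forall>q\<in>X. (q \<bullet> i) * (q \<bullet> j) = r (S q))"
  shows "\<exists>r t. polynomial_function r \<and> (\<forall>i\<in>Basis. polynomial_function (t i)) \<and>
    (\<forall>q\<in>X. p q = r (S q) + (\<Sum>i\<in>Basis. (q \<bullet> i) * t i (S q)))"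
  using p
proof (induction rule: polynomial_function_induct_real)
  case (linear f)
  have *: "f q = 0 + (\<Sum>i\<in>Basis. (q \<bullet> i) * f i)" for q
  proof -
    have f: "linear f" using linear by (rule bounded_linear.linear)
    then have "f (\<Sum>i\<in>Basis. (q \<bullet> i) *\<^sub>R i) = (\<Sum>i\<in>Basis. (q \<bullet> i) * f i)"
      by (simp add: linear_sum[OF f] linear_scale[OF f])
    then show ?thesis by (simp add: euclidean_representation)
  qed
  show ?case
    by (intro exI[of _ "\<lambda>_. 0"] exI[of _ "\<lambda>i _. f i"] conjI ballI * poly_intros)
next
  case (const c)
  then show ?case
    by (intro exI[of _ "\<lambda>_. c"] exI[of _ "\<lambda>i _. 0"] conjI ballI) (simp_all add: poly_intros)
next
  case (add f g)
  then obtain r t r' t' where "polynomial_function r" "\<forall>i\<in>Basis. polynomial_function (t i)"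
    "\<forall>q\<in>X. f q = r (S q) + (\<Sum>i\<in>Basis. (q \<bullet> i) * t i (S q))"
    "polynomial_function r'" "\<forall>i\<in>Basis. polynomial_function (t' i)"
    "\<forall>q\<in>X. g q = r' (S q) + (\<Sum>i\<in>Basis. (q \<bullet> i) * t' i (S q))"
    by blast
  then show ?case
    by (intro exI[of _ "\<lambda>x. r x + r' x"] exI[of _ "\<lambda>i x. t i x + t' i x"] conjI ballI)
      (simp_all add: poly_intros sum.distrib algebra_simps)
next
  case (mult f g)
  obtain r t r' t' where 1: "polynomial_function r" "\<forall>i\<in>Basis. polynomial_function (t i)"
    "\<forall>q\<in>X. f q = r (S q) + (\<Sum>i\<in>Basis. (q \<bullet> i) * t i (S q))"
    "polynomial_function r'" "\<forall>i\<in>Basis. polynomial_function (t' i)"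
    "\<forall>q\<in>X. g q = r' (S q) + (\<Sum>i\<in>Basis. (q \<bullet> i) * t' i (S q))"
    using mult by blast
  obtain s where s: "\<And>i j. i \<in> Basis \<Longrightarrow> j \<in> Basis \<Longrightarrow> polynomial_function (s i j)"
    "\<And>i j q. i \<in> Basis \<Longrightarrow> j \<in> Basis \<Longrightarrow> q \<in> X \<Longrightarrow> (q \<bullet> i) * (q \<bullet> j) = s i j (S q)"
    using S by metis
  show ?case
  proof (intro exI[of _ "\<lambda>x. r x * r' x + (\<Sum>i\<in>Basis. \<Sum>j\<in>Basis. s i j x * (t i x * t' j x))"]
      exI[of _ "\<lambda>i x. r x * t' i x + r' x * t i x"] conjI ballI)
    fix q assume q: "q \<in> X"
    have "(\<Sum>i\<in>Basis. (q \<bullet> i) * t i (S q)) * (\<Sum>j\<in>Basis. (q \<bullet> j) * t' j (S q)) =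
        (\<Sum>i\<in>Basis. \<Sum>j\<in>Basis. ((q \<bullet> i) * (q \<bullet> j)) * (t i (S q) * t' j (S q)))"
      unfolding sum_product by (simp add: mult_ac)
    also have "\<dots> = (\<Sum>i\<in>Basis. \<Sum>j\<in>Basis. s i j (S q) * (t i (S q) * t' j (S q)))"
      using s(2) q by simp
    finally show "f q * g q = r (S q) * r' (S q) +
        (\<Sum>i\<in>Basis. \<Sum>j\<in>Basis. s i j (S q) * (t i (S q) * t' j (S q))) +
        (\<Sum>i\<in>Basis. (q \<bullet> i) * (r (S q) * t' i (S q) + r' (S q) * t i (S q)))"
      using 1 q by (simp add: algebra_simps sum.distrib sum_distrib_left)
  next
    show "polynomial_function (\<lambda>x. r x * r' x + (\<Sum>i\<in>Basis. \<Sum>j\<in>Basis. s i j x * (t i x * t' j x)))"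
      using 1(1,2,4,5) s(1) by (intro poly_intros) auto
    show "polynomial_function (\<lambda>x. r x * t' i x + r' x * t i x)" if "i \<in> Basis" for i
      using 1(1,2,4,5) that by (intro poly_intros) auto
  qed
qed

text \<open>To be used for maps \<open>S\<close> that determine \<open>q\<close> up to sign, such as \<open>q \<mapsto> q q\<^sup>T\<close> or the rotation given by
  a quaternion.\<close>

lemma even_polynomial_function:
  fixes p :: "'a::euclidean_space \<Rightarrow> 'c::euclidean_space" and S :: "'a \<Rightarrow> 'b::euclidean_space"
  assumes p: "polynomial_function p"
    and S: "\<And>i j. i \<in> Basis \<Longrightarrow> j \<in> Basis \<Longrightarrow>
      \<exists>r. polynomial_function r \<and> (\<forall>q\<in>X. (q \<bullet> i) * (q \<bullet> j) = r (S q))"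
    and X: "\<And>q. q \<in> X \<Longrightarrow> - q \<in> X \<and> S (- q) = S q \<and> p (- q) = p q"
  obtains r where "polynomial_function r" "\<And>q. q \<in> X \<Longrightarrow> p q = r (S q)"
proof -
  have "\<exists>r. polynomial_function r \<and> (\<forall>q\<in>X. p q \<bullet> b = r (S q))" for b
  proof -
    have "polynomial_function (\<lambda>q. p q \<bullet> b)" using p by (intro poly_intros)
    from polynomial_function_sq_expansion[OF this S]
    obtain r t where r: "polynomial_function r"
      "\<And>q. q \<in> X \<Longrightarrow> p q \<bullet> b = r (S q) + (\<Sum>i\<in>Basis. (q \<bullet> i) * t i (S q))"
      by metis
    \<comment> \<open>The linear part is odd: adding the expansions at \<open>q\<close> and
      \<open>- q\<close> removes it.\<close>
    have "p q \<bullet> b = r (S q)" if "q \<in> X" for q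
      using r(2)[OF that] r(2)[of "-q"] X[OF that] by (simp add: sum_negf)
    then show ?thesis using r(1) by blast
  qed
  then obtain r where r: "\<And>b. polynomial_function (r b)" "\<And>b q. q \<in> X \<Longrightarrow> p q \<bullet> b = r b (S q)"
    by metis
  show thesis
  proof
    show "polynomial_function (\<lambda>x. \<Sum>b\<in>Basis. r b x *\<^sub>R b)"
      by (intro poly_intros r)
    show "p q = (\<Sum>b\<in>Basis. r b (S q) *\<^sub>R b)" if "q \<in> X" for q
      using r(2)[OF that] by (metis (no_types, lifting) euclidean_representation sum.cong)
  qed
qed


section \<open>Null sets and Hausdorff measure\<close>

text \<open>Restricted to a line through a point where the polynomial does not vanish, it has finitely
  many zeros. By Fubini almost every homothety of the zero set about that point is null.\<close>

lemma negligible_polynomial_zeros: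
  fixes p :: "'a::euclidean_space \<Rightarrow> real"
  assumes p: "polynomial_function p" and v0: "p v0 \<noteq> 0"
  shows "negligible {v. p v = 0}"
proof -
  define P where "P v t \<longleftrightarrow> p (v0 + t *\<^sub>R (v - v0)) \<noteq> 0" for v :: 'a and t :: real
  have cont: "continuous_on X p" for X by (rule continuous_on_polymonial_function[OF p])
  have "finite {t. \<not> P v t}" for v
  proof -
    have "polynomial_function (\<lambda>t. v0 + t *\<^sub>R (v - v0))" by (intro poly_intros)
    then have "polynomial_function (\<lambda>t. p (v0 + t *\<^sub>R (v - v0)))"
      using p by (rule polynomial_function_comp)
    then obtain a n where a: "\<And>t. p (v0 + t *\<^sub>R (v - v0)) = (\<Sum>i\<le>n. a i * t ^ i)"
      unfolding real_polynomial_function_eq[symmetric] real_polynomial_function_iff_sum by metis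
    have "\<exists>i\<le>n. a i \<noteq> 0"
    proof (rule ccontr)
      assume "\<not> ?thesis"
      then have "p v0 = 0" using a[of 0] by simp
      then show False using v0 by simp
    qed
    then show ?thesis
      using polyfun_finite_roots[of a n] by (simp add: P_def a)
  qed
  then have "AE t in lborel. P v t" for v
    by (intro AE_I'[of "{t. \<not> P v t}"]) (auto intro: finite_imp_null_set_lborel)
  then have 1: "AE v in lborel. AE t in lborel. P v t" by simp
  have "open {x::'a \<times> real. p (v0 + snd x *\<^sub>R (fst x - v0)) \<noteq> 0}"
    by (intro open_Collect_neq continuous_intros continuous_on_compose2[OF cont[of UNIV]]) auto
  then have "{x. P (fst x) (snd x)} \<in> sets (borel :: ('a \<times> real) measure)"
    by (simp add: P_def borel_open)
  then have "{x \<in> space (lborel \<Otimes>\<^sub>M lborel). P (fst x) (snd x)} \<in> sets (lborel \<Otimes>\<^sub>M lborel)"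
    unfolding lborel_prod by (simp add: space_pair_measure)
  from lborel_pair.AE_commute[OF this] 1
  have "AE t in lborel. AE v in lborel. P v t" by simp
  moreover have "AE t in lborel. t \<noteq> (0::real)"
    by (rule AE_lborel_singleton)
  ultimately have "AE t in lborel. t \<noteq> 0 \<and> (AE v in lborel. P v t)"
    by auto
  then have "\<exists>t::real. t \<noteq> 0 \<and> (AE v in lborel. P v t)"
    by (intro eventually_happens'[of "ae_filter lborel"]) (auto simp: ae_filter_eq_bot_iff)
  then obtain t :: real where t: "t \<noteq> 0" "AE v in lborel. P v t"
    by blast
  have "open {v. P v t}" unfolding P_def
    by (intro open_Collect_neq continuous_intros continuous_on_compose2[OF cont[of UNIV]]) auto
  then have "{v. \<not> P v t} \<in> sets lborel"
    by (simp add: Collect_neg_eq borel_closed closed_def)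
  then have "{v. \<not> P v t} \<in> null_sets lborel"
    using t(2) by (simp add: AE_iff_null_sets)
  then have "negligible {v. \<not> P v t}"
    by (simp add: negligible_iff_null_sets null_sets_completionI)
  then have "negligible ((\<lambda>v. (v0 - t *\<^sub>R v0) + t *\<^sub>R v) ` {v. \<not> P v t})"
    by (intro negligible_differentiable_image_negligible)
      (auto intro!: polynomial_function_differentiable poly_intros simp: differentiable_on_def differentiable_at_withinI)
  moreover have "{v. p v = 0} \<subseteq> (\<lambda>v. (v0 - t *\<^sub>R v0) + t *\<^sub>R v) ` {v. \<not> P v t}"
  proof
    fix v assume "v \<in> {v. p v = 0}"
    then have "\<not> P (v0 + (1 / t) *\<^sub>R (v - v0)) t"
      using t(1) by (simp add: P_def)
    moreover have "v = (v0 - t *\<^sub>R v0) + t *\<^sub>R (v0 + (1 / t) *\<^sub>R (v - v0))"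
      using t(1) by (simp add: algebra_simps)
    ultimately show "v \<in> (\<lambda>v. (v0 - t *\<^sub>R v0) + t *\<^sub>R v) ` {v. \<not> P v t}" by blast
  qed
  ultimately show ?thesis by (rule negligible_subset)
qed

section \<open>Hausdorff measure of images of null cones\<close>

lemma hausdorff_outer_mono: "A \<subseteq> B \<Longrightarrow> hausdorff_outer n A \<le> hausdorff_outer n B"
  unfolding hausdorff_outer_def by (intro SUP_mono' INF_superset_mono) auto

lemma hausdorff_outer_empty: "hausdorff_outer n {} = 0"
proof -
  have "hausdorff_outer n {} \<le> 0"
    unfolding hausdorff_outer_def
    by (rule SUP_least, rule INF_lower2[where i = "\<lambda>_. {}"]) auto
  then show ?thesis by simp
qed

lemma polynomial_function_lipschitz_cball_real:
  fixes p :: "'a::euclidean_space \<Rightarrow> real"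
  assumes "polynomial_function p"
  shows "\<exists>L. L-lipschitz_on (cball 0 R) p"
  using assms
proof (induction rule: polynomial_function_induct_real)
  case (linear f)
  then obtain L where "L \<ge> 0" "\<And>x. norm (f x) \<le> norm x * L"
    using bounded_linear.nonneg_bounded by blast
  then show ?case
    by (intro exI[of _ L] lipschitz_onI)
      (auto simp: dist_norm mult.commute linear_diff[OF bounded_linear.linear[OF linear], symmetric])
next
  case (const c)
  show ?case by (auto intro: lipschitz_on_constant)
next
  case (add f g)
  then show ?case by (auto intro: lipschitz_on_add)
next
  case (mult f g)
  then obtain L M where L: "L-lipschitz_on (cball 0 R) f" and M: "M-lipschitz_on (cball 0 R) g" by blast
  have "bounded (f ` cball 0 R)" "bounded (g ` cball 0 R)"
    using mult(1,2) by (auto intro!: compact_imp_bounded compact_continuous_image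
        continuous_on_polymonial_function)
  then obtain F G where F: "\<And>x. x \<in> cball 0 R \<Longrightarrow> \<bar>f x\<bar> \<le> F" and G: "\<And>x. x \<in> cball 0 R \<Longrightarrow> \<bar>g x\<bar> \<le> G"
    and pos: "F \<ge> 0" "G \<ge> 0"
    by (metis bounded_pos image_eqI less_imp_le real_norm_def)
  show ?case
  proof (intro exI[of _ "F * M + L * G"] lipschitz_onI)
    fix x y :: 'a assume x: "x \<in> cball 0 R" and y: "y \<in> cball 0 R"
    have "\<bar>f x * g x - f y * g y\<bar> = \<bar>f x * (g x - g y) + (f x - f y) * g y\<bar>"
      by (simp add: algebra_simps)
    also have "\<dots> \<le> \<bar>f x\<bar> * \<bar>g x - g y\<bar> + \<bar>f x - f y\<bar> * \<bar>g y\<bar>"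
      by (metis abs_mult abs_triangle_ineq)
    also have "\<dots> \<le> F * (M * dist x y) + (L * dist x y) * G"
      using lipschitz_onD[OF L x y] lipschitz_onD[OF M x y] lipschitz_on_nonneg[OF L] F[OF x] G[OF y] pos
      by (intro add_mono mult_mono) (auto simp: dist_real_def)
    finally show "dist (f x * g x) (f y * g y) \<le> (F * M + L * G) * dist x y"
      by (simp add: dist_real_def algebra_simps)
  qed (use pos lipschitz_on_nonneg[OF L] lipschitz_on_nonneg[OF M] in auto)
qed

lemma polynomial_function_lipschitz_cball:
  fixes p :: "'a::euclidean_space \<Rightarrow> 'b::euclidean_space"
  assumes "polynomial_function p"
  obtains L where "L-lipschitz_on (cball 0 R) p"
proof -
  have "\<exists>L. L-lipschitz_on (cball 0 R) (\<lambda>x. p x \<bullet> b)" for b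
    using assms by (intro polynomial_function_lipschitz_cball_real poly_intros)
  then obtain L where L: "\<And>b. (L b)-lipschitz_on (cball 0 R) (\<lambda>x. p x \<bullet> b)" by metis
  show thesis
  proof (rule that[of "\<Sum>b\<in>Basis. L b"], rule lipschitz_onI)
    fix x y :: 'a assume "x \<in> cball 0 R" "y \<in> cball 0 R"
    have "dist (p x) (p y) \<le> (\<Sum>b\<in>Basis. \<bar>(p x - p y) \<bullet> b\<bar>)"
      unfolding dist_norm by (rule norm_le_l1)
    also have "\<dots> \<le> (\<Sum>b\<in>Basis. L b * dist x y)"
      using lipschitz_onD[OF L \<open>x \<in> _\<close> \<open>y \<in> _\<close>]
      by (intro sum_mono) (simp add: dist_real_def inner_diff_left)
    finally show "dist (p x) (p y) \<le> (\<Sum>b\<in>Basis. L b) * dist x y"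
      by (simp add: sum_distrib_right)
  qed (use lipschitz_on_nonneg[OF L] in \<open>auto intro: sum_nonneg\<close>)
qed

text \<open>Separated points of the base of a cone give, at the heights \<open>1 + j r\<close>, about \<open>1 / r\<close> times
  as many disjoint balls of radius \<open>r / 2\<close>, all close to the cone.\<close>

lemma card_separated_in_cone:
  fixes Z T :: "'a::euclidean_space set"
  assumes cone: "\<And>x t. x \<in> Z \<Longrightarrow> t > 0 \<Longrightarrow> t *\<^sub>R x \<in> Z"
    and T: "T \<in> lmeasurable" "(\<Union>x\<in>{x\<in>Z. 1 \<le> norm x \<and> norm x \<le> 2}. ball x r) \<subseteq> T"
    and r: "0 < r" "r \<le> 1"
    and Y: "finite Y" "Y \<subseteq> Z \<inter> sphere 0 1" "pairwise (\<lambda>x y. r \<le> dist x y) Y"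
  shows "real (card Y) * (1 / r) * (unit_ball_vol DIM('a) * (r / 2) ^ DIM('a)) \<le> measure lebesgue T"
proof -
  \<comment> \<open>The heights \<open>1 + j * r\<close> with \<open>j \<le> m\<close> stay in
    [1, 2] because \<open>m * r \<le> 1\<close>, and there are \<open>m + 1 \<ge> 1 / r\<close> of
    them.\<close>
  define m where "m = nat \<lfloor>1 / r\<rfloor>"
  define c where "c = (\<lambda>(j::nat, y::'a). (1 + real j * r) *\<^sub>R y)"
  define I where "I = {..m} \<times> Y"
  have m: "1 / r \<le> real m + 1" "real m \<le> 1 / r"
    using r by (auto simp: m_def)
  have normc: "norm (c (j, y)) = 1 + real j * r" if "y \<in> Y" for j y
    using that Y(2) r by (auto simp: c_def subset_iff)
  have sep: "r \<le> dist (c i) (c k)" if ik: "i \<in> I" "k \<in> I" "i \<noteq> k" for i k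
  proof -
    obtain j y j' y' where e: "i = (j, y)" "k = (j', y')" by (cases i, cases k) auto
    then have y: "y \<in> Y" "y' \<in> Y" using ik by (auto simp: I_def)
    \<comment> \<open>Different heights separate the norms by \<open>r\<close>; at equal height,
      scaling by \<open>1 + j * r \<ge> 1\<close> does not decrease distances.\<close>
    show ?thesis
    proof (cases "j = j'")
      case False
      have "1 \<le> \<bar>real j - real j'\<bar>" using False by linarith
      then have "r \<le> \<bar>real j - real j'\<bar> * r" using r by simp
      also have "\<dots> = \<bar>norm (c i) - norm (c k)\<bar>"
        using r by (simp add: e normc y left_diff_distrib[symmetric] abs_mult)
      also have "\<dots> \<le> dist (c i) (c k)" by (simp add: dist_norm norm_triangle_ineq3)
      finally show ?thesis .
    next
      case True
      then have "y \<noteq> y'" using ik(3) e by simp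
      then have "r \<le> dist y y'" using Y(3) y by (auto simp: pairwise_def)
      also have "\<dots> \<le> (1 + real j * r) * dist y y'"
        using r by (intro mult_le_cancel_right1[THEN iffD2]) auto
      also have "\<dots> = dist (c i) (c k)"
        using r True by (simp add: e c_def dist_norm scaleR_right_diff_distrib[symmetric])
      finally show ?thesis .
    qed
  qed
  have disj: "disjoint_family_on (\<lambda>i. ball (c i) (r / 2)) I"
    unfolding disjoint_family_on_def
  proof (intro ballI impI)
    fix i k assume "i \<in> I" "k \<in> I" "i \<noteq> k"
    from sep[OF this] show "ball (c i) (r / 2) \<inter> ball (c k) (r / 2) = {}"
      by (intro disjoint_ballI) simp
  qed
  have fin: "finite I" using Y(1) by (simp add: I_def)
  have "(\<Union>i\<in>I. ball (c i) (r / 2)) \<subseteq> T"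
  proof -
    have "c i \<in> {x\<in>Z. 1 \<le> norm x \<and> norm x \<le> 2}" if "i \<in> I" for i
    proof -
      obtain j y where i: "i = (j, y)" by (cases i)
      then have y: "y \<in> Y" "j \<le> m" using that by (auto simp: I_def)
      have "real j * r \<le> (1 / r) * r"
        using m(2) y(2) r by (intro mult_right_mono) auto
      moreover have "c (j, y) \<in> Z"
        unfolding c_def using Y(2) y r by (auto intro!: cone add_pos_nonneg)
      ultimately show ?thesis using y r by (auto simp: i normc)
    qed
    then have "(\<Union>i\<in>I. ball (c i) (r / 2)) \<subseteq> (\<Union>x\<in>{x\<in>Z. 1 \<le> norm x \<and> norm x \<le> 2}. ball x r)"
      using r by (fastforce simp: subset_iff)
    then show ?thesis using T(2) by blast
  qed
  then have "measure lebesgue (\<Union>i\<in>I. ball (c i) (r / 2)) \<le> measure lebesgue T"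
    using T(1) fin by (intro measure_mono_fmeasurable) auto
  also have "measure lebesgue (\<Union>i\<in>I. ball (c i) (r / 2)) = (\<Sum>i\<in>I. measure lebesgue (ball (c i) (r / 2)))"
    using fin disj by (intro measure_finite_Union) (use fmeasurableD2[OF lmeasurable_ball] in auto)
  also have "\<dots> = real (card I) * (unit_ball_vol DIM('a) * (r / 2) ^ DIM('a))"
    using r by (simp add: content_ball measure_completion)
  finally have *: "real (card I) * (unit_ball_vol DIM('a) * (r / 2) ^ DIM('a)) \<le> measure lebesgue T" .
  have "real (card Y) * (1 / r) \<le> real (card Y) * (real m + 1)"
    using m(1) by (intro mult_left_mono) auto
  also have "\<dots> = real (card I)" by (simp add: I_def card_cartesian_product algebra_simps)
  finally have "real (card Y) * (1 / r) \<le> real (card I)" .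
  then have "real (card Y) * (1 / r) * (unit_ball_vol DIM('a) * (r / 2) ^ DIM('a)) \<le>
     real (card I) * (unit_ball_vol DIM('a) * (r / 2) ^ DIM('a))"
    using r by (intro mult_right_mono) auto
  then show ?thesis using * by linarith
qed

text \<open>Let d be the dimension. The shell of \<open>Z\<close> between radii 1 and 2 is compact
  and null, so some r-neighbourhood of it has volume below a prescribed \<eta>. By
  \<open>card_separated_in_cone\<close> an r-separated subset of the base then has at most a
  constant times \<eta> / r^(d - 1) points. For a maximal one the r-balls cover the base, and their
  images contribute at most a constant times r^n each, in total a constant times \<eta> because n
  \<ge> d - 1 and r \<le> 1.\<close>

lemma hausdorff_outer_cone_base:
  fixes Z :: "'a::euclidean_space set" and \<Phi> :: "'a \<Rightarrow> 'b::euclidean_space"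
  assumes Z: "closed Z" "negligible Z" and cone: "\<And>x t. x \<in> Z \<Longrightarrow> t > 0 \<Longrightarrow> t *\<^sub>R x \<in> Z"
    and \<Phi>: "L-lipschitz_on (sphere 0 1) \<Phi>" and n: "DIM('a) \<le> Suc n"
  shows "hausdorff_outer n (\<Phi> ` (Z \<inter> sphere 0 1)) = 0"
proof -
  define K where "K = Z \<inter> sphere 0 1"
  define d where "d = DIM('a)"
  define A where "A = {x\<in>Z. 1 \<le> norm x \<and> norm x \<le> 2}"
  define \<omega> where "\<omega> = unit_ball_vol (real d)"
  have \<omega>: "\<omega> > 0" by (simp add: \<omega>_def)
  have L: "L \<ge> 0" using \<Phi> by (rule lipschitz_on_nonneg)
  have d: "d > 0" "d \<le> Suc n" using n by (auto simp: d_def)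
  have A: "A = Z \<inter> (cball 0 2 - ball 0 1)" by (auto simp: A_def)
  have "compact A" unfolding A by (intro closed_Int_compact Z compact_diff) auto
  have "negligible A" using Z(2) by (rule negligible_subset) (auto simp: A)
  have cover: "(INF U\<in>{U::nat \<Rightarrow> 'b set. \<Phi> ` K \<subseteq> (\<Union>i. U i) \<and> (\<forall>i. bounded (U i) \<and> diameter (U i) \<le> \<delta>)}.
          (\<Sum>i. if U i = {} then 0
               else ennreal (unit_ball_vol (real n) * (diameter (U i) / 2) ^ n))) \<le> ennreal e"
    if \<delta>: "\<delta> > 0" and e: "e > 0" for \<delta> e
  proof -
    define W where "W = unit_ball_vol (real n) * L ^ n"
    have W: "W \<ge> 0" using L by (simp add: W_def)
    \<comment> \<open>Chosen so that the final estimate becomes \<open>e * (W / (W + 1))\<close>;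
      the summand 1 covers \<open>W = 0\<close>.\<close>
    define \<eta> where "\<eta> = e * \<omega> / (2 ^ d * (W + 1))"
    have \<eta>: "\<eta> > 0" using e \<omega> W by (simp add: \<eta>_def)
    obtain T where T: "open T" "A \<subseteq> T" "T - A \<in> lmeasurable" "emeasure lebesgue (T - A) < ennreal \<eta>"
      using sets_lebesgue_outer_open[OF _ \<eta>, of A] \<open>negligible A\<close> negligible_imp_sets by blast
    have Tm: "T \<in> lmeasurable"
      using T(2,3) \<open>negligible A\<close> negligible_imp_measurable[of A]
      by (metis Diff_partition fmeasurable.Un sup_commute)
    have "measure lebesgue T = measure lebesgue (T - A)"
      using \<open>negligible A\<close> by (intro measure_negligible_symdiff[symmetric])
        (auto intro: negligible_subset simp: Tm fmeasurableD)
    also have "\<dots> < \<eta>" using T(4) \<eta> T(3)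
      by (simp add: emeasure_eq_measure2 ennreal_less_iff)
    finally have mT: "measure lebesgue T < \<eta>" .
    obtain e1 where e1: "e1 > 0" "(\<Union>x\<in>A. ball x e1) \<subseteq> T"
      using compact_subset_open_imp_ball_epsilon_subset[OF \<open>compact A\<close> T(1,2)] by blast
    \<comment> \<open>The three bounds place the \<open>r\<close>-neighbourhood of the shell in
      \<open>T\<close>, allow \<open>card_separated_in_cone\<close>, and keep the diameter bound
      \<open>2 * L * r\<close> below \<open>\<delta>\<close>; the 1 in the last denominator covers
      \<open>L = 0\<close>.\<close>
    define r where "r = Min {e1, 1, \<delta> / (2 * L + 1)}"
    have r: "r > 0" "r \<le> 1" "r \<le> e1" "r \<le> \<delta> / (2 * L + 1)"
      using e1 \<delta> L by (auto simp: r_def)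
    have "2 * L * r \<le> (2 * L + 1) * r" using r by (intro mult_right_mono) auto
    also have "\<dots> \<le> \<delta>" using r(4) L by (simp add: field_simps)
    finally have r\<delta>: "2 * L * r \<le> \<delta>" .
    define sep where "sep Y \<longleftrightarrow> finite Y \<and> Y \<subseteq> K \<and> pairwise (\<lambda>x y. r \<le> dist x y) Y" for Y
    have bound: "real (card Y) * r ^ (d - 1) * (\<omega> / 2 ^ d) \<le> \<eta>" if "sep Y" for Y
    proof -
      have "(\<Union>x\<in>{x\<in>Z. 1 \<le> norm x \<and> norm x \<le> 2}. ball x r) \<subseteq> T"
        using e1(2) r(3) by (fastforce simp: A_def subset_iff)
      from card_separated_in_cone[OF cone Tm this r(1,2)] that
      have "real (card Y) * (1 / r) * (\<omega> * (r / 2) ^ d) \<le> measure lebesgue T"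
        by (auto simp: sep_def K_def \<omega>_def d_def)
      moreover have "(1 / r) * (\<omega> * (r / 2) ^ d) = r ^ (d - 1) * (\<omega> / 2 ^ d)"
        using r(1) d(1) by (cases d) (auto simp: power_divide)
      ultimately have "real (card Y) * (r ^ (d - 1) * (\<omega> / 2 ^ d)) \<le> measure lebesgue T"
        by (simp only: mult.assoc)
      then show ?thesis using mT by (simp only: mult.assoc)
    qed
    have c0: "r ^ (d - 1) * (\<omega> / 2 ^ d) > 0" using r \<omega> by simp
    have "card Y \<le> nat \<lceil>\<eta> / (r ^ (d - 1) * (\<omega> / 2 ^ d))\<rceil>" if "sep Y" for Y
    proof -
      have "real (card Y) \<le> \<eta> / (r ^ (d - 1) * (\<omega> / 2 ^ d))"
        using bound[OF that] by (simp only: pos_le_divide_eq[OF c0] mult.assoc)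
      then show ?thesis by (meson of_nat_le_iff order_trans real_nat_ceiling_ge)
    qed
    moreover have "sep {}" by (simp add: sep_def)
    ultimately obtain Y where Y: "sep Y" "\<And>Y'. sep Y' \<Longrightarrow> card Y' \<le> card Y"
      using ex_has_greatest_nat[of sep "{}" card "Suc (nat \<lceil>\<eta> / (r ^ (d - 1) * (\<omega> / 2 ^ d))\<rceil>)"]
      by (auto simp only: less_Suc_eq_le)
    have near: "\<exists>y\<in>Y. dist y x < r" if x: "x \<in> K" for x
    proof (rule ccontr)
      assume "\<not> ?thesis"
      then have far: "\<And>y. y \<in> Y \<Longrightarrow> r \<le> dist y x" by force
      then have "x \<notin> Y" using r(1) by force
      moreover have "sep (insert x Y)"
        using Y(1) x far by (auto simp: sep_def pairwise_insert dist_commute)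
      ultimately show False using Y(2)[of "insert x Y"] Y(1) by (simp add: sep_def)
    qed
    obtain h where h: "bij_betw h {..<card Y} Y"
      using Y(1) by (metis ex_bij_betw_nat_finite lessThan_atLeast0 sep_def)
    \<comment> \<open>Padding by empty sets is free: they count as 0 even for \<open>n = 0\<close>,
      where a zero diameter has power 1.\<close>
    define U where "U i = (if i < card Y then \<Phi> ` (ball (h i) r \<inter> K) else {})" for i
    have dist_U: "dist a b \<le> 2 * L * r" if ab: "a \<in> U i" "b \<in> U i" for a b i
    proof -
      obtain x y where x: "a = \<Phi> x" "x \<in> K" "dist (h i) x < r" and y: "b = \<Phi> y" "y \<in> K" "dist (h i) y < r"
        using ab by (auto simp: U_def split: if_splits)
      have "dist x y \<le> 2 * r" using x y dist_triangle3[of x y "h i"] by simp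
      have "dist a b \<le> L * dist x y"
        unfolding x y using x y by (intro lipschitz_onD[OF \<Phi>]) (auto simp: K_def)
      also have "\<dots> \<le> L * (2 * r)" using \<open>dist x y \<le> 2 * r\<close> L by (rule mult_left_mono)
      finally show ?thesis by simp
    qed
    have bU: "bounded (U i)" for i
      unfolding bounded_def using dist_U by (metis equals0I)
    have dU: "diameter (U i) \<le> 2 * L * r" for i
      using dist_U L r(1) by (intro diameter_le) (auto simp: dist_norm)
    have "\<Phi> ` K \<subseteq> (\<Union>i. U i)"
    proof
      fix a assume "a \<in> \<Phi> ` K"
      then obtain x where x: "a = \<Phi> x" "x \<in> K" by blast
      then obtain y where y: "y \<in> Y" "dist y x < r" using near by blast
      then obtain i where "i < card Y" "h i = y" using h by (metis bij_betw_iff_bijections lessThan_iff)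
      then have "a \<in> U i" using x y by (auto simp: U_def)
      then show "a \<in> (\<Union>i. U i)" by blast
    qed
    moreover have "(\<Sum>i. if U i = {} then 0
               else ennreal (unit_ball_vol (real n) * (diameter (U i) / 2) ^ n)) \<le> ennreal e"
    proof -
      have "(\<Sum>i. if U i = {} then 0 else ennreal (unit_ball_vol (real n) * (diameter (U i) / 2) ^ n)) =
          (\<Sum>i<card Y. if U i = {} then 0 else ennreal (unit_ball_vol (real n) * (diameter (U i) / 2) ^ n))"
        by (rule suminf_finite) (auto simp: U_def)
      also have "\<dots> \<le> (\<Sum>i<card Y. ennreal (W * r ^ n))"
      proof (rule sum_mono)
        fix i
        have "(diameter (U i) / 2) ^ n \<le> (L * r) ^ n"
          using dU[of i] bU[of i] by (intro power_mono) (auto simp: diameter_ge_0)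
        then have "unit_ball_vol (real n) * (diameter (U i) / 2) ^ n \<le> W * r ^ n"
          by (simp add: W_def power_mult_distrib mult.assoc)
        then show "(if U i = {} then 0 else ennreal (unit_ball_vol (real n) * (diameter (U i) / 2) ^ n))
            \<le> ennreal (W * r ^ n)"
          by (simp add: ennreal_leI)
      qed
      also have "\<dots> = ennreal (real (card Y) * (W * r ^ n))"
        using W r(1) by (simp add: ennreal_of_nat_eq_real_of_nat ennreal_mult'')
      also have "real (card Y) * (W * r ^ n) \<le> e"
      proof -
        have "r ^ n \<le> r ^ (d - 1)" using r d by (intro power_decreasing) auto
        then have "real (card Y) * (W * r ^ n) \<le> real (card Y) * (W * r ^ (d - 1))"
          using W by (intro mult_left_mono) auto
        also have "\<dots> = W * (real (card Y) * r ^ (d - 1) * (\<omega> / 2 ^ d)) * (2 ^ d / \<omega>)"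
          using \<omega> by simp
        also have "\<dots> \<le> W * \<eta> * (2 ^ d / \<omega>)"
          using bound[OF Y(1)] W \<omega> by (intro mult_right_mono mult_left_mono) auto
        also have "\<dots> = e * (W / (W + 1))" using \<omega> by (simp add: \<eta>_def)
        also have "\<dots> \<le> e * 1" using e W by (intro mult_left_mono) auto
        finally show ?thesis by simp
      qed
      finally show ?thesis by (simp add: ennreal_leI)
    qed
    ultimately show ?thesis
      using bU order_trans[OF dU r\<delta>] by (intro INF_lower2[of U]) auto
  qed
  have "hausdorff_outer n (\<Phi> ` K) \<le> 0"
    unfolding hausdorff_outer_def
  proof (rule SUP_least)
    fix \<delta> :: real assume "\<delta> \<in> {0<..}"
    then have \<delta>: "\<delta> > 0" by simp
    show "(INF U\<in>{U::nat \<Rightarrow> 'b set. \<Phi> ` K \<subseteq> (\<Union>i. U i) \<and> (\<forall>i. bounded (U i) \<and> diameter (U i) \<le> \<delta>)}.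
          (\<Sum>i. if U i = {} then 0
               else ennreal (unit_ball_vol (real n) * (diameter (U i) / 2) ^ n))) \<le> 0"
      by (rule ennreal_le_epsilon, simp only: add_0) (rule cover[OF \<delta>])
  qed
  then show ?thesis by (simp add: K_def)
qed


section \<open>Velocities of curves in a submanifold\<close>

lemma smooth_map_local:
  assumes "smooth_map X f" "x \<in> X"
  obtains U f' D where "open U" "x \<in> U" "(f' has_derivative D) (at x)" "\<And>y. y \<in> X \<inter> U \<Longrightarrow> f' y = f y"
proof -
  obtain U f' where U: "open U" "x \<in> U" "\<forall>k. Ck_on k U f'" "\<forall>y\<in>X \<inter> U. f' y = f y"
    using assms unfolding smooth_map_def by blast
  then have "Ck_on (Suc 0) U f'" by blast
  then obtain D where "(f' has_derivative D) (at x)"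
    using U(2) by (auto simp: differentiable_def)
  then show thesis using that[OF U(1,2), of f' D] U(4) by simp
qed

lemma submanifold_velocities:
  assumes M: "submanifold_of_dim n M" and x: "x \<in> M"
  obtains T where "subspace T" "dim T \<le> n"
    "\<And>\<gamma> w. \<lbrakk>\<And>t. \<gamma> t \<in> M; \<gamma> 0 = x; (\<gamma> has_vector_derivative w) (at (0::real))\<rbrakk> \<Longrightarrow> w \<in> T"
proof -
  obtain V U f and S :: "'a set" where V: "open V" "x \<in> V" and S: "subspace S" "dim S = n"
    and U: "openin (top_of_set S) U" and f: "diffeomorphism U (M \<inter> V) f"
    using M x unfolding submanifold_of_dim_def by blast
  note f = f[unfolded diffeomorphism_def]
  have fU: "f ` U = M \<inter> V" using f by (rule conjunct1)
  have fs: "smooth_map U f" using f by (elim conjE)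
  have ex: "\<exists>g. smooth_map (M \<inter> V) g \<and> (\<forall>u\<in>U. g (f u) = u)" using f by (elim conjE)
  from ex obtain g where g': "smooth_map (M \<inter> V) g \<and> (\<forall>u\<in>U. g (f u) = u)" by (rule exE)
  have g: "smooth_map (M \<inter> V) g" "\<And>u. u \<in> U \<Longrightarrow> g (f u) = u"
    using conjunct1[OF g'] bspec[OF conjunct2[OF g']] by this
  have "x \<in> f ` U" unfolding fU using x V by simp
  then obtain u0 where u0: "u0 \<in> U" "f u0 = x" by (auto simp only: image_iff)
  obtain U1 f' Df where U1: "open U1" "u0 \<in> U1" and Df: "(f' has_derivative Df) (at u0)"
    and f'_eq: "\<And>y. y \<in> U \<inter> U1 \<Longrightarrow> f' y = f y"
    by (rule smooth_map_local[OF fs u0(1)], rule that)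
  have "x \<in> M \<inter> V" using x V by simp
  obtain V1 g' Dg where V1: "open V1" "x \<in> V1" and Dg: "(g' has_derivative Dg) (at x)"
    and g'_eq: "\<And>y. y \<in> M \<inter> V \<inter> V1 \<Longrightarrow> g' y = g y"
    by (rule smooth_map_local[OF g(1) \<open>x \<in> M \<inter> V\<close>], rule that)
  have lin: "linear Df" using Df by (rule has_derivative_linear)
  show thesis
  proof
    show "subspace (Df ` S)" using lin S(1) by (rule linear_subspace_image)
    show "dim (Df ` S) \<le> n" using dim_image_le[OF lin, of S] S(2) by simp
  next
    fix \<gamma> :: "real \<Rightarrow> 'a" and w
    assume \<gamma>: "\<And>t. \<gamma> t \<in> M" "\<gamma> 0 = x" "(\<gamma> has_vector_derivative w) (at 0)"
    have g'x: "g' x = u0" using g'_eq[of x] V1 V(2) x g(2)[OF u0(1)] u0(2) by simp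
    have d\<gamma>: "(\<gamma> has_derivative (\<lambda>h. h *\<^sub>R w)) (at 0)"
      using \<gamma>(3) by (simp add: has_vector_derivative_def)
    have du: "((\<lambda>t. g' (\<gamma> t)) has_derivative (\<lambda>h. Dg (h *\<^sub>R w))) (at 0)"
      using has_derivative_compose[OF d\<gamma>, of g' Dg] Dg \<gamma>(2) by simp
    have cont\<gamma>: "(\<gamma> \<longlongrightarrow> x) (at 0)"
      using has_derivative_continuous[OF d\<gamma>] \<gamma>(2) by (simp add: isCont_def)
    have contu: "((\<lambda>t. g' (\<gamma> t)) \<longlongrightarrow> u0) (at 0)"
      using has_derivative_continuous[OF du] \<gamma>(2) g'x by (simp add: isCont_def)
    have ev: "\<forall>\<^sub>F t in at 0. \<gamma> t \<in> V \<and> \<gamma> t \<in> V1 \<and> g' (\<gamma> t) \<in> U1"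
      using topological_tendstoD[OF cont\<gamma> V] topological_tendstoD[OF cont\<gamma> V1(1,2)]
        topological_tendstoD[OF contu U1(1,2)]
      by eventually_elim simp
    have loc: "g' y \<in> U \<and> f' (g' y) = y" if "y \<in> M" "y \<in> V" "y \<in> V1" "g' y \<in> U1" for y
    proof -
      have "y \<in> f ` U" unfolding fU using that by simp
      then obtain u where u: "u \<in> U" "f u = y" by (auto simp only: image_iff)
      have "g' y = u" using g'_eq[of y] g(2)[OF u(1)] u(2) that by simp
      then show ?thesis using u f'_eq[of u] that(4) by simp
    qed
    have US: "U \<subseteq> S" using U openin_imp_subset by blast
    \<comment> \<open>A component orthogonal to \<open>S\<close> vanishes along the curve, hence so
      does its derivative.\<close>
    have "Dg w \<in> S"
    proof -
      obtain y z where yz: "y \<in> span S" "\<And>v. v \<in> span S \<Longrightarrow> orthogonal z v" "Dg w = y + z"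
        using orthogonal_subspace_decomp_exists[of S "Dg w"] by metis
      have zS: "z \<bullet> v = 0" if "v \<in> S" for v
        using yz(2)[of v] that by (simp add: orthogonal_def span_base)
      have "((\<lambda>t. z \<bullet> g' (\<gamma> t)) has_derivative (\<lambda>h. z \<bullet> Dg (h *\<^sub>R w))) (at 0)"
        by (rule has_derivative_inner_right[OF du])
      then have "((\<lambda>t. 0) has_derivative (\<lambda>h. z \<bullet> Dg (h *\<^sub>R w))) (at (0::real))"
      proof (rule has_derivative_transform_eventually)
        show "\<forall>\<^sub>F t in at 0. z \<bullet> g' (\<gamma> t) = 0"
          using ev by eventually_elim (use loc \<gamma>(1) US zS in blast)
        show "z \<bullet> g' (\<gamma> 0) = 0" using \<gamma>(2) g'x u0(1) US zS by auto
      qed simp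
      from has_derivative_unique[OF this has_derivative_const] have "z \<bullet> Dg w = 0"
        by (metis scaleR_one)
      moreover have "z \<bullet> y = 0" using yz(1,2) by (simp add: orthogonal_def)
      ultimately have "z = 0" by (simp add: yz(3) inner_add_right)
      then show ?thesis using yz(1,3) S(1) by (metis add.right_neutral span_eq_iff)
    qed
    moreover have "((\<lambda>t. f' (g' (\<gamma> t))) has_derivative (\<lambda>h. Df (Dg (h *\<^sub>R w)))) (at 0)"
      using has_derivative_compose[OF du, of f' Df] Df \<gamma>(2) g'x by simp
    then have "(\<gamma> has_derivative (\<lambda>h. Df (Dg (h *\<^sub>R w)))) (at 0)"
    proof (rule has_derivative_transform_eventually)
      show "\<forall>\<^sub>F t in at 0. f' (g' (\<gamma> t)) = \<gamma> t"
        using ev by eventually_elim (use loc \<gamma>(1) in blast)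
      show "f' (g' (\<gamma> 0)) = \<gamma> 0" using loc[OF x V(2) V1(2)] g'x U1(2) \<gamma>(2) by simp
    qed simp
    then have "Df (Dg w) = w"
      using has_derivative_unique[OF d\<gamma>] by (metis scaleR_one)
    ultimately show "w \<in> Df ` S" by (metis imageI)
  qed
qed


section \<open>Quaternions and Hermitian products\<close>

text \<open>A pair \<open>(\<alpha>, \<beta>)\<close> stands for the quaternion \<^term>\<open>hmat \<alpha> \<beta>\<close>; those of norm 1 form \<^const>\<open>SU2\<close>.\<close>

definition qmul :: "complex \<times> complex \<Rightarrow> complex \<times> complex \<Rightarrow> complex \<times> complex" where
  "qmul p q = (fst p * fst q - cnj (snd p) * snd q, snd p * fst q + cnj (fst p) * snd q)"

definition qcnj :: "complex \<times> complex \<Rightarrow> complex \<times> complex" where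
  "qcnj q = (cnj (fst q), - snd q)"

lemma norm_sq_pair: "(norm q)\<^sup>2 = (cmod (fst q))\<^sup>2 + (cmod (snd q))\<^sup>2" for q :: "complex \<times> complex"
  by (simp add: norm_prod_def)

lemma pair_mult_cnj: "fst q * cnj (fst q) + snd q * cnj (snd q) = complex_of_real ((norm q)\<^sup>2)"
  for q :: "complex \<times> complex"
  unfolding norm_sq_pair by (simp only: of_real_add complex_norm_square)

lemma qmul_qcnj: "qmul q (qcnj q) = (complex_of_real ((norm q)\<^sup>2), 0)"
  unfolding pair_mult_cnj[symmetric] by (simp add: qmul_def qcnj_def algebra_simps)

lemma qcnj_qmul: "qmul (qcnj q) q = (complex_of_real ((norm q)\<^sup>2), 0)"
  unfolding pair_mult_cnj[symmetric] by (simp add: qmul_def qcnj_def algebra_simps)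

lemma qcnj_qcnj [simp]: "qcnj (qcnj q) = q"
  by (simp add: qcnj_def)

lemma norm_qcnj [simp]: "norm (qcnj q) = norm q"
  by (simp add: norm_prod_def qcnj_def)

lemma qmul_assoc: "qmul (qmul p q) r = qmul p (qmul q r)"
  by (simp add: qmul_def algebra_simps)

lemma qmul_one [simp]: "qmul (1, 0) q = q" "qmul q (1, 0) = q"
  by (simp_all add: qmul_def)

lemma qcnj_mult: "qcnj (qmul p q) = qmul (qcnj q) (qcnj p)"
  by (simp add: qmul_def qcnj_def algebra_simps)

lemma norm_qmul: "norm (qmul p q) = norm p * norm q"
proof -
  have "complex_of_real ((norm (qmul p q))\<^sup>2) = of_real ((norm p)\<^sup>2) * of_real ((norm q)\<^sup>2)"
    unfolding pair_mult_cnj[symmetric] by (simp add: qmul_def algebra_simps)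
  then have "(norm (qmul p q))\<^sup>2 = (norm p * norm q)\<^sup>2"
    by (simp only: of_real_mult[symmetric] of_real_eq_iff power_mult_distrib)
  then show ?thesis by (simp add: power2_eq_iff_nonneg)
qed

lemma hmat_in_SU2_iff: "hmat \<alpha> \<beta> \<in> SU2 \<longleftrightarrow> norm (\<alpha>, \<beta>) = 1"
proof -
  have "hmat a b = hmat a' b' \<longleftrightarrow> a = a' \<and> b = b'" for a b a' b'
    by (metis hmat_nth(1,3))
  moreover have "norm (\<alpha>, \<beta>) = 1 \<longleftrightarrow> (norm (\<alpha>, \<beta>))\<^sup>2 = 1"
    by (simp add: power2_eq_1_iff) (metis norm_ge_zero neg_0_le_iff_le not_one_le_zero)
  ultimately show ?thesis by (auto simp: SU2_eq_hmat norm_sq_pair)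
qed

lemma SU2_image: "SU2 = (\<lambda>q. hmat (fst q) (snd q)) ` sphere 0 1"
proof (intro equalityI subsetI)
  fix g assume "g \<in> SU2"
  then obtain a b where "g = hmat a b" by (auto simp: SU2_eq_hmat)
  then show "g \<in> (\<lambda>q. hmat (fst q) (snd q)) ` sphere 0 1"
    using \<open>g \<in> SU2\<close> hmat_in_SU2_iff[of a b] by (intro image_eqI[of _ _ "(a, b)"]) auto
next
  fix g assume "g \<in> (\<lambda>q. hmat (fst q) (snd q)) ` sphere 0 1"
  then obtain q where "norm q = 1" "g = hmat (fst q) (snd q)" by auto
  then show "g \<in> SU2" using hmat_in_SU2_iff[of "fst q" "snd q"] by simp
qed

section \<open>Hermitian products and annihilators\<close>

definition herm :: "complex^'n::finite \<Rightarrow> complex^'n \<Rightarrow> complex" where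
  "herm x y = (\<Sum>m\<in>UNIV. cnj (x $ m) * y $ m)"

lemma herm_self: "herm x x = of_real ((norm x)\<^sup>2)"
  by (simp add: herm_def norm_vec_def L2_set_def sum_nonneg complex_norm_square mult.commute
      del: of_real_power)

lemma inner_eq_Re_herm: "x \<bullet> y = Re (herm x y)"
  by (simp add: inner_vec_def herm_def inner_complex_def)

lemma herm_linear:
  "herm x (y + z) = herm x y + herm x z" "herm (x + y) z = herm x z + herm y z"
  "herm x (y - z) = herm x y - herm x z" "herm (x - y) z = herm x z - herm y z"
  "herm x (c *s y) = c * herm x y" "herm (c *s x) y = cnj c * herm x y"
  "herm x (t *\<^sub>R y) = of_real t * herm x y" "herm (t *\<^sub>R x) y = of_real t * herm x y"
  "herm x 0 = 0" "herm 0 y = 0"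
  by (simp_all add: herm_def algebra_simps sum.distrib sum_subtractf sum_distrib_left
      scaleR_conv_of_real[symmetric] scaleR_sum_right)

lemma herm_matrix: "herm (M *v x) y = herm x ((\<chi> i j. cnj (M $ j $ i)) *v y)"
  unfolding herm_def matrix_vector_mult_def
  by (simp add: sum_distrib_left sum_distrib_right mult_ac) (rule sum.swap)

lemma polynomial_function_herm [poly_intros]:
  "polynomial_function f \<Longrightarrow> polynomial_function g \<Longrightarrow> polynomial_function (\<lambda>x. herm (f x) (g x))"
  unfolding herm_def by (intro poly_intros)

lemma of_real_smult: "of_real t *s x = t *\<^sub>R x" for x :: "complex^'n::finite"
  by (simp add: vec_eq_iff complex_eq_iff)

text \<open>Orthogonality to a complex subspace for the real inner product is already Hermitian
  orthogonality: test \<open>a\<close> and \<open>\<i> *s a\<close>.\<close>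

lemma vec_span_annihilator:
  fixes A :: "(complex^'n::finite) set"
  assumes "vec.span A \<noteq> UNIV"
  obtains u where "u \<noteq> 0" "\<And>a. a \<in> A \<Longrightarrow> herm u a = 0"
proof -
  have "subspace (vec.span A)"
    unfolding subspace_def
  proof (intro conjI ballI allI)
    fix t :: real and x assume "x \<in> vec.span A"
    then have "of_real t *s x \<in> vec.span A" by (rule vec.span_scale)
    then show "t *\<^sub>R x \<in> vec.span A" by (simp only: of_real_smult)
  qed (auto intro: vec.span_add vec.span_zero)
  then have "span (vec.span A) = vec.span A" by (simp add: span_eq_iff)
  then obtain u where u: "u \<noteq> 0" "\<And>a. a \<in> vec.span A \<Longrightarrow> u \<bullet> a = 0"
    using span_not_UNIV_orthogonal[of "vec.span A"] assms by metis
  have "herm u a = 0" if "a \<in> A" for a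
  proof -
    have a: "a \<in> vec.span A" using that by (rule vec.span_base)
    have "Re (herm u a) = 0" using u(2)[OF a] by (simp add: inner_eq_Re_herm)
    moreover have "Re (herm u (\<i> *s a)) = 0"
      using u(2)[OF vec.span_scale[OF a]] by (simp add: inner_eq_Re_herm)
    ultimately show ?thesis by (simp add: herm_linear complex_eq_iff)
  qed
  then show thesis using that u(1) by blast
qed


section \<open>Wigner matrices acting on binary forms\<close>

locale wigner_rep =
  fixes l :: real and ix :: "'n::finite \<Rightarrow> real"
  assumes half_integer: "2 * l \<in> \<nat>" and labelling: "bij_betw ix UNIV (weights l)"
begin

definition N :: nat where "N = nat \<lfloor>2 * l\<rfloor>"

definition k :: "'n \<Rightarrow> nat" where "k m = nat \<lfloor>l + ix m\<rfloor>"

definition wt :: "'n \<Rightarrow> real" where "wt m = sqrt (real (N choose k m))"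

definition pv :: "complex \<Rightarrow> complex \<Rightarrow> complex^'n" where "pv x y = (\<chi> m. psi l (ix m) x y)"

definition ev :: "complex^'n \<Rightarrow> complex \<Rightarrow> complex \<Rightarrow> complex" where
  "ev v x y = (\<Sum>m\<in>UNIV. pv x y $ m * v $ m)"

text \<open>Taken on all pairs, not only unit ones: by \<open>is_wigner_ex1\<close> the identity
  determines a matrix for every \<open>g\<close>, so \<open>D\<close> lives on all quaternions and
  is homogeneous of degree \<open>N\<close>.\<close>

definition D :: "complex \<times> complex \<Rightarrow> complex^'n^'n" where
  "D q = wigner l ix (hmat (fst q) (snd q))"

lemma N: "real N = 2 * l"
  using half_integer by (auto simp: N_def elim!: Nats_cases)

lemma ix_k: "ix m = real (k m) - l" and k_le: "k m \<le> N"
proof -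
  have "ix m \<in> weights l" using labelling by (auto simp: bij_betw_def)
  then obtain j :: nat where "ix m = real j - l" "real j \<le> 2 * l" by (auto simp: weights_def)
  then show "ix m = real (k m) - l" "k m \<le> N" using N by (auto simp: k_def)
qed

lemma bij_k: "bij_betw k UNIV {..N}"
  unfolding bij_betw_def
proof (intro conjI equalityI subsetI)
  show "inj k" using labelling ix_k by (metis bij_betw_def inj_on_def)
next
  fix j assume "j \<in> {..N}"
  then have "real j - l \<in> weights l" using N by (auto simp: weights_def)
  then obtain m where "ix m = real j - l" using labelling by (metis bij_betw_def imageE)
  then have "k m = j" using ix_k[of m] by simp
  then show "j \<in> range k" by blast
qed (use k_le in auto)

lemma k_inject: "k m = k m' \<longleftrightarrow> m = m'"
  using bij_k by (auto simp: bij_betw_def dest: injD)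

lemma sum_k: "(\<Sum>m\<in>UNIV. h (k m)) = (\<Sum>j\<le>N. h j)"
  by (rule sum.reindex_bij_betw[OF bij_k])

lemma wt_pos: "wt m > 0"
  using k_le[of m] by (simp add: wt_def)

lemma pv_nth: "pv x y $ m = of_real (wt m) * x ^ k m * y ^ (N - k m)"
proof -
  have "l - ix m = real (N - k m)" using k_le[of m] N ix_k[of m] by (simp add: of_nat_diff)
  then show ?thesis by (simp add: pv_def psi_def wt_def k_def N_def)
qed

lemma ev_linear:
  "ev (v + w) x y = ev v x y + ev w x y" "ev (v - w) x y = ev v x y - ev w x y"
  "ev (c *s v) x y = c * ev v x y" "ev 0 x y = 0"
  by (simp_all add: ev_def algebra_simps sum.distrib sum_subtractf sum_distrib_left)

text \<open>At \<open>y = 1\<close> the form is a univariate polynomial with coefficients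
  \<open>wt m * v $ m\<close> in distinct degrees \<open>k m\<close>, and no \<open>wt m\<close>
  vanishes.\<close>

lemma ev_eq_0:
  assumes "\<And>x. ev v x 1 = 0"
  shows "v = 0"
proof -
  define i where "i = inv_into UNIV k"
  have i: "i (k m) = m" for m
    using bij_k by (simp add: i_def bij_betw_def)
  define c where "c j = of_real (wt (i j)) * v $ i j" for j
  have "(\<Sum>j\<le>N. c j * x ^ j) = 0" for x
    using assms[of x] sum_k[of "\<lambda>j. c j * x ^ j"] by (simp add: c_def i ev_def pv_nth mult_ac)
  then have "c (k m) = 0" for m
    using polyfun_eq_0[of c N] k_le[of m] by blast
  then have "v $ m = 0" for m
    using wt_pos[of m] by (simp add: c_def i) (metis less_irrefl)
  then show ?thesis by (simp add: vec_eq_iff)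
qed

lemma ev_inject:
  assumes "\<And>x. ev v x 1 = ev w x 1"
  shows "v = w"
  using ev_eq_0[of "v - w"] assms by (simp add: ev_linear)

lemma ev_axis: "ev (axis m 1) x y = pv x y $ m"
  by (simp add: ev_def axis_def if_distrib cong: if_cong)

lemma ev_D: "ev (D q *v v) x y = ev v (cnj (fst q) * x + cnj (snd q) * y) (- snd q * x + fst q * y)"
proof -
  have D: "(\<Sum>m\<in>UNIV. pv x y $ m * D q $ m $ s) =
      pv (cnj (fst q) * x + cnj (snd q) * y) (- snd q * x + fst q * y) $ s" for s
    using theI'[OF is_wigner_ex1[OF half_integer labelling, of "hmat (fst q) (snd q)"]]
    by (simp add: D_def wigner_def is_wigner_def pv_def)
  have "ev (D q *v v) x y = (\<Sum>m\<in>UNIV. \<Sum>s\<in>UNIV. pv x y $ m * D q $ m $ s * v $ s)"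
    by (simp add: ev_def matrix_vector_mult_def sum_distrib_left mult_ac)
  also have "\<dots> = (\<Sum>s\<in>UNIV. (\<Sum>m\<in>UNIV. pv x y $ m * D q $ m $ s) * v $ s)"
    by (subst sum.swap) (simp add: sum_distrib_right)
  finally show ?thesis by (simp add: D ev_def)
qed

lemma ev_homogeneous: "ev v (t * x) (t * y) = t ^ N * ev v x y"
proof -
  have "t ^ k m * t ^ (N - k m) = t ^ N" for m
    using k_le[of m] by (simp add: power_add[symmetric])
  then have "pv (t * x) (t * y) $ m = t ^ N * pv x y $ m" for m
    by (simp add: pv_nth power_mult_distrib mult_ac)
  then show ?thesis by (simp add: ev_def sum_distrib_left mult_ac)
qed

text \<open>The substitution in \<open>ev_D\<close> is by the conjugate transpose of
  \<open>hmat\<close>, and substitution and conjugate transposition both reverse products.\<close>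

lemma D_mult: "D p *v (D q *v v) = D (qmul p q) *v v"
  by (rule ev_inject) (simp add: ev_D qmul_def algebra_simps)

lemma D_one: "D (1, 0) *v v = v"
  by (rule ev_inject) (simp add: ev_D)

text \<open>Homogeneity turns statements on unit quaternions into statements on nonzero ones, and
  zero sets into cones.\<close>

lemma D_scale: "D (t *\<^sub>R q) *v v = t ^ N *\<^sub>R (D q *v v)"
proof (rule ev_inject)
  fix x
  have "ev (D (t *\<^sub>R q) *v v) x 1 = ev v (of_real t * (cnj (fst q) * x + cnj (snd q) * 1))
      (of_real t * (- snd q * x + fst q * 1))"
    unfolding ev_D by (simp add: scaleR_conv_of_real algebra_simps)
  also have "\<dots> = of_real t ^ N * ev (D q *v v) x 1"
    unfolding ev_homogeneous ev_D by simp
  also have "\<dots> = ev (of_real t ^ N *s (D q *v v)) x 1"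
    by (simp add: ev_linear)
  also have "of_real t ^ N *s (D q *v v) = t ^ N *\<^sub>R (D q *v v)"
    by (simp only: of_real_power[symmetric] of_real_smult)
  finally show "ev (D (t *\<^sub>R q) *v v) x 1 = ev (t ^ N *\<^sub>R (D q *v v)) x 1" .
qed

lemma D_qcnj: "norm q = 1 \<Longrightarrow> D (qcnj q) *v (D q *v v) = v" "norm q = 1 \<Longrightarrow> D q *v (D (qcnj q) *v v) = v"
  by (simp_all add: D_mult qcnj_qmul qmul_qcnj D_one)

text \<open>The coherent vectors of quantum mechanics.\<close>

definition pv_cnj :: "complex \<Rightarrow> complex \<Rightarrow> complex^'n" where "pv_cnj x y = (\<chi> m. cnj (pv x y $ m))"

lemma herm_pv_cnj: "herm (pv_cnj x y) v = ev v x y"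
  by (simp add: herm_def pv_cnj_def ev_def)

text \<open>The binomial theorem, for which the square roots in \<open>psi\<close> are made: a
  coherent vector is the \<open>N\<close>-th power of a linear form. So \<open>D\<close> carries
  coherent vectors to coherent vectors.\<close>

lemma ev_pv_cnj: "ev (pv_cnj x' y') x y = (x * cnj x' + y * cnj y') ^ N"
proof -
  have "complex_of_real (wt m) * of_real (wt m) = of_nat (N choose k m)" for m
    by (simp add: wt_def of_real_mult[symmetric] del: of_real_mult)
  then have "pv x y $ m * cnj (pv x' y' $ m) =
      of_nat (N choose k m) * (x * cnj x') ^ k m * (y * cnj y') ^ (N - k m)" for m
    by (simp add: pv_nth power_mult_distrib mult_ac)
  then show ?thesis
    by (simp add: ev_def pv_cnj_def binomial_ring sum_k[symmetric])
qed

lemma D_pv_cnj: "D q *v pv_cnj x y = pv_cnj (fst q * x - cnj (snd q) * y) (snd q * x + cnj (fst q) * y)"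
  by (rule ev_inject) (simp add: ev_D ev_pv_cnj algebra_simps)

text \<open>The adjoint is computed on coherent vectors: they represent evaluation by
  \<open>herm_pv_cnj\<close>, and \<open>D q\<close> moves them by \<open>D_pv_cnj\<close>.\<close>

lemma herm_D: "herm (D q *v x) y = herm x (D (qcnj q) *v y)"
proof -
  define M :: "complex^'n^'n" where "M = (\<chi> i j. cnj (D q $ j $ i))"
  have "ev (M *v y) a 1 = ev (D (qcnj q) *v y) a 1" for a
  proof -
    have "ev (M *v y) a 1 = herm (D q *v pv_cnj a 1) y"
      by (simp add: herm_matrix M_def herm_pv_cnj)
    also have "\<dots> = ev (D (qcnj q) *v y) a 1"
      by (simp add: D_pv_cnj herm_pv_cnj ev_D qcnj_def)
    finally show ?thesis .
  qed
  then have "M *v y = D (qcnj q) *v y" by (rule ev_inject)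
  then show ?thesis by (simp add: herm_matrix M_def)
qed

lemma norm_D: "norm q = 1 \<Longrightarrow> norm (D q *v x) = norm x"
proof -
  assume "norm q = 1"
  then have "herm (D q *v x) (D q *v x) = herm x x" by (simp add: herm_D D_qcnj)
  then have "(norm (D q *v x))\<^sup>2 = (norm x)\<^sup>2" by (simp only: herm_self of_real_eq_iff)
  then show ?thesis by (simp add: power2_eq_iff_nonneg)
qed

section \<open>Recovering a vector from values of its form\<close>

lemma polynomial_function_ev [poly_intros]:
  "\<lbrakk>polynomial_function v; polynomial_function f; polynomial_function g\<rbrakk> \<Longrightarrow>
    polynomial_function (\<lambda>x. ev (v x) (f x) (g x))"
  unfolding ev_def pv_nth by (intro poly_intros)

text \<open>The vectors \<open>pv x y\<close> span, since the conjugate of a vector annihilating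
  them has vanishing form. So each coordinate is a finite combination of evaluations.\<close>

lemma interpolation:
  obtains Z c where "finite (Z :: (complex \<times> complex) set)"
    "\<And>v m. v $ m = (\<Sum>z\<in>Z. c m z * ev v (fst z) (snd z))"
proof -
  let ?R = "(\<lambda>(x, y). pv x y) ` UNIV"
  have span: "vec.span ?R = UNIV"
  proof (rule ccontr)
    assume "vec.span ?R \<noteq> UNIV"
    then obtain u where u: "u \<noteq> 0" "\<And>a. a \<in> ?R \<Longrightarrow> herm u a = 0"
      using vec_span_annihilator by blast
    have "ev (\<chi> m. cnj (u $ m)) x 1 = 0" for x
      using u(2)[of "pv x 1"] by (auto simp: herm_def ev_def mult.commute)
    then have "(\<chi> m. cnj (u $ m)) = 0" by (rule ev_eq_0)
    then show False using u(1) by (simp add: vec_eq_iff)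
  qed
  have "\<exists>Z c. finite Z \<and> axis m 1 = (\<Sum>z\<in>Z. c z *s pv (fst z) (snd z))" for m :: 'n
  proof -
    have "axis m 1 \<in> vec.span ?R" by (simp add: span)
    then obtain t r where t: "finite t" "t \<subseteq> ?R" "(\<Sum>a\<in>t. r a *s a) = axis m 1"
      unfolding vec.span_explicit by force
    obtain Z where Z: "inj_on (\<lambda>(x, y). pv x y) Z" "t = (\<lambda>(x, y). pv x y) ` Z"
      using subset_image_inj[THEN iffD1, OF t(2)] by blast
    have "finite Z" using t(1) Z finite_image_iff by blast
    moreover have "axis m 1 = (\<Sum>z\<in>Z. r (pv (fst z) (snd z)) *s pv (fst z) (snd z))"
      unfolding t(3)[symmetric] Z(2) by (subst sum.reindex[OF Z(1)]) (simp add: case_prod_unfold)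
    ultimately show ?thesis by (intro exI[of _ Z] exI[of _ "\<lambda>z. r (pv (fst z) (snd z))"]) auto
  qed
  then obtain Z c where Z: "\<And>m. finite (Z m)"
    "\<And>m. axis m 1 = (\<Sum>z\<in>Z m. c m z *s pv (fst z) (snd z))" by metis
  show thesis
  proof
    show "finite (\<Union>m. Z m)" using Z(1) by simp
    fix v :: "complex^'n" and m
    have "v $ m = (\<Sum>i\<in>UNIV. (axis m 1 :: complex^'n) $ i * v $ i)"
      by (simp add: axis_def if_distrib if_distribR cong: if_cong)
    also have "\<dots> = (\<Sum>i\<in>UNIV. \<Sum>z\<in>Z m. c m z * (pv (fst z) (snd z) $ i * v $ i))"
      unfolding Z(2) by (simp add: sum_distrib_right mult.assoc)
    also have "\<dots> = (\<Sum>z\<in>Z m. c m z * ev v (fst z) (snd z))"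
      by (subst sum.swap) (simp add: ev_def sum_distrib_left)
    also have "\<dots> = (\<Sum>z\<in>(\<Union>m. Z m). (if z \<in> Z m then c m z else 0) * ev v (fst z) (snd z))"
      using Z(1) by (intro sum.mono_neutral_cong_left) auto
    finally show "v $ m = (\<Sum>z\<in>(\<Union>m. Z m). (if z \<in> Z m then c m z else 0) * ev v (fst z) (snd z))" .
  qed
qed

text \<open>Interpolation: \<open>of_values F\<close> is meaningful only if \<open>F\<close> is the form of some vector. It depends on
  finitely many values of \<open>F\<close>, so it is polynomial in every parameter in which \<open>F\<close> is.\<close>

definition of_values :: "(complex \<Rightarrow> complex \<Rightarrow> complex) \<Rightarrow> complex^'n" where
  "of_values = (SOME r. (\<forall>v. r (ev v) = v) \<and>
     (\<exists>Z c. finite Z \<and> r = (\<lambda>F. \<chi> m. \<Sum>z\<in>Z. c m z * F (fst z) (snd z))))"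

lemma of_values_spec:
  "(\<forall>v. of_values (ev v) = v) \<and> (\<exists>Z c. finite Z \<and> of_values = (\<lambda>F. \<chi> m. \<Sum>z\<in>Z. c m z * F (fst z) (snd z)))"
proof -
  obtain Z c where Z: "finite (Z :: (complex \<times> complex) set)"
    "\<And>v m. v $ m = (\<Sum>z\<in>Z. c m z * ev v (fst z) (snd z))" by (rule interpolation) (rule that)
  then have "\<exists>r. (\<forall>v. r (ev v) = v) \<and>
     (\<exists>Z c. finite Z \<and> r = (\<lambda>F. \<chi> m. \<Sum>z\<in>Z. c m z * F (fst z) (snd z)))"
    by (intro exI[of _ "\<lambda>F. \<chi> m. \<Sum>z\<in>Z. c m z * F (fst z) (snd z)"]) (auto simp: vec_eq_iff simp flip: Z(2))
  from someI_ex[OF this] show ?thesis unfolding of_values_def by blast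
qed

lemma of_values_ev: "of_values (ev v) = v"
  using of_values_spec by blast

lemma polynomial_function_of_values [poly_intros]:
  fixes F :: "'a::real_normed_vector \<Rightarrow> complex \<Rightarrow> complex \<Rightarrow> complex"
  assumes "\<And>x y. polynomial_function (\<lambda>a. F a x y)"
  shows "polynomial_function (\<lambda>a. of_values (F a))"
proof -
  obtain Z c where "of_values = (\<lambda>F. \<chi> m. \<Sum>z\<in>Z. c m z * F (fst z) (snd z))"
    using of_values_spec by blast
  then show ?thesis by (simp only:) (intro poly_intros assms)
qed

text \<open>The matrix is given by a definite description, so polynomiality is read off the form: by
  \<open>ev_D\<close> each value is polynomial in \<open>q\<close>, and \<open>of_values\<close>
  needs finitely many.\<close>

lemma polynomial_function_D_apply:
  "polynomial_function (\<lambda>q. D q *v v)"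
proof -
  have "polynomial_function (\<lambda>q. of_values (ev (D q *v v)))"
    unfolding ev_D by (intro poly_intros)
  then show ?thesis by (simp add: of_values_ev)
qed

lemma wigner_orbit_eq: "wigner_orbit l ix v = (\<lambda>q. D q *v v) ` sphere 0 1"
  by (simp add: wigner_orbit_def SU2_image image_image D_def)

text \<open>The weight \<open>cnj t ^ k m * t ^ (N - k m)\<close> is written with nonnegative powers
  of \<open>t\<^sup>2\<close>, so that sums over weights become a common unit factor times a
  polynomial in \<open>t\<^sup>2\<close>.\<close>

lemma D_torus: "norm t = 1 \<Longrightarrow> D (t, 0) *v v = (\<chi> m. cnj t ^ N * (t\<^sup>2) ^ (N - k m) * v $ m)"
proof (rule ev_inject)
  fix x assume t: "norm t = 1"
  then have tt: "t * cnj t = 1" by (simp add: complex_norm_square[symmetric])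
  have "cnj t ^ k m * t ^ (N - k m) = cnj t ^ N * (t\<^sup>2) ^ (N - k m)" for m
  proof -
    have "cnj t ^ N = cnj t ^ k m * cnj t ^ (N - k m)"
      using k_le[of m] by (simp add: power_add[symmetric])
    then have "cnj t ^ N * (t\<^sup>2) ^ (N - k m) = cnj t ^ k m * (cnj t ^ (N - k m) * t ^ (N - k m)) * t ^ (N - k m)"
      by (simp add: power2_eq_square power_mult_distrib mult_ac)
    also have "cnj t ^ (N - k m) * t ^ (N - k m) = 1"
      using tt by (simp add: power_mult_distrib[symmetric] mult.commute)
    finally show ?thesis by simp
  qed
  then have pv: "pv (cnj t * x) t $ m = pv x 1 $ m * (cnj t ^ N * (t\<^sup>2) ^ (N - k m))" for m
    by (simp add: pv_nth power_mult_distrib mult_ac)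
  then show "ev (D (t, 0) *v v) x 1 = ev (\<chi> m. cnj t ^ N * (t\<^sup>2) ^ (N - k m) * v $ m) x 1"
    unfolding ev_D by (simp add: ev_def pv mult.assoc)
qed

lemma pv_cnj_1_0: "pv_cnj 1 0 = axis m 1" if "k m = N"
proof (rule ev_inject)
  fix x show "ev (pv_cnj 1 0) x 1 = ev (axis m 1) x 1"
    using that by (simp add: ev_pv_cnj ev_axis pv_nth wt_def)
qed

text \<open>Averaging over the torus extracts the component of highest weight, whose orbit consists
  of the coherent vectors.\<close>

lemma irreducible:
  assumes v: "v \<noteq> 0" and u: "\<And>q. norm q = 1 \<Longrightarrow> herm u (D q *v v) = 0"
  shows "u = 0"
proof -
  have u': "herm u (D q *v v) = 0" if "q \<noteq> 0" for q
  proof -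
    have "D q *v v = D (norm q *\<^sub>R (q /\<^sub>R norm q)) *v v" using that by simp
    also have "\<dots> = norm q ^ N *\<^sub>R (D (q /\<^sub>R norm q) *v v)" by (rule D_scale)
    finally show ?thesis using u[of "q /\<^sub>R norm q"] that by (simp add: herm_linear)
  qed
  obtain M where M: "k M = N"
    using bij_k by (metis atMost_iff bij_betw_iff_bijections order_refl)
  obtain x where x: "ev v x 1 \<noteq> 0" using ev_eq_0 v by blast
  \<comment> \<open>\<open>D p\<close> carries the value of the form at \<open>(x, 1)\<close> to
    \<open>(1, 0)\<close>, where only the highest weight contributes; thus
    \<open>w $ M \<noteq> 0\<close>.\<close>
  define p where "p = (cnj x, - 1 :: complex)"
  have p: "p \<noteq> 0" by (simp add: p_def zero_prod_def)
  define w where "w = D p *v v"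
  have "ev w 1 0 = ev v x 1" by (simp add: w_def ev_D p_def)
  moreover have "ev w 1 0 = w $ M"
    using herm_pv_cnj[of 1 0 w] pv_cnj_1_0[OF M] by (simp add: herm_def axis_def if_distrib if_distribR cong: if_cong)
  ultimately have wM: "w $ M \<noteq> 0" using x by simp
  have top: "herm u (D q *v axis M 1) = 0" if q: "q \<noteq> 0" for q
  proof -
    define c where "c m = herm u (D q *v axis m 1) * w $ m" for m
    have sum0: "(\<Sum>m\<in>UNIV. c m * (t\<^sup>2) ^ (N - k m)) = 0" if t: "norm t = 1" for t
    proof -
      have "0 = herm u (D (qmul (qmul q (t, 0)) p) *v v)"
      proof (rule u'[symmetric])
        have "norm (qmul (qmul q (t, 0)) p) \<noteq> 0"
          using q p t by (simp add: norm_qmul norm_Pair)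
        then show "qmul (qmul q (t, 0)) p \<noteq> 0" by auto
      qed
      also have "\<dots> = herm u (D q *v (\<chi> m. cnj t ^ N * (t\<^sup>2) ^ (N - k m) * w $ m))"
        using t by (simp add: D_mult[symmetric] D_torus w_def)
      also have "\<dots> = (\<Sum>m\<in>UNIV. cnj t ^ N * (t\<^sup>2) ^ (N - k m) * w $ m * herm u (D q *v axis m 1))"
      proof -
        have lin: "herm u (D q *v y) = (\<Sum>m\<in>UNIV. y $ m * herm u (D q *v axis m 1))" for y :: "complex^'n"
        proof -
          have "herm u (D q *v y) = (\<Sum>i\<in>UNIV. \<Sum>m\<in>UNIV. cnj (u $ i) * (D q $ i $ m * y $ m))"
            by (simp add: herm_def matrix_vector_mult_def sum_distrib_left)
          also have "\<dots> = (\<Sum>m\<in>UNIV. y $ m * (\<Sum>i\<in>UNIV. cnj (u $ i) * D q $ i $ m))"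
            by (subst sum.swap) (simp add: sum_distrib_left mult_ac)
          finally show ?thesis
            by (simp add: herm_def matrix_vector_mult_def axis_def if_distrib cong: if_cong)
        qed
        show ?thesis by (subst lin) simp
      qed
      also have "\<dots> = cnj t ^ N * (\<Sum>m\<in>UNIV. c m * (t\<^sup>2) ^ (N - k m))"
        by (simp add: c_def sum_distrib_left mult_ac)
      finally show ?thesis using t by auto
    qed
    define i where "i = inv_into UNIV k"
    have i: "i (k m) = m" for m
      using bij_k by (simp add: i_def bij_betw_def)
    \<comment> \<open>Every unit \<open>s\<close> is some \<open>t\<^sup>2\<close>. The exponents
      are reversed so that the highest weight becomes the constant term.\<close>
    have poly0: "(\<Sum>j\<le>N. c (i (N - j)) * s ^ j) = 0" if "norm s = 1" for s
    proof -
      have "norm (csqrt s) = 1" using that by (simp add: norm_csqrt)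
      from sum0[OF this] have "(\<Sum>m\<in>UNIV. c m * s ^ (N - k m)) = 0" by simp
      then have "(\<Sum>j\<le>N. c (i j) * s ^ (N - j)) = 0"
        using sum_k[of "\<lambda>j. c (i j) * s ^ (N - j)"] by (simp add: i)
      then show ?thesis
        by (subst sum.atLeastAtMost_rev[of _ 0 N, simplified atLeast0AtMost, simplified]) simp
    qed
    have "infinite (sphere (0::complex) 1)"
    proof
      assume "finite (sphere (0::complex) 1)"
      moreover have "connected (sphere (0::complex) 1)" by (rule connected_sphere) simp
      ultimately obtain a where "sphere (0::complex) 1 \<subseteq> {a}"
        by (auto simp: connected_finite_iff_sing)
      moreover have "1 \<in> sphere (0::complex) 1" "-1 \<in> sphere (0::complex) 1" by simp_all
      ultimately have "(1::complex) = -1" by blast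
      then show False by simp
    qed
    have "c (i N) = 0"
    proof (rule ccontr)
      assume "c (i N) \<noteq> 0"
      then have "finite {s. (\<Sum>j\<le>N. c (i (N - j)) * s ^ j) = 0}"
        using polyfun_finite_roots[of "\<lambda>j. c (i (N - j))" N] by (metis diff_zero le0)
      then have "finite (sphere (0::complex) 1)"
        by (rule finite_subset[rotated]) (use poly0 in auto)
      then show False using \<open>infinite _\<close> by simp
    qed
    then show ?thesis using wM i[of M] M by (simp add: c_def)
  qed
  \<comment> \<open>\<open>D (cnj x, 1)\<close> sends the highest weight vector to the coherent
    vector at \<open>(cnj x, 1)\<close>, whose pairing with \<open>u\<close> is the form of the
    conjugate of \<open>u\<close> at \<open>(x, 1)\<close>.\<close>
  have "ev (\<chi> m. cnj (u $ m)) x 1 = 0" for x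
  proof -
    have "D (cnj x, 1) *v axis M 1 = pv_cnj (cnj x) 1"
      by (simp add: pv_cnj_1_0[OF M, symmetric] D_pv_cnj)
    then have "herm u (pv_cnj (cnj x) 1) = 0" using top[of "(cnj x, 1)"] by (simp add: zero_prod_def)
    moreover have "herm u (pv_cnj (cnj x) 1) = ev (\<chi> m. cnj (u $ m)) x 1"
      by (simp add: herm_def pv_cnj_def ev_def pv_nth mult_ac)
    ultimately show ?thesis by simp
  qed
  then have "(\<chi> m. cnj (u $ m)) = 0" by (rule ev_eq_0)
  then show ?thesis by (simp add: vec_eq_iff)
qed

end

section \<open>Quaternion products and the Hopf map\<close>

lemma scaleR_matrix_vector: "(c *\<^sub>R M) *v x = c *\<^sub>R (M *v x)" for M :: "complex^'n::finite^'m::finite"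
  by (simp add: matrix_vector_mult_def vec_eq_iff scaleR_sum_right)

lemma inner_qmul_left: "qmul q p \<bullet> r = p \<bullet> qmul (qcnj q) r"
  by (simp add: qmul_def qcnj_def inner_prod_def inner_complex_def algebra_simps)

lemma inner_qmul_right: "qmul p (qcnj q) \<bullet> r = p \<bullet> qmul r q"
  by (simp add: qmul_def qcnj_def inner_prod_def inner_complex_def algebra_simps)

lemma polynomial_function_qmul [poly_intros]:
  "polynomial_function f \<Longrightarrow> polynomial_function g \<Longrightarrow> polynomial_function (\<lambda>x. qmul (f x) (g x))"
  unfolding qmul_def by (intro poly_intros)

text \<open>The Hopf map. Up to constants its coordinates are the diagonal difference and the
  off-diagonal entry of the orthogonal projection onto the line of \<open>q\<close>.\<close>

lemma hopf_image:
  assumes "norm q = 1"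
  shows "qmul (qmul q (\<i>, 0)) (qcnj q) =
    (\<i> * of_real ((cmod (fst q))\<^sup>2 - (cmod (snd q))\<^sup>2), 2 * \<i> * snd q * cnj (fst q))"
  unfolding of_real_diff complex_norm_square by (simp add: qmul_def qcnj_def algebra_simps)

lemma hopf_surj:
  assumes h: "norm h = 1" "Re (fst h) = 0"
  obtains q where "norm q = 1" "h = qmul (qmul q (\<i>, 0)) (qcnj q)"
proof -
  define c where "c = Im (fst h)"
  have f: "fst h = \<i> * of_real c" using h(2) by (simp add: complex_eq_iff c_def)
  have n: "c\<^sup>2 + (cmod (snd h))\<^sup>2 = 1"
    using h(1) norm_sq_pair[of h] by (simp add: f norm_mult)
  show thesis
  proof (cases "c = - 1")
    case True
    then have "snd h = 0" using n by simp
    then show thesis using f True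
      by (intro that[of "(0, 1)"]) (simp_all add: norm_Pair qmul_def qcnj_def prod_eq_iff)
  next
    case False
    have "c\<^sup>2 \<le> 1\<^sup>2" using n by (smt (verit) zero_le_power2 power_one)
    then have "\<bar>c\<bar> \<le> 1" using abs_le_square_iff[of c 1] by simp
    then have c: "1 + c > 0" using False by linarith
    \<comment> \<open>Solve for \<open>q\<close> with real positive first entry \<open>r\<close>:
      the two squared moduli add up to 1 and differ by \<open>c\<close>, and the second coordinate
      of \<open>h\<close> is \<open>2 * \<i> * snd q * r\<close>. At \<open>c = - 1\<close> this
      \<open>r\<close> would be 0.\<close>
    define r where "r = sqrt ((1 + c) / 2)"
    have r: "r > 0" "r\<^sup>2 = (1 + c) / 2" using c by (simp_all add: r_def)
    define q where "q = (complex_of_real r, snd h / (2 * \<i> * of_real r))"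
    have "(cmod (snd q))\<^sup>2 = (cmod (snd h))\<^sup>2 / (4 * r\<^sup>2)"
      using r(1) by (simp add: q_def norm_divide norm_mult power_divide power_mult_distrib)
    also have "\<dots> = (1 - c) / 2"
    proof -
      have "(cmod (snd h))\<^sup>2 = (1 - c) * (1 + c)" using n by (simp add: algebra_simps power2_eq_square)
      then show ?thesis using c by (simp add: r(2) field_simps)
    qed
    finally have s: "(cmod (snd q))\<^sup>2 = (1 - c) / 2" .
    have fq: "(cmod (fst q))\<^sup>2 = (1 + c) / 2" using r by (simp add: q_def)
    have "(norm q)\<^sup>2 = 1\<^sup>2" using s fq by (simp add: norm_sq_pair add_divide_distrib[symmetric])
    then have "norm q = 1" by (simp only: power2_eq_iff_nonneg norm_ge_zero zero_le_one)
    moreover have "h = qmul (qmul q (\<i>, 0)) (qcnj q)"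
      unfolding hopf_image[OF \<open>norm q = 1\<close>] s fq
      using r(1) f by (simp add: prod_eq_iff q_def diff_divide_distrib[symmetric])
    ultimately show thesis by (rule that)
  qed
qed

context wigner_rep
begin


section \<open>The derived representation and its moment map\<close>

lemma polynomial_function_D: "polynomial_function D"
proof -
  have "polynomial_function (\<lambda>q. \<chi> m s. (D q *v axis s 1) $ m)"
    by (intro poly_intros polynomial_function_D_apply)
  moreover have "(\<chi> m s. (D q *v axis s 1) $ m) = D q" for q
    by (simp add: vec_eq_iff matrix_vector_mult_def axis_def if_distrib cong: if_cong)
  ultimately show ?thesis by simp
qed

lemma polynomial_function_D_compose [poly_intros]:
  "polynomial_function f \<Longrightarrow> polynomial_function (\<lambda>x. D (f x))"
  by (rule polynomial_function_comp[OF _ polynomial_function_D])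

text \<open>For purely imaginary \<open>d\<close> this is the Lie algebra representation; the real
  direction acts as multiplication by \<open>N\<close>.\<close>

definition dD :: "complex \<times> complex \<Rightarrow> complex^'n^'n" where
  "dD = frechet_derivative D (at (1, 0))"

lemma has_derivative_D: "(D has_derivative dD) (at (1, 0))"
  unfolding dD_def using polynomial_function_differentiable[OF polynomial_function_D]
  by (simp add: frechet_derivative_works)

lemma linear_dD: "linear dD"
  using has_derivative_D by (rule has_derivative_linear)

lemma has_derivative_D_apply: "((\<lambda>q. D q *v v) has_derivative (\<lambda>d. dD d *v v)) (at (1, 0))"
proof -
  have "linear (\<lambda>M. M *v v)"
    by (simp add: linear_iff matrix_vector_mult_def vec_eq_iff algebra_simps sum.distrib scaleR_sum_right)
  then have "bounded_linear (\<lambda>M. M *v v)" by (simp add: linear_linear)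
  then show ?thesis by (rule bounded_linear.has_derivative[OF _ has_derivative_D])
qed

text \<open>Multiplicativity gives the same identity with \<open>D p\<close> in place of
  \<open>dD d\<close>; differentiate it at \<open>p = (1, 0)\<close>.\<close>

lemma dD_conj:
  assumes "norm q = 1"
  shows "D q *v (dD d *v (D (qcnj q) *v v)) = dD (qmul (qmul q d) (qcnj q)) *v v"
proof -
  have one: "qmul (qmul q (1, 0)) (qcnj q) = (1, 0)"
    using assms by (simp add: qmul_qcnj)
  have "linear (\<lambda>p. qmul (qmul q p) (qcnj q))"
    by (simp add: linear_iff qmul_def prod_eq_iff algebra_simps)
  then have "((\<lambda>p. qmul (qmul q p) (qcnj q)) has_derivative (\<lambda>p. qmul (qmul q p) (qcnj q))) (at (1, 0))"
    by (intro bounded_linear_imp_has_derivative) (simp add: linear_linear)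
  from has_derivative_compose[OF this, of "\<lambda>q. D q *v v" "\<lambda>d. dD d *v v"]
  have "((\<lambda>p. D (qmul (qmul q p) (qcnj q)) *v v) has_derivative
      (\<lambda>d. dD (qmul (qmul q d) (qcnj q)) *v v)) (at (1, 0))"
    unfolding one by (simp add: has_derivative_D_apply)
  moreover have "((\<lambda>p. D q *v (D p *v (D (qcnj q) *v v))) has_derivative
      (\<lambda>d. D q *v (dD d *v (D (qcnj q) *v v)))) (at (1, 0))"
  proof -
    have "linear ((*v) (D q))"
      by (simp add: linear_iff matrix_vector_mult_def vec_eq_iff algebra_simps sum.distrib scaleR_sum_right)
    then have "bounded_linear ((*v) (D q))" by (simp add: linear_linear)
    then show ?thesis by (rule bounded_linear.has_derivative[OF _ has_derivative_D_apply])
  qed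
  then have "((\<lambda>p. D (qmul (qmul q p) (qcnj q)) *v v) has_derivative
      (\<lambda>d. D q *v (dD d *v (D (qcnj q) *v v)))) (at (1, 0))"
    by (simp add: D_mult qmul_assoc)
  ultimately show ?thesis by (metis has_derivative_unique)
qed

lemma ev_dD:
  "((\<lambda>q. ev v (cnj (fst q) * x + cnj (snd q) * y) (- snd q * x + fst q * y))
     has_derivative (\<lambda>d. ev (dD d *v v) x y)) (at (1, 0))"
proof -
  have "linear (\<lambda>v. ev v x y)"
    by (simp add: linear_iff ev_def algebra_simps sum.distrib scaleR_sum_right)
  then have "bounded_linear (\<lambda>v. ev v x y)" by (simp add: linear_linear)
  from bounded_linear.has_derivative[OF this has_derivative_D_apply] show ?thesis
    by (simp only: ev_D)
qed

text \<open>The truncated exponents \<open>k m - 1\<close> and \<open>N - k m - 1\<close> are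
  harmless at the ends, because their factors vanish there.\<close>

lemma ev_dD_axis: "ev (dD d *v axis m 1) x y = of_real (wt m) *
    (of_nat (k m) * (cnj (fst d) * x + cnj (snd d) * y) * x ^ (k m - 1) * y ^ (N - k m) +
     of_nat (N - k m) * (- snd d * x + fst d * y) * x ^ k m * y ^ (N - k m - 1))"
  (is "_ = ?G d")
proof -
  have "((\<lambda>q. pv (cnj (fst q) * x + cnj (snd q) * y) (- snd q * x + fst q * y) $ m)
     has_derivative (\<lambda>d. ev (dD d *v axis m 1) x y)) (at (1, 0))"
    using ev_dD[of "axis m 1"] by (simp add: ev_axis)
  moreover have "((\<lambda>q. pv (cnj (fst q) * x + cnj (snd q) * y) (- snd q * x + fst q * y) $ m)
     has_derivative (\<lambda>d. of_real (wt m) *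
    (of_nat (k m) * (cnj (fst d) * x + cnj (snd d) * y) * x ^ (k m - 1) * y ^ (N - k m) +
     of_nat (N - k m) * (- snd d * x + fst d * y) * x ^ k m * y ^ (N - k m - 1)))) (at (1, 0))"
    unfolding pv_nth
    by (auto intro!: derivative_eq_intros bounded_linear.has_derivative[OF bounded_linear_cnj]
        simp: algebra_simps)
  ultimately have "(\<lambda>d. ev (dD d *v axis m 1) x y) = ?G"
    by (rule has_derivative_unique)
  then show ?thesis by (rule fun_cong)
qed

lemma dD_torus: "dD (t, 0) *v axis m 1 = (of_nat (k m) * cnj t + of_nat (N - k m) * t) *s axis m 1"
proof (rule ev_inject)
  fix x
  have "of_nat (k m) * (cnj t * x) * x ^ (k m - 1) = of_nat (k m) * cnj t * x ^ k m"
    by (cases "k m") simp_all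
  then show "ev (dD (t, 0) *v axis m 1) x 1 =
      ev ((of_nat (k m) * cnj t + of_nat (N - k m) * t) *s axis m 1) x 1"
    by (auto simp: ev_dD_axis ev_linear ev_axis pv_nth algebra_simps)
qed

text \<open>The moment map: the functional \<open>d \<mapsto> Im (herm x (dD d *v x))\<close>,
  turned into a quaternion by the real inner product. It is purely imaginary, because the real
  direction acts by the real scalar \<open>N\<close>.\<close>

definition moment :: "complex^'n \<Rightarrow> complex \<times> complex" where
  "moment x = (\<Sum>d\<in>Basis. Im (herm x (dD d *v x)) *\<^sub>R d)"

lemma inner_moment: "moment x \<bullet> d = Im (herm x (dD d *v x))"
proof -
  define f where "f = (\<lambda>d. Im (herm x (dD d *v x)))"
  have f: "linear f"
    unfolding linear_iff f_def
    by (simp add: linear_add[OF linear_dD] linear_scale[OF linear_dD] herm_linear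
        matrix_vector_mult_add_rdistrib scaleR_matrix_vector)
  have "moment x \<bullet> d = (\<Sum>b\<in>Basis. (d \<bullet> b) * f b)"
    by (simp add: moment_def f_def inner_sum_left inner_commute[of d] mult.commute)
  also have "\<dots> = f (\<Sum>b\<in>Basis. (d \<bullet> b) *\<^sub>R b)"
    by (simp only: linear_sum[OF f] linear_scale[OF f] real_scaleR_def)
  also have "\<dots> = f d" by (simp only: euclidean_representation)
  finally show ?thesis by (simp only: f_def)
qed

lemma polynomial_function_moment [poly_intros]:
  "polynomial_function f \<Longrightarrow> polynomial_function (\<lambda>x. moment (f x))"
  unfolding moment_def by (intro poly_intros)

lemma moment_D:
  assumes q: "norm q = 1"
  shows "moment (D q *v x) = qmul (qmul q (moment x)) (qcnj q)"
proof -
  have "moment (D q *v x) \<bullet> d = qmul (qmul q (moment x)) (qcnj q) \<bullet> d" for d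
  proof -
    have "moment (D q *v x) \<bullet> d = Im (herm x (D (qcnj q) *v (dD d *v (D q *v x))))"
      by (simp add: inner_moment herm_D)
    also have "\<dots> = moment x \<bullet> qmul (qmul (qcnj q) d) q"
      using dD_conj[of "qcnj q" d x] q by (simp add: inner_moment)
    also have "\<dots> = qmul (qmul q (moment x)) (qcnj q) \<bullet> d"
      by (subst inner_qmul_right, subst inner_qmul_left) (simp only: qmul_assoc)
    finally show ?thesis .
  qed
  then have "\<forall>d. moment (D q *v x) \<bullet> d = qmul (qmul q (moment x)) (qcnj q) \<bullet> d" by blast
  then show ?thesis by (simp only: vector_eq_rdot)
qed

lemma herm_axis: "herm (axis m 1) x = x $ m"
  by (simp add: herm_def axis_def if_distrib if_distribR cong: if_cong)

lemma moment_axis: "moment (axis m 1) = (\<i> * of_real (- 2 * ix m), 0)"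
proof -
  define e where "e = (axis m 1 :: complex^'n)"
  \<comment> \<open>\<open>(\<i>, 0)\<close> preserves the line of \<open>e\<close> and conjugates
    \<open>(0, b)\<close> to its negative, so the expectation equals its own negative.\<close>
  have off: "herm e (dD (0, b) *v e) = 0" for b
  proof -
    define c where "c = cnj \<i> ^ N * (\<i>\<^sup>2) ^ (N - k m)"
    have c: "cnj c * c = 1"
      by (simp add: c_def power_mult_distrib[symmetric] mult_ac flip: power_add)
    have Dc: "D (\<i>, 0) *v e = c *s e"
      by (simp add: D_torus vec_eq_iff e_def axis_def c_def)
    have "herm (D (\<i>, 0) *v e) (dD (0, b) *v (D (\<i>, 0) *v e)) =
        herm e (dD (qmul (qmul (qcnj (\<i>, 0)) (0, b)) (\<i>, 0)) *v e)"
      using dD_conj[of "qcnj (\<i>, 0)" "(0, b)" e] by (simp add: herm_D norm_Pair)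
    also have "qmul (qmul (qcnj (\<i>, 0)) (0, b)) (\<i>, 0) = - (0, b)"
      by (simp add: qmul_def qcnj_def complex_eq_iff)
    also have "herm e (dD (- (0, b)) *v e) = - herm e (dD (0, b) *v e)"
      unfolding linear_neg[OF linear_dD]
      by (simp add: herm_def matrix_vector_mult_def sum_negf)
    also have "herm (D (\<i>, 0) *v e) (dD (0, b) *v (D (\<i>, 0) *v e)) = cnj c * c * herm e (dD (0, b) *v e)"
      unfolding Dc by (simp add: herm_linear matrix_vector_mult_scaleR vector_scalar_commute)
    finally show ?thesis by (simp add: c)
  qed
  have on: "Im (herm e (dD (t, 0) *v e)) = (real (N - k m) - real (k m)) * Im t" for t
    by (simp add: e_def dD_torus herm_linear herm_axis algebra_simps)
  have "real (N - k m) - real (k m) = - 2 * ix m"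
    using k_le[of m] N ix_k[of m] by (simp add: of_nat_diff)
  then have "moment e \<bullet> d = (\<i> * of_real (- 2 * ix m), 0) \<bullet> d" for d
  proof -
    have "d = (fst d, 0) + (0, snd d)" by simp
    then have "moment e \<bullet> d = moment e \<bullet> (fst d, 0) + moment e \<bullet> (0, snd d)"
      by (metis inner_add_right)
    then show ?thesis
      unfolding inner_moment off on \<open>real (N - k m) - real (k m) = - 2 * ix m\<close>
      by (simp add: inner_prod_def inner_complex_def)
  qed
  then have "\<forall>d. moment e \<bullet> d = (\<i> * of_real (- 2 * ix m), 0) \<bullet> d" by blast
  then show ?thesis by (simp only: vector_eq_rdot e_def)
qed

end


section \<open>Circle bundles\<close>

lemma axis_eq_basis_vec:
  assumes "inj ix"
  shows "basis_vec ix (ix m) = axis m 1"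
  using assms by (auto simp: basis_vec_def axis_def vec_eq_iff dest: injD)

lemma tau_hmat: "tau (hmat a b) = vector [a, b]"
  by (simp add: tau_def column_def vec_eq_iff forall_2)

lemma line_proj_unit: "norm v = 1 \<Longrightarrow> line_proj v $ i $ j = v $ i * cnj (v $ j)"
  by (simp add: line_proj_def)

lemma norm_vector2: "norm (vector [a, b] :: complex^2) = norm (a, b)"
  by (simp add: norm_vec_def L2_set_def sum_2 norm_prod_def)

lemma tensor_smult: "tensor (\<lambda>j. c j *s u j) = (\<Prod>j\<in>UNIV. c j) *s tensor u"
  by (simp add: tensor_def vec_eq_iff prod.distrib)

lemma unit_root:
  fixes c :: complex
  assumes "norm c = 1" "K > 0"
  obtains z where "norm z = 1" "z ^ K = c"
proof
  show "norm (cis (Arg c / K)) = 1" by simp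
  have "cis (Arg c / K) ^ K = cis (Arg c)" using assms(2) by (simp add: Complex.DeMoivre)
  also have "\<dots> = c" using assms(1) by (metis cis_Arg norm_zero sgn_eq div_by_1 of_real_1 zero_neq_one)
  finally show "cis (Arg c / K) ^ K = c" .
qed

lemma norm_smult_complex: "norm (c *s x) = cmod c * norm x" for x :: "complex^'n::finite"
  by (simp add: norm_vec_def L2_set_def norm_mult power_mult_distrib sum_distrib_left[symmetric]
      real_sqrt_mult)

lemma line_of_unit: "norm v = 1 \<Longrightarrow> x \<in> line_of (line_proj v) \<Longrightarrow> \<exists>c. x = c *s v"
  unfolding line_of_def by (simp add: line_proj_mult) metis

lemma dual_line_of_unit:
  assumes v: "norm v = 1" and \<phi>: "\<phi> \<in> dual_line_of (line_proj v)"
  shows "\<exists>c. \<phi> = c *s dual_elt v"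
proof -
  \<comment> \<open>This vector spans the Hermitian complement of the line; the factor sought is the
    value of \<open>\<phi>\<close> at \<open>v\<close>.\<close>
  have "line_proj v *v (vector [- cnj (v $ 2), cnj (v $ 1)]) = 0"
    by (simp add: line_proj_mult sum_2)
  then have 1: "\<phi> $ 2 * cnj (v $ 1) = \<phi> $ 1 * cnj (v $ 2)"
    using \<phi> by (auto simp: dual_line_of_def sum_2)
  have 2: "cnj (v $ 1) * v $ 1 + cnj (v $ 2) * v $ 2 = 1"
    using norm_sq_complex2[of v] v by (simp add: sum_2)
  have "\<phi> $ 1 = (\<phi> $ 1 * v $ 1 + \<phi> $ 2 * v $ 2) * cnj (v $ 1)"
       "\<phi> $ 2 = (\<phi> $ 1 * v $ 1 + \<phi> $ 2 * v $ 2) * cnj (v $ 2)"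
    using 1 2 by algebra+
  then obtain c where "\<phi> $ 1 = c * cnj (v $ 1)" "\<phi> $ 2 = c * cnj (v $ 2)" by blast
  then show ?thesis
    using v by (intro exI[of _ c]) (simp add: vec_eq_iff forall_2 dual_elt_def)
qed

text \<open>The fibre is one-dimensional, so a unit element is a phase times the power of a unit
  vector. A \<open>CARD('k)\<close>-th root of the phase can be absorbed into that vector.\<close>

lemma circle_bundle_eq:
  assumes s: "s \<noteq> 0" and K: "real CARD('k::finite) = 2 * \<bar>s\<bar>"
  shows "(circle_bundle s :: ((complex^2^2) \<times> (complex^('k \<Rightarrow> 2))) set) = tau_power s ` SU2"
proof (intro equalityI subsetI)
  fix p :: "(complex^2^2) \<times> (complex^('k \<Rightarrow> 2))"
  assume "p \<in> tau_power s ` SU2"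
  then show "p \<in> circle_bundle s"
    using tau_power_in_spin_bundle spin_norm_tau_power by (auto simp: circle_bundle_def)
next
  fix p :: "(complex^2^2) \<times> (complex^('k \<Rightarrow> 2))"
  assume p: "p \<in> circle_bundle s"
  obtain P w where Pw: "p = (P, w)" by (cases p)
  have P: "P \<in> CP1" and w: "w \<in> spin_fibre s P" and nw: "norm w = 1"
    using p s by (auto simp: Pw circle_bundle_def spin_bundle_def spin_norm_def)
  obtain v0 where v0: "v0 \<noteq> 0" "P = line_proj v0" using P by (auto simp: CP1_def)
  define v where "v = v0 /\<^sub>R norm v0"
  have v: "norm v = 1" using v0(1) by (simp add: v_def)
  have "v $ i = v0 $ i / of_real (norm v0)" for i
    by (simp add: v_def scaleR_conv_of_real[of _ "v0 $ i"] divide_inverse mult.commute)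
  then have Pv: "P = line_proj v"
    using line_proj_unit[OF v] by (simp add: v0(2) line_proj_def vec_eq_iff power2_eq_square)
  define elt where "elt v = (if s > 0 then v else dual_elt v)" for v :: "complex^2"
  have elt: "norm (elt v) = 1"
    using v by (simp add: elt_def dual_elt_def norm_vec_def L2_set_def)
  have ex: "\<exists>c. x = c *s elt v" if "x \<in> (if s > 0 then line_of P else dual_line_of P)" for x
    using that line_of_unit[OF v] dual_line_of_unit[OF v] by (auto simp: elt_def Pv split: if_splits)
  have "\<exists>c. w = c *s tensor (\<lambda>_. elt v)"
  proof -
    have sub: "{tensor u |u. \<forall>j::'k. u j \<in> (if s > 0 then line_of P else dual_line_of P)} \<subseteq>
        vec.span {tensor (\<lambda>_. elt v)}"
    proof safe
      fix u :: "'k \<Rightarrow> complex^2" assume u: "\<forall>j. u j \<in> (if s > 0 then line_of P else dual_line_of P)"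
      then have "\<forall>j. \<exists>c. u j = c *s elt v" using ex by blast
      then obtain c where c: "\<And>j. u j = c j *s elt v" by metis
      have "u = (\<lambda>j. c j *s elt v)" using c by (rule ext)
      then have "tensor u = (\<Prod>j\<in>UNIV. c j) *s tensor (\<lambda>_. elt v)"
        by (simp only: tensor_smult)
      then show "tensor u \<in> vec.span {tensor (\<lambda>_. elt v)}"
        by (simp add: vec.span_scale vec.span_base)
    qed
    have "w \<in> vec.span {tensor (\<lambda>_. elt v)}"
      using w vec.span_minimal[OF sub] by (auto simp: spin_fibre_def vec.subspace_span)
    then show ?thesis by (auto simp: vec.span_singleton)
  qed
  then obtain c where c: "w = c *s tensor (\<lambda>_. elt v)" by blast
  have "norm c = 1"
    using nw elt by (simp add: c norm_smult_complex norm_tensor)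
  then obtain z where z: "norm z = 1" "z ^ CARD('k) = c"
    using unit_root[of c "CARD('k)"] by auto
  have zz: "z * cnj z = 1" using z(1) by (simp add: complex_norm_square[symmetric])
  \<comment> \<open>Passing to the dual element conjugates a unit factor.\<close>
  define z' where "z' = (if s > 0 then z else cnj z)"
  have z': "norm z' = 1" "z' * cnj z' = 1" using z zz by (auto simp: z'_def mult.commute)
  define g where "g = hmat (z' * v $ 1) (z' * v $ 2)"
  have tau: "tau g = z' *s v"
    by (simp add: g_def tau_hmat vec_eq_iff forall_2)
  have n1: "norm (tau g) = 1" using v z' by (simp add: tau norm_smult_complex)
  then have "g \<in> SU2"
    unfolding g_def hmat_in_SU2_iff tau_hmat norm_vector2 .
  have "line_proj (tau g) = P"
  proof -
    have "z' * v $ i * (cnj z' * cnj (v $ j)) = v $ i * cnj (v $ j)" for i j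
      using z'(2) by algebra
    then show ?thesis
      using line_proj_unit[OF n1] line_proj_unit[OF v] by (simp add: Pv vec_eq_iff tau)
  qed
  moreover have "(if s > 0 then tau g else dual_elt (tau g)) = z *s elt v"
    using n1 v unfolding dual_elt_def elt_def by (cases "s > 0") (simp_all add: vec_eq_iff tau z'_def)
  then have "tensor (\<lambda>_. if s > 0 then tau g else dual_elt (tau g)) = w"
    using tensor_smult[of "\<lambda>_::'k. z" "\<lambda>_. elt v"] z(2) by (simp add: c)
  ultimately have "p = tau_power s g" by (simp add: Pw tau_power_def)
  then show "p \<in> tau_power s ` SU2" using \<open>g \<in> SU2\<close> by blast
qed

text \<open>Pairing pure powers turns a power of a linear form into an expression that is conjugate
  linear in the tensor.\<close>

lemma tensor_pairing:
  "(\<Sum>i\<in>(UNIV :: ('k::finite \<Rightarrow> 2) set). cnj (tensor (\<lambda>_. u) $ i) * (\<Prod>j\<in>UNIV. z $ i j)) =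
     (\<Sum>i\<in>UNIV. cnj (u $ i) * z $ i) ^ CARD('k)"
proof -
  have "(\<Sum>i\<in>UNIV. \<Prod>j\<in>(UNIV::'k set). cnj (u $ i j) * z $ i j) =
      (\<Prod>j\<in>(UNIV::'k set). \<Sum>i\<in>UNIV. cnj (u $ i) * z $ i)"
    using prod_sum_PiE[of "UNIV::'k set" "\<lambda>_. UNIV" "\<lambda>j i. cnj (u $ i) * z $ i"] by simp
  then show ?thesis by (simp add: tensor_def prod.distrib)
qed

context wigner_rep
begin

lemma inj_ix: "inj ix"
  using labelling by (simp add: bij_betw_def)

text \<open>With \<open>X = cnj \<alpha> * x + cnj \<beta> * y\<close> and
  \<open>Y = - \<beta> * x + \<alpha> * y\<close> the form of the orbit point is a constant times
  \<open>X ^ k m * Y ^ (N - k m)\<close>. The product \<open>X * Y\<close> depends on the line only,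
  and the surplus factor, a power of \<open>X\<close> or \<open>Y\<close> with exponent 2|s|, on the
  tensor only. Hence the orbit map descends to a polynomial \<open>F\<close> of the line and the
  tensor.\<close>

lemma circle_bundle_embedding:
  assumes s: "s \<in> weights l" "s \<noteq> 0" and K: "real CARD('k::finite) = 2 * \<bar>s\<bar>"
  shows "\<exists>F. smooth_embedding (circle_bundle s :: ((complex^2^2) \<times> (complex^('k \<Rightarrow> 2))) set)
                (sphere (0::complex^'n) 1) F
             \<and> F ` circle_bundle s = wigner_orbit l ix (basis_vec ix s)
             \<and> (\<forall>g\<in>SU2. F (tau_power s g) = wigner l ix g *v basis_vec ix s)"
proof -
  obtain m where m: "ix m = s" using s(1) labelling by (metis bij_betw_def imageE)
  have e: "basis_vec ix s = axis m 1" using axis_eq_basis_vec[OF inj_ix] m by blast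
  define K where "K = CARD('k)"
  define p where "p = (if s > 0 then N - k m else k m)"
  have kp: "s > 0 \<Longrightarrow> k m = K + p" "s < 0 \<Longrightarrow> N - k m = K + p"
  proof -
    have "s > 0 \<Longrightarrow> real (k m) = real (K + p)" "s < 0 \<Longrightarrow> real (N - k m) = real (K + p)"
      using K k_le[of m] N ix_k[of m] m by (auto simp: p_def K_def of_nat_diff)
    then show "s > 0 \<Longrightarrow> k m = K + p" "s < 0 \<Longrightarrow> N - k m = K + p"
      by (simp_all only: of_nat_eq_iff)
  qed
  define elt where "elt v = (if s > 0 then v else dual_elt v)" for v :: "complex^2"
  \<comment> \<open>Pairing with \<open>\<zeta> x y\<close> gives
    \<open>cnj \<alpha> * x + cnj \<beta> * y\<close> for \<open>s > 0\<close> and, through the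
    conjugated entries of the dual element, \<open>- \<beta> * x + \<alpha> * y\<close> for
    \<open>s < 0\<close>; \<open>b\<close> is the product of these two linear forms in terms of the
    projection.\<close>
  define \<zeta> where "\<zeta> x y = (if s > 0 then vector [x, y] else vector [y, - x] :: complex^2)" for x y :: complex
  define b where "b P x y = - P $ 2 $ 1 * x\<^sup>2 + (P $ 1 $ 1 - P $ 2 $ 2) * x * y + P $ 1 $ 2 * y\<^sup>2"
    for P :: "complex^2^2" and x y
  define pair where "pair w x y = (\<Sum>i\<in>UNIV. cnj (w $ i) * (\<Prod>j\<in>UNIV. \<zeta> x y $ i j))"
    for w :: "complex^('k \<Rightarrow> 2)" and x y
  define F where "F p' = of_values (\<lambda>x y. of_real (wt m) * pair (snd p') x y * b (fst p') x y ^ p)"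
    for p' :: "(complex^2^2) \<times> (complex^('k \<Rightarrow> 2))"
  have ev_form: "ev (D (\<alpha>, \<beta>) *v axis m 1) x y =
     of_real (wt m) * pair (tensor (\<lambda>_. elt (vector [\<alpha>, \<beta>]))) x y * b (line_proj (vector [\<alpha>, \<beta>])) x y ^ p"
    if n: "norm (\<alpha>, \<beta>) = 1" for \<alpha> \<beta> x y
  proof -
    have nv: "norm (vector [\<alpha>, \<beta>] :: complex^2) = 1" using n by (simp add: norm_vector2)
    have p: "s > 0 \<Longrightarrow> N - k m = p" "s < 0 \<Longrightarrow> k m = p" by (simp_all add: p_def)
    have b: "b (line_proj (vector [\<alpha>, \<beta>])) x y = (cnj \<alpha> * x + cnj \<beta> * y) * (- \<beta> * x + \<alpha> * y)"
      unfolding b_def line_proj_unit[OF nv] by (simp add: algebra_simps power2_eq_square)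
    have pr: "pair (tensor (\<lambda>_. elt (vector [\<alpha>, \<beta>]))) x y =
        (if s > 0 then cnj \<alpha> * x + cnj \<beta> * y else - \<beta> * x + \<alpha> * y) ^ K"
      unfolding pair_def tensor_pairing K_def
      using nv by (simp add: sum_2 elt_def \<zeta>_def dual_elt_def)
    have "ev (D (\<alpha>, \<beta>) *v axis m 1) x y =
        of_real (wt m) * (cnj \<alpha> * x + cnj \<beta> * y) ^ k m * (- \<beta> * x + \<alpha> * y) ^ (N - k m)"
      by (simp add: ev_D ev_axis pv_nth)
    then show ?thesis
      unfolding b pr using kp p s(2)
      by (cases "s > 0") (simp_all add: power_add power_mult_distrib mult_ac)
  qed
  have F_tau: "F (tau_power s (hmat \<alpha> \<beta>)) = D (\<alpha>, \<beta>) *v axis m 1" if n: "norm (\<alpha>, \<beta>) = 1" for \<alpha> \<beta>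
  proof -
    have "F (tau_power s (hmat \<alpha> \<beta>)) = of_values (ev (D (\<alpha>, \<beta>) *v axis m 1))"
      unfolding F_def tau_power_def tau_hmat fst_conv snd_conv elt_def[symmetric] ev_form[OF n, symmetric]
      by (rule refl)
    then show ?thesis by (simp add: of_values_ev)
  qed
  have polyF: "polynomial_function F"
    unfolding F_def pair_def b_def by (intro poly_intros)
  \<comment> \<open>By \<open>moment_D\<close> and \<open>moment_axis\<close> the moment divided by
    \<open>- 2 * s\<close> is the Hopf image of \<open>q\<close>; solving \<open>hopf_image\<close>
    for the projection gives these entries.\<close>
  define P where "P x = (let h = (- 1 / (2 * s)) *\<^sub>R moment x in
     vector [vector [(1 + of_real (Im (fst h))) / 2, cnj (snd h / (2 * \<i>))],
             vector [snd h / (2 * \<i>), (1 - of_real (Im (fst h))) / 2]] :: complex^2^2)" for x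
  have P11: "P x $ 1 $ 1 = (1 + of_real (Im (fst ((- 1 / (2 * s)) *\<^sub>R moment x)))) / 2"
    and P12: "P x $ 1 $ 2 = cnj (snd ((- 1 / (2 * s)) *\<^sub>R moment x) / (2 * \<i>))"
    and P21: "P x $ 2 $ 1 = snd ((- 1 / (2 * s)) *\<^sub>R moment x) / (2 * \<i>)"
    and P22: "P x $ 2 $ 2 = (1 - of_real (Im (fst ((- 1 / (2 * s)) *\<^sub>R moment x)))) / 2" for x
    by (simp_all only: P_def Let_def vector_2)
  have polyP_nth: "polynomial_function (\<lambda>x. P x $ i $ j)" for i j
    using exhaust_2[of i] exhaust_2[of j]
    by (elim disjE; simp only: P11 P12 P21 P22; intro poly_intros)
  have polyP: "polynomial_function P"
  proof -
    have "polynomial_function (\<lambda>x. \<chi> i j. P x $ i $ j)"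
      by (intro poly_intros polyP_nth)
    then show ?thesis by simp
  qed
  have P_D: "P (D q *v axis m 1) = line_proj (vector [fst q, snd q])" if q: "norm q = 1" for q
  proof -
    have nv: "norm (vector [fst q, snd q] :: complex^2) = 1" using q by (simp add: norm_vector2)
    have lin: "qmul (qmul q (\<i> * of_real t, 0)) (qcnj q) = t *\<^sub>R qmul (qmul q (\<i>, 0)) (qcnj q)" for t
      by (simp add: qmul_def qcnj_def prod_eq_iff scaleR_conv_of_real algebra_simps)
    have "(- 1 / (2 * s)) *\<^sub>R moment (D q *v axis m 1) = qmul (qmul q (\<i>, 0)) (qcnj q)"
      unfolding moment_D[OF q] moment_axis lin m using s(2) by simp
    then have h: "(- 1 / (2 * s)) *\<^sub>R moment (D q *v axis m 1) =
        (\<i> * of_real ((cmod (fst q))\<^sup>2 - (cmod (snd q))\<^sup>2), 2 * \<i> * snd q * cnj (fst q))"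
      by (simp only: hopf_image[OF q])
    define A B where "A = fst q * cnj (fst q)" and "B = snd q * cnj (snd q)"
    have AB: "A + B = 1"
      using pair_mult_cnj[of q] q by (simp add: A_def B_def)
    define t where "t = (cmod (fst q))\<^sup>2 - (cmod (snd q))\<^sup>2"
    have r: "complex_of_real t = A - B"
      unfolding t_def of_real_diff complex_norm_square A_def B_def by (rule refl)
    have "Im (fst (\<i> * complex_of_real t, z)) = t" for z :: complex by simp
    note h = h[folded t_def] this
    have "(1 + (A - B)) / 2 = A" "(1 - (A - B)) / 2 = B"
      using AB by (auto simp: field_simps)
    then show ?thesis
      unfolding vec_eq_iff forall_2 line_proj_unit[OF nv] P11 P12 P21 P22 h
      by (simp add: r A_def[symmetric] B_def[symmetric])
  qed
  define PP where "PP x i i' = (if s > 0 then P x $ i $ i' else P x $ i' $ i)" for x i i'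
  \<comment> \<open>A unit vector \<open>x\<close> satisfies
    \<open>w $ i = herm x (w $ i *s x)\<close>. The form of \<open>w $ i *s x\<close> contains the
    tensor only through \<open>w $ i * cnj (w $ i')\<close>, a product of entries of the projection,
    so it is polynomial in \<open>x\<close>.\<close>
  define G where "G x = (P x, \<chi> i. herm x (of_values (\<lambda>a c. of_real (wt m) *
      (\<Sum>i'\<in>UNIV. (\<Prod>j\<in>UNIV. PP x (i j) (i' j)) * (\<Prod>j\<in>UNIV. \<zeta> a c $ i' j)) * b (P x) a c ^ p))
      :: complex^('k \<Rightarrow> 2))" for x
  have "polynomial_function (\<lambda>x. PP x i i')" for i i'
    by (cases "s > 0") (simp_all add: PP_def polyP_nth)
  then have polyG: "polynomial_function G"
    unfolding G_def b_def by (intro poly_intros polyP polyP_nth)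
  have G_D: "G (D q *v axis m 1) = tau_power s (hmat (fst q) (snd q))" if q: "norm q = 1" for q
  proof -
    define v where "v = (vector [fst q, snd q] :: complex^2)"
    define w where "w = (tensor (\<lambda>_. elt v) :: complex^('k \<Rightarrow> 2))"
    define x where "x = D q *v (axis m 1 :: complex^'n)"
    have nv: "norm v = 1" using q by (simp add: norm_vector2 v_def)
    have Px: "P x = line_proj v" using P_D[OF q] by (simp add: x_def v_def)
    have "PP x i i' = elt v $ i * cnj (elt v $ i')" for i i'
      using nv by (simp add: PP_def Px line_proj_unit elt_def dual_elt_def mult.commute)
    then have PPw: "(\<Prod>j\<in>UNIV. PP x (i j) (i' j)) = w $ i * cnj (w $ i')" for i i'
      by (simp add: w_def tensor_def prod.distrib)
    have G_eq: "of_values (\<lambda>a c. of_real (wt m) *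
      (\<Sum>i'\<in>UNIV. (\<Prod>j\<in>UNIV. PP x (i j) (i' j)) * (\<Prod>j\<in>UNIV. \<zeta> a c $ i' j)) * b (P x) a c ^ p) = w $ i *s x"
      for i
    proof -
      have "(\<lambda>a c. of_real (wt m) * (\<Sum>i'\<in>UNIV. (\<Prod>j\<in>UNIV. PP x (i j) (i' j)) * (\<Prod>j\<in>UNIV. \<zeta> a c $ i' j)) *
          b (P x) a c ^ p) = ev (w $ i *s x)"
      proof (intro ext)
        fix a c
        have "ev x a c = of_real (wt m) * pair w a c * b (P x) a c ^ p"
          using ev_form[of "fst q" "snd q" a c] q
          by (simp add: Px flip: x_def v_def w_def)
        then show "of_real (wt m) * (\<Sum>i'\<in>UNIV. (\<Prod>j\<in>UNIV. PP x (i j) (i' j)) * (\<Prod>j\<in>UNIV. \<zeta> a c $ i' j)) *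
          b (P x) a c ^ p = ev (w $ i *s x) a c"
          by (simp add: ev_linear pair_def PPw sum_distrib_left mult_ac)
      qed
      then show ?thesis by (simp add: of_values_ev)
    qed
    have "herm x x = 1"
      using norm_D[OF q, of "axis m 1"] by (simp add: herm_self x_def)
    then have "G x = (line_proj v, w)"
      unfolding G_def G_eq by (simp add: Px herm_linear)
    then show ?thesis
      by (simp add: x_def v_def w_def tau_power_def tau_hmat elt_def)
  qed
  have cb: "(circle_bundle s :: ((complex^2^2) \<times> (complex^('k \<Rightarrow> 2))) set) =
      (\<lambda>q. tau_power s (hmat (fst q) (snd q))) ` sphere 0 1"
    unfolding circle_bundle_eq[OF s(2) K] SU2_image image_image by (rule refl)
  have F_tau': "F (tau_power s (hmat (fst q) (snd q))) = D q *v axis m 1" if "norm q = 1" for q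
    using F_tau[of "fst q" "snd q"] that by simp
  have orbit: "F ` circle_bundle s = wigner_orbit l ix (basis_vec ix s)"
    unfolding cb wigner_orbit_eq e image_image by (intro image_cong) (auto simp: F_tau')
  show ?thesis
  proof (intro exI[of _ F] conjI ballI)
    have "diffeomorphism (circle_bundle s) (F ` circle_bundle s) F"
      using polyF polyG refl
    proof (rule diffeomorphism_polynomial)
      fix p' :: "(complex^2^2) \<times> (complex^('k \<Rightarrow> 2))" assume "p' \<in> circle_bundle s"
      then show "G (F p') = p'" unfolding cb using G_D by (fastforce simp: F_tau)
    qed
    moreover have "F ` circle_bundle s \<subseteq> sphere 0 1"
      unfolding cb by (auto simp: F_tau norm_D)
    ultimately show "smooth_embedding (circle_bundle s) (sphere 0 1) F"
      by (simp add: smooth_embedding_def)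
    show "F ` circle_bundle s = wigner_orbit l ix (basis_vec ix s)" by (rule orbit)
    fix g assume "g \<in> SU2"
    then show "F (tau_power s g) = wigner l ix g *v basis_vec ix s"
      by (auto simp: SU2_image F_tau e D_def)
  qed
qed

end


section \<open>Zonal vectors\<close>

text \<open>The third axis is \<open>(\<i>, 0)\<close>, the direction of the diagonal torus.\<close>

definition im_q :: "real^3 \<Rightarrow> complex \<times> complex" where
  "im_q n = (\<i> * of_real (n $ 3), of_real (n $ 1) + \<i> * of_real (n $ 2))"

lemma Re_fst_im_q [simp]: "Re (fst (im_q n)) = 0"
  by (simp add: im_q_def)

lemma im_q_linear: "im_q (m + n) = im_q m + im_q n" "im_q (- n) = - im_q n" "im_q (t *\<^sub>R n) = t *\<^sub>R im_q n"
  by (simp_all add: im_q_def prod_eq_iff complex_eq_iff algebra_simps)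

lemma inner_im_q: "im_q m \<bullet> im_q n = m \<bullet> n"
  by (simp add: im_q_def inner_prod_def inner_complex_def inner_vec_def sum_3)

lemma norm_im_q: "norm (im_q n) = norm n"
  by (simp add: norm_eq_sqrt_inner inner_im_q)

lemma im_q_surj:
  assumes "Re (fst h) = 0"
  obtains n where "h = im_q n"
proof
  show "h = im_q (vector [Re (snd h), Im (snd h), Im (fst h)])"
    using assms by (simp add: im_q_def prod_eq_iff complex_eq_iff)
qed

lemma polynomial_function_im_q [poly_intros]:
  "polynomial_function f \<Longrightarrow> polynomial_function (\<lambda>x. im_q (f x))"
  unfolding im_q_def by (intro poly_intros)

lemma hopf_sphere:
  "(\<lambda>q. qmul (qmul q (\<i>, 0)) (qcnj q)) ` sphere 0 1 = im_q ` sphere 0 1"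
proof (intro equalityI subsetI)
  fix h assume "h \<in> (\<lambda>q. qmul (qmul q (\<i>, 0)) (qcnj q)) ` sphere 0 1"
  then obtain q where q: "norm q = 1" "h = qmul (qmul q (\<i>, 0)) (qcnj q)" by auto
  then have "norm h = 1" by (simp add: norm_qmul norm_Pair)
  moreover have "Re (fst h) = 0" unfolding q(2) hopf_image[OF q(1)] by simp
  then obtain n where "h = im_q n" by (rule im_q_surj)
  ultimately show "h \<in> im_q ` sphere 0 1" by (simp add: norm_im_q)
next
  fix h assume "h \<in> im_q ` sphere 0 1"
  then have "norm h = 1" "Re (fst h) = 0" by (auto simp: norm_im_q)
  then obtain q where "norm q = 1" "h = qmul (qmul q (\<i>, 0)) (qcnj q)" by (rule hopf_surj)
  then show "h \<in> (\<lambda>q. qmul (qmul q (\<i>, 0)) (qcnj q)) ` sphere 0 1" by auto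
qed

text \<open>The binary quadratic form \<open>z\<^sup>T J h z\<close> with \<open>J\<close> the standard symplectic matrix; the real part
  of \<open>h\<close> drops out.\<close>

definition qform :: "complex \<times> complex \<Rightarrow> complex \<Rightarrow> complex \<Rightarrow> complex" where
  "qform h x y = snd h * x\<^sup>2 + (cnj (fst h) - fst h) * x * y + cnj (snd h) * y\<^sup>2"

text \<open>Conjugating the quaternion by \<open>q\<close> is the substitution through which
  \<open>D q\<close> acts, so powers of this form are equivariant.\<close>

lemma qform_conj:
  "qform (qmul (qmul q h) (qcnj q)) x y =
   qform h (cnj (fst q) * x + cnj (snd q) * y) (- snd q * x + fst q * y)"
  by (simp add: qform_def qmul_def qcnj_def algebra_simps power2_eq_square)

lemma polynomial_function_qform [poly_intros]:
  "polynomial_function f \<Longrightarrow> polynomial_function g \<Longrightarrow> polynomial_function h \<Longrightarrow>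
    polynomial_function (\<lambda>x. qform (f x) (g x) (h x))"
  unfolding qform_def by (intro poly_intros)

lemma polynomial_outer:
  fixes i j :: "real^'n::finite"
  assumes "i \<in> Basis" "j \<in> Basis"
  shows "\<exists>r. polynomial_function r \<and> (\<forall>q\<in>X. (q \<bullet> i) * (q \<bullet> j) = r ((\<chi> a b. q $ a * q $ b) :: real^'n^'n))"
proof -
  obtain a b where "i = axis a 1" "j = axis b 1" using assms by (auto simp: Basis_vec_def)
  then show ?thesis
    by (intro exI[of _ "\<lambda>S. S $ a $ b"] conjI poly_intros) (simp add: inner_axis)
qed

context wigner_rep
begin

text \<open>A vector of weight 0 is fixed by the torus, while conjugation by the torus gives
  \<open>b\<close> any phase.\<close>

lemma norm_dD_off_diagonal:
  assumes m: "2 * k m = N"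
  shows "norm (dD (0, b) *v axis m 1) = norm b * norm (dD (0, 1) *v axis m 1)"
proof (cases "b = 0")
  case True
  then show ?thesis using linear_0[OF linear_dD] by (simp add: zero_prod_def[symmetric])
next
  case False
  define u where "u = csqrt (of_real (norm b) / b)"
  have u: "norm u = 1" "u\<^sup>2 * b = of_real (norm b)"
    using False by (simp_all add: u_def norm_csqrt norm_divide)
  have uu: "cnj u * u = 1" using u(1) by (simp add: mult.commute complex_norm_square[symmetric])
  have N: "N - k m = k m" using m by simp
  have "cnj u ^ N * (u\<^sup>2) ^ k m = (cnj u * u) ^ N"
    unfolding m[symmetric] by (simp add: power_mult_distrib power_mult)
  then have fix_axis: "D (u, 0) *v axis m 1 = axis m 1"
    using u(1) uu by (auto simp: D_torus vec_eq_iff axis_def N)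
  have eq: "qmul (qmul (qcnj (u, 0)) (0, b)) (qcnj (qcnj (u, 0))) = (0, u\<^sup>2 * b)"
    by (simp add: qmul_def qcnj_def power2_eq_square)
  have "dD (0, u\<^sup>2 * b) *v axis m 1 = D (qcnj (u, 0)) *v (dD (0, b) *v axis m 1)"
    using dD_conj[of "qcnj (u, 0)" "(0, b)" "axis m 1"] u(1)
    unfolding eq by (simp add: fix_axis norm_Pair)
  then have "norm (dD (0, b) *v axis m 1) = norm (dD (0, of_real (norm b)) *v axis m 1)"
    using u by (simp add: norm_D norm_Pair)
  also have "(0, of_real (norm b)) = norm b *\<^sub>R (0::complex, 1::complex)"
    by (simp add: scaleR_conv_of_real)
  finally show ?thesis by (simp add: linear_scale[OF linear_dD] scaleR_matrix_vector del: scaleR_Pair)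
qed

lemma dD_off_diagonal_nonzero:
  assumes m: "2 * k m = N" and N: "N > 0"
  shows "dD (0, 1) *v axis m 1 \<noteq> 0"
proof
  assume 0: "dD (0, 1) *v axis m 1 = 0"
  obtain p where p: "k m = Suc p" "N - k m = Suc p"
    using m N by (cases "k m") auto
  \<comment> \<open>At \<open>(1, 1)\<close> the two terms cancel, so the form is evaluated at
    \<open>(2, 1)\<close>.\<close>
  have "of_real (wt m) * of_nat (Suc p) * (2 ^ p - 2 ^ Suc (Suc p) :: complex) = ev (dD (0, 1) *v axis m 1) 2 1"
    unfolding ev_dD_axis unfolding p(2) unfolding p(1) by (simp add: algebra_simps)
  then have "of_nat (Suc p) * (2 ^ p - 2 ^ Suc (Suc p) :: complex) = 0"
    using 0 wt_pos[of m] by (simp add: ev_linear)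
  moreover have "2 ^ p - 2 ^ Suc (Suc p) = (- 3 * 2 ^ p :: complex)" by simp
  ultimately show False by (simp del: of_nat_Suc power_Suc)
qed

text \<open>As \<open>qform (\<i>, 0) x y = - 2 * \<i> * x * y\<close>, the value at
  \<open>(\<i>, 0)\<close> is the vector of weight 0 when \<open>2 * k m = N\<close>.\<close>

definition zonal :: "'n \<Rightarrow> complex \<times> complex \<Rightarrow> complex^'n" where
  "zonal m h = of_values (\<lambda>x y. of_real (wt m) * (qform h x y / (- 2 * \<i>)) ^ k m)"

lemma polynomial_function_zonal [poly_intros]:
  "polynomial_function f \<Longrightarrow> polynomial_function (\<lambda>x. zonal m (f x))"
  unfolding zonal_def by (intro poly_intros)

lemma D_zonal:
  assumes m: "2 * k m = N"
  shows "D q *v axis m 1 = zonal m (qmul (qmul q (\<i>, 0)) (qcnj q))"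
proof -
  have "(\<lambda>x y. of_real (wt m) * (qform (qmul (qmul q (\<i>, 0)) (qcnj q)) x y / (- 2 * \<i>)) ^ k m) =
      ev (D q *v axis m 1)"
  proof (intro ext)
    fix x y
    have "N - k m = k m" using m by simp
    moreover have "qform (\<i>, 0) X Y / (- 2 * \<i>) = X * Y" for X Y
      by (simp add: qform_def)
    ultimately show "of_real (wt m) * (qform (qmul (qmul q (\<i>, 0)) (qcnj q)) x y / (- 2 * \<i>)) ^ k m =
      ev (D q *v axis m 1) x y"
      by (simp only: qform_conj ev_D ev_axis pv_nth power_mult_distrib mult.assoc)
  qed
  then show ?thesis by (simp add: zonal_def of_values_ev)
qed

lemma zonal_scale: "zonal m (t *\<^sub>R h) = t ^ k m *\<^sub>R zonal m h"
proof -
  obtain Z c where Z: "of_values = (\<lambda>F. \<chi> m. \<Sum>z\<in>Z. c m z * F (fst z) (snd z))"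
    using of_values_spec by blast
  have "qform (t *\<^sub>R h) x y / (- 2 * \<i>) = of_real t * (qform h x y / (- 2 * \<i>))" for x y
    by (simp add: qform_def scaleR_conv_of_real algebra_simps add_divide_distrib diff_divide_distrib)
  then have "zonal m (t *\<^sub>R h) = of_real (t ^ k m) *s zonal m h"
    unfolding zonal_def Z
    by (simp only: power_mult_distrib) (simp add: vec_eq_iff sum_distrib_left mult_ac)
  then show ?thesis by (simp only: of_real_smult)
qed

text \<open>The parity of \<open>k m\<close> decides whether antipodal directions give the same
  orbit point, and so between projective plane and sphere.\<close>

lemma zonal_minus: "zonal m (- h) = (-1) ^ k m *\<^sub>R zonal m h"
  using zonal_scale[of m "- 1" h] by simp

lemma zonal_orbit:
  assumes m: "2 * k m = N"
  shows "wigner_orbit l ix (axis m 1) = (\<lambda>n. zonal m (im_q n)) ` sphere 0 1"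
proof -
  have "wigner_orbit l ix (axis m 1) = zonal m ` (\<lambda>q. qmul (qmul q (\<i>, 0)) (qcnj q)) ` sphere 0 1"
    by (simp add: wigner_orbit_eq D_zonal[OF m] image_image)
  then show ?thesis by (simp add: hopf_sphere image_image)
qed

text \<open>Rotate \<open>h\<close> to \<open>(\<i>, 0)\<close>. The component of \<open>d\<close>
  along it annihilates the vector of weight 0, and the orthogonal component acts with a norm
  independent of its direction by \<open>norm_dD_off_diagonal\<close>.\<close>

lemma norm_dD_zonal:
  assumes m: "2 * k m = N" and h: "norm h = 1" "Re (fst h) = 0" and d: "Re (fst d) = 0"
  shows "(norm (dD d *v zonal m h))\<^sup>2 = (norm (dD (0, 1) *v axis m 1))\<^sup>2 * ((norm d)\<^sup>2 - (d \<bullet> h)\<^sup>2)"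
proof -
  obtain q where q: "norm q = 1" "h = qmul (qmul q (\<i>, 0)) (qcnj q)" using hopf_surj[OF h] .
  define d' where "d' = qmul (qmul (qcnj q) d) q"
  have in_d': "d' \<bullet> r = d \<bullet> qmul (qmul q r) (qcnj q)" for r
    unfolding d'_def using inner_qmul_right[of "qmul (qcnj q) d" "qcnj q" r]
      inner_qmul_left[of "qcnj q" d] by (simp add: qmul_assoc)
  have "Re (fst d') = d' \<bullet> (1, 0)" by (simp add: inner_prod_def inner_complex_def)
  also have "\<dots> = d \<bullet> (1, 0)" unfolding in_d' using q(1) by (simp add: qmul_qcnj)
  also have "\<dots> = 0" using d by (simp add: inner_prod_def inner_complex_def)
  finally have re: "Re (fst d') = 0" .
  have "Im (fst d') = d' \<bullet> (\<i>, 0)" by (simp add: inner_prod_def inner_complex_def)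
  then have im: "Im (fst d') = d \<bullet> h" by (simp add: in_d' q(2))
  have "(norm d)\<^sup>2 = (norm d')\<^sup>2" using q(1) by (simp add: d'_def norm_qmul)
  then have snd: "(norm (snd d'))\<^sup>2 = (norm d)\<^sup>2 - (d \<bullet> h)\<^sup>2"
    by (simp add: norm_sq_pair cmod_power2[of "fst d'"] re im)
  have N: "N - k m = k m" using m by simp
  have "norm (dD d *v zonal m h) = norm (D (qcnj q) *v (dD d *v (D q *v axis m 1)))"
    using q(1) by (simp add: norm_D q(2) D_zonal[OF m])
  also have "\<dots> = norm (dD d' *v axis m 1)"
    using dD_conj[of "qcnj q" d "axis m 1"] q(1) by (simp add: d'_def)
  also have "d' = (fst d', 0) + (0, snd d')" by simp
  also have "dD \<dots> *v axis m 1 = dD (0, snd d') *v axis m 1"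
  proof -
    have "of_nat (k m) * cnj (fst d') + of_nat (k m) * fst d' = (0::complex)"
      by (simp add: complex_eq_iff re)
    then have "dD (fst d', 0) *v axis m 1 = 0"
      by (simp add: dD_torus N)
    then show ?thesis
      by (simp only: linear_add[OF linear_dD] matrix_vector_mult_add_rdistrib) simp
  qed
  also have "norm (dD (0, snd d') *v axis m 1) = norm (snd d') * norm (dD (0, 1) *v axis m 1)"
    by (rule norm_dD_off_diagonal[OF m])
  finally show ?thesis by (simp add: power_mult_distrib snd)
qed

lemma zonal_recover:
  assumes m: "2 * k m = N" and N: "N > 0"
  obtains P :: "complex^'n \<Rightarrow> real^3^3" where "polynomial_function P"
    "\<And>n. n \<in> S2 \<Longrightarrow> P (zonal m (im_q n)) = (\<chi> a b. n $ a * n $ b)"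
proof -
  define \<kappa> where "\<kappa> = (norm (dD (0, 1) *v axis m 1))\<^sup>2"
  have \<kappa>: "\<kappa> \<noteq> 0" using dD_off_diagonal_nonzero[OF m N] by (simp add: \<kappa>_def)
  define sq where "sq d x = (norm d)\<^sup>2 - ((dD d *v x) \<bullet> (dD d *v x)) / \<kappa>" for d x
  \<comment> \<open>Polarisation of the quadratic form \<open>(v \<bullet> n)\<^sup>2\<close> in
    \<open>v\<close>.\<close>
  define P where "P x = (\<chi> a b. (sq (im_q (axis a 1 + axis b 1)) x - sq (im_q (axis a 1)) x
      - sq (im_q (axis b 1)) x) / 2 :: real^3^3)" for x
  have sq: "sq (im_q v) (zonal m (im_q n)) = (v \<bullet> n)\<^sup>2" if "n \<in> S2" for v n
    using norm_dD_zonal[OF m, of "im_q n" "im_q v"] that \<kappa>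
    by (simp add: sq_def power2_norm_eq_inner[symmetric] norm_im_q inner_im_q \<kappa>_def[symmetric])
  show thesis
  proof
    show "polynomial_function P"
      unfolding P_def sq_def by (intro poly_intros)
    show "P (zonal m (im_q n)) = (\<chi> a b. n $ a * n $ b)" if "n \<in> S2" for n
      unfolding P_def sq[OF that] by (simp add: vec_eq_iff inner_axis' inner_add_left power2_sum)
  qed
qed

lemma norm_zonal: "2 * k m = N \<Longrightarrow> norm n = 1 \<Longrightarrow> norm (zonal m (im_q n)) = 1"
proof -
  assume "2 * k m = N" "norm n = 1"
  then have "zonal m (im_q n) \<in> wigner_orbit l ix (axis m 1)"
    by (auto simp: zonal_orbit)
  then show ?thesis by (auto simp: wigner_orbit_eq norm_D)
qed

lemma orbit_RP2:
  assumes m: "2 * k m = N" and N: "N > 0" and even: "even (k m)"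
  shows "diffeomorphic (wigner_orbit l ix (axis m 1)) RP2"
proof -
  obtain P where P: "polynomial_function P"
    "\<And>n. n \<in> S2 \<Longrightarrow> P (zonal m (im_q n)) = (\<chi> a b. n $ a * n $ b)"
    by (rule zonal_recover[OF m N], rule that)
  have "polynomial_function (\<lambda>n. zonal m (im_q n))" by (intro poly_intros)
  then obtain r where r: "polynomial_function r"
    "\<And>n. n \<in> S2 \<Longrightarrow> zonal m (im_q n) = r ((\<chi> a b. n $ a * n $ b) :: real^3^3)"
    by (rule even_polynomial_function[OF _ polynomial_outer, where X = S2])
      (use even in \<open>auto simp: im_q_linear zonal_minus\<close>)
  have "diffeomorphism (wigner_orbit l ix (axis m 1)) RP2 P"
    using P(1) r(1)
  proof (rule diffeomorphism_polynomial)
    show "P ` wigner_orbit l ix (axis m 1) = RP2"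
      unfolding zonal_orbit[OF m] RP2_def image_image using P(2) by (auto simp: image_iff)
    fix x assume "x \<in> wigner_orbit l ix (axis m 1)"
    then obtain n where "n \<in> S2" "x = zonal m (im_q n)" by (auto simp: zonal_orbit[OF m])
    then show "r (P x) = x" using P(2) r(2) by simp
  qed
  then show ?thesis unfolding diffeomorphic_def by blast
qed

text \<open>The derivatives give only the products of coordinates of \<open>n\<close>. For odd
  \<open>k m\<close> the map \<open>n $ a *\<^sub>R zonal m (im_q n)\<close> is even, hence
  polynomial in these products, and pairing it with the unit vector \<open>zonal m (im_q n)\<close>
  leaves \<open>n $ a\<close>.\<close>

lemma orbit_S2:
  assumes m: "2 * k m = N" and odd: "odd (k m)"
  shows "diffeomorphic (wigner_orbit l ix (axis m 1)) S2"
proof -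
  have N: "N > 0" using m odd by (cases "k m") auto
  obtain P where P: "polynomial_function P"
    "\<And>n. n \<in> S2 \<Longrightarrow> P (zonal m (im_q n)) = (\<chi> a b. n $ a * n $ b)"
    by (rule zonal_recover[OF m N], rule that)
  have "\<exists>r. polynomial_function r \<and>
      (\<forall>n\<in>S2. n $ a *\<^sub>R zonal m (im_q n) = r ((\<chi> a b. n $ a * n $ b) :: real^3^3))" for a
  proof -
    have "polynomial_function (\<lambda>n. n $ a *\<^sub>R zonal m (im_q n))" by (intro poly_intros)
    then obtain r where "polynomial_function r"
      "\<And>n. n \<in> S2 \<Longrightarrow> n $ a *\<^sub>R zonal m (im_q n) = r ((\<chi> a b. n $ a * n $ b) :: real^3^3)"
      by (rule even_polynomial_function[OF _ polynomial_outer, where X = S2])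
        (use odd in \<open>auto simp: im_q_linear zonal_minus\<close>)
    then show ?thesis by blast
  qed
  then obtain r where r: "\<And>a. polynomial_function (r a)"
    "\<And>a n. n \<in> S2 \<Longrightarrow> n $ a *\<^sub>R zonal m (im_q n) = r a ((\<chi> a b. n $ a * n $ b) :: real^3^3)"
    by metis
  define V where "V x = (\<chi> a. r a (P x) \<bullet> x :: real^3)" for x
  have V: "V (zonal m (im_q n)) = n" if "n \<in> S2" for n
    using that norm_zonal[OF m, of n]
    by (simp add: V_def P(2) r(2)[symmetric] vec_eq_iff power2_norm_eq_inner[symmetric])
  have "polynomial_function V"
    unfolding V_def by (intro poly_intros polynomial_function_comp[OF P(1) r(1)])
  moreover have "polynomial_function (\<lambda>n. zonal m (im_q n))" by (intro poly_intros)
  ultimately have "diffeomorphism (wigner_orbit l ix (axis m 1)) S2 V"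
  proof (rule diffeomorphism_polynomial)
    show "V ` wigner_orbit l ix (axis m 1) = S2"
      unfolding zonal_orbit[OF m] image_image using V by (auto simp: image_iff)
    fix x assume "x \<in> wigner_orbit l ix (axis m 1)"
    then show "zonal m (im_q (V x)) = x" using V by (auto simp: zonal_orbit[OF m])
  qed
  then show ?thesis unfolding diffeomorphic_def by blast
qed

end


section \<open>Quaternions and rotations\<close>

text \<open>Conjugation by \<open>q\<close> on imaginary quaternions, in the coordinates of
  \<open>im_q\<close>.\<close>

definition rot :: "complex \<times> complex \<Rightarrow> real^3^3" where
  "rot q = (let a = Re (fst q); b = Im (fst q); c = Re (snd q); d = Im (snd q) in
     vector [vector [a\<^sup>2 - b\<^sup>2 + c\<^sup>2 - d\<^sup>2, 2 * a * b + 2 * c * d, - 2 * a * d + 2 * b * c],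
             vector [- 2 * a * b + 2 * c * d, a\<^sup>2 - b\<^sup>2 - c\<^sup>2 + d\<^sup>2, 2 * a * c + 2 * b * d],
             vector [2 * a * d + 2 * b * c, - 2 * a * c + 2 * b * d, a\<^sup>2 + b\<^sup>2 - c\<^sup>2 - d\<^sup>2]])"

lemma rot_nth:
  "rot q $ 1 $ 1 = (Re (fst q))\<^sup>2 - (Im (fst q))\<^sup>2 + (Re (snd q))\<^sup>2 - (Im (snd q))\<^sup>2"
  "rot q $ 1 $ 2 = 2 * Re (fst q) * Im (fst q) + 2 * Re (snd q) * Im (snd q)"
  "rot q $ 1 $ 3 = - 2 * Re (fst q) * Im (snd q) + 2 * Im (fst q) * Re (snd q)"
  "rot q $ 2 $ 1 = - 2 * Re (fst q) * Im (fst q) + 2 * Re (snd q) * Im (snd q)"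
  "rot q $ 2 $ 2 = (Re (fst q))\<^sup>2 - (Im (fst q))\<^sup>2 - (Re (snd q))\<^sup>2 + (Im (snd q))\<^sup>2"
  "rot q $ 2 $ 3 = 2 * Re (fst q) * Re (snd q) + 2 * Im (fst q) * Im (snd q)"
  "rot q $ 3 $ 1 = 2 * Re (fst q) * Im (snd q) + 2 * Im (fst q) * Re (snd q)"
  "rot q $ 3 $ 2 = - 2 * Re (fst q) * Re (snd q) + 2 * Im (fst q) * Im (snd q)"
  "rot q $ 3 $ 3 = (Re (fst q))\<^sup>2 + (Im (fst q))\<^sup>2 - (Re (snd q))\<^sup>2 - (Im (snd q))\<^sup>2"
  by (simp_all add: rot_def Let_def vector_3)

lemma im_q_rot: "im_q (rot q *v n) = qmul (qmul q (im_q n)) (qcnj q)"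
  by (simp add: im_q_def qmul_def qcnj_def matrix_vector_mult_def sum_3 rot_nth prod_eq_iff
      complex_eq_iff algebra_simps power2_eq_square)

lemma im_q_inject: "im_q m = im_q n \<longleftrightarrow> m = n"
  by (auto simp: im_q_def complex_eq_iff vec_eq_iff forall_3)

lemma rot_qmul: "rot (qmul p q) = rot p ** rot q"
proof -
  have "rot (qmul p q) *v n = (rot p ** rot q) *v n" for n
    unfolding im_q_inject[symmetric] matrix_vector_mul_assoc[symmetric] im_q_rot
    by (simp add: qcnj_mult qmul_assoc)
  then show ?thesis by (simp add: matrix_eq)
qed

lemma norm_sq_quaternion:
  "(norm q)\<^sup>2 = (Re (fst q))\<^sup>2 + (Im (fst q))\<^sup>2 + (Re (snd q))\<^sup>2 + (Im (snd q))\<^sup>2"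
  by (simp add: norm_sq_pair cmod_power2)

lemma rot_SO3:
  assumes "norm q = 1"
  shows "rot q \<in> SO3"
proof -
  define a b c d where "a = Re (fst q)" and "b = Im (fst q)" and "c = Re (snd q)" and "d = Im (snd q)"
  note defs = a_def[symmetric] b_def[symmetric] c_def[symmetric] d_def[symmetric]
  have n: "a\<^sup>2 + b\<^sup>2 + c\<^sup>2 + d\<^sup>2 = 1"
    using assms norm_sq_quaternion[of q] by (simp add: defs)
  have "det (rot q) = (a\<^sup>2 + b\<^sup>2 + c\<^sup>2 + d\<^sup>2) ^ 3"
    unfolding det_3 rot_nth defs by algebra
  then have "det (rot q) = 1" by (simp add: n)
  moreover have "norm (rot q *v n) = norm n" for n
    using assms by (simp add: norm_im_q[symmetric] im_q_rot norm_qmul)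
  then have "orthogonal_transformation ((*v) (rot q))"
    by (simp add: orthogonal_transformation)
  then have "orthogonal_matrix (rot q)"
    by (simp add: orthogonal_transformation_matrix)
  ultimately show ?thesis by (simp add: SO3_def)
qed

lemma SO3_fix_axis:
  assumes R: "R \<in> SO3" "R $ 1 $ 3 = 0" "R $ 2 $ 3 = 0" "R $ 3 $ 3 = 1"
  obtains t where "norm t = 1" "R = rot (t, 0)"
proof -
  have o: "transpose R ** R = mat 1" "R ** transpose R = mat 1" and d: "det R = 1"
    using R(1) by (auto simp: SO3_def orthogonal_matrix_def)
  have "R $ 3 $ 1 * R $ 3 $ 1 + R $ 3 $ 2 * R $ 3 $ 2 + R $ 3 $ 3 * R $ 3 $ 3 = 1"
    using arg_cong[OF o(2), of "\<lambda>M. M $ 3 $ 3"]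
    by (simp add: matrix_matrix_mult_def transpose_def mat_def sum_3)
  then have r3: "R $ 3 $ 1 = 0" "R $ 3 $ 2 = 0"
    using R(4) by (simp_all add: sum_squares_eq_zero_iff)
  have 1: "R $ 1 $ 1 * R $ 1 $ 1 + R $ 2 $ 1 * R $ 2 $ 1 = 1"
    using arg_cong[OF o(1), of "\<lambda>M. M $ 1 $ 1"]
    by (simp add: matrix_matrix_mult_def transpose_def mat_def sum_3 r3)
  have 2: "R $ 1 $ 1 * R $ 1 $ 2 + R $ 2 $ 1 * R $ 2 $ 2 = 0"
    using arg_cong[OF o(1), of "\<lambda>M. M $ 1 $ 2"]
    by (simp add: matrix_matrix_mult_def transpose_def mat_def sum_3 r3)
  have 3: "R $ 1 $ 1 * R $ 2 $ 2 - R $ 1 $ 2 * R $ 2 $ 1 = 1"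
    using d by (simp add: det_3 r3 R)
  have 4: "R $ 2 $ 2 = R $ 1 $ 1" "R $ 1 $ 2 = - R $ 2 $ 1"
    using 1 2 3 by algebra+
  define w where "w = Complex (R $ 1 $ 1) (R $ 2 $ 1)"
  \<comment> \<open>\<open>rot (t, 0)\<close> multiplies the first two coordinates, read as a
    complex number, by \<open>(cnj t)\<^sup>2\<close>.\<close>
  define t where "t = cnj (csqrt w)"
  have "(cmod w)\<^sup>2 = 1" using 1 by (simp add: w_def cmod_power2) (simp add: power2_eq_square)
  then have "cmod w = 1" by (metis norm_ge_zero power2_eq_1_iff neg_0_le_iff_le not_one_le_zero)
  then have nt: "norm t = 1" by (simp add: t_def norm_csqrt)
  have tw: "(cnj t)\<^sup>2 = w" by (simp add: t_def)
  have ab: "(Re t)\<^sup>2 - (Im t)\<^sup>2 = R $ 1 $ 1" "- 2 * Re t * Im t = R $ 2 $ 1"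
    using arg_cong[OF tw, of Re] arg_cong[OF tw, of Im]
    by (simp_all add: w_def power2_eq_square mult_ac)
  have "(Re t)\<^sup>2 + (Im t)\<^sup>2 = 1" using nt cmod_power2[of t] by simp
  then have "R = rot (t, 0)"
    unfolding vec_eq_iff forall_3 rot_nth using ab 4 R r3 by simp
  then show thesis using nt that by blast
qed

text \<open>The Hopf map reaches the third column; what remains is a rotation about the third
  axis.\<close>

lemma rot_surj: "rot ` sphere 0 1 = SO3"
proof (intro equalityI subsetI)
  fix R assume R: "R \<in> SO3"
  define n where "n = column 3 R"
  have "norm n = 1"
    using R unfolding n_def SO3_def by (simp add: orthogonal_matrix_orthonormal_columns)
  then have "im_q n \<in> im_q ` sphere 0 1" by simp
  then obtain q where q: "norm q = 1" "im_q n = qmul (qmul q (\<i>, 0)) (qcnj q)"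
    unfolding hopf_sphere[symmetric] by auto
  have "(\<i>, 0) = im_q (axis 3 1)" by (simp add: im_q_def axis_def)
  then have n: "n = rot q *v axis 3 1"
    using q(2) by (simp only: im_q_rot[symmetric] im_q_inject)
  have Q: "orthogonal_matrix (rot q)" "det (rot q) = 1" using rot_SO3[OF q(1)] by (auto simp: SO3_def)
  define R' where "R' = transpose (rot q) ** R"
  have R': "R' \<in> SO3"
    using R Q by (simp add: SO3_def R'_def orthogonal_matrix_mul orthogonal_matrix_transpose det_mul)
  have "R' *v axis 3 1 = transpose (rot q) *v n"
    unfolding n_def matrix_vector_mult_basis
    by (simp add: R'_def column_def matrix_matrix_mult_def matrix_vector_mult_def vec_eq_iff)
  also have "\<dots> = axis 3 1"
    using Q(1) by (simp add: n matrix_vector_mul_assoc orthogonal_matrix)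
  finally have "column 3 R' = axis 3 1" by (simp add: matrix_vector_mult_basis)
  then have "R' $ 1 $ 3 = 0" "R' $ 2 $ 3 = 0" "R' $ 3 $ 3 = 1"
    by (auto simp: column_def vec_eq_iff axis_def forall_3)
  then obtain t where t: "norm t = 1" "R' = rot (t, 0)" using SO3_fix_axis[OF R'] by blast
  have "rot q ** R' = R"
    using Q(1) by (simp add: R'_def matrix_mul_assoc orthogonal_matrix_def)
  then have "R = rot (qmul q (t, 0))" by (simp add: rot_qmul t)
  moreover have "norm (qmul q (t, 0)) = 1" using q t by (simp add: norm_qmul norm_Pair)
  ultimately show "R \<in> rot ` sphere 0 1" by auto
qed (auto intro: rot_SO3)

text \<open>Invert \<open>rot_nth\<close>: the diagonal entries and the unit norm determine the
  squares, sums and differences of opposite off-diagonal entries the mixed products.\<close>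

lemma polynomial_quaternion_products:
  assumes "i \<in> Basis" "j \<in> Basis"
  shows "\<exists>r. polynomial_function r \<and> (\<forall>q\<in>sphere 0 1. (q \<bullet> i) * (q \<bullet> j) = r (rot q))"
proof -
  define ok where "ok f \<longleftrightarrow> (\<exists>r. polynomial_function r \<and> (\<forall>q\<in>sphere 0 1. f q = r (rot q)))"
    for f :: "complex \<times> complex \<Rightarrow> real"
  have okI: "ok f" if "polynomial_function r" "\<And>q. norm q = 1 \<Longrightarrow> f q = r (rot q)" for f r
    using that by (auto simp: ok_def)
  have n: "(Re (fst q))\<^sup>2 + (Im (fst q))\<^sup>2 + (Re (snd q))\<^sup>2 + (Im (snd q))\<^sup>2 = 1" if "norm q = 1"
    for q :: "complex \<times> complex"
    using that norm_sq_quaternion[of q] by simp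
  have sq: "ok (\<lambda>q. Re (fst q) * Re (fst q))" "ok (\<lambda>q. Im (fst q) * Im (fst q))"
    "ok (\<lambda>q. Re (snd q) * Re (snd q))" "ok (\<lambda>q. Im (snd q) * Im (snd q))"
    by (rule okI[of "\<lambda>R. (1 + R $ 1 $ 1 + R $ 2 $ 2 + R $ 3 $ 3) / 4"]
        okI[of "\<lambda>R. (1 - R $ 1 $ 1 - R $ 2 $ 2 + R $ 3 $ 3) / 4"]
        okI[of "\<lambda>R. (1 + R $ 1 $ 1 - R $ 2 $ 2 - R $ 3 $ 3) / 4"]
        okI[of "\<lambda>R. (1 - R $ 1 $ 1 + R $ 2 $ 2 - R $ 3 $ 3) / 4"];
      (intro poly_intros)?; (drule n)?; (simp add: rot_nth power2_eq_square))+
  have mixed: "ok (\<lambda>q. Re (fst q) * Im (fst q))" "ok (\<lambda>q. Re (snd q) * Im (snd q))"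
    "ok (\<lambda>q. Re (fst q) * Im (snd q))" "ok (\<lambda>q. Im (fst q) * Re (snd q))"
    "ok (\<lambda>q. Re (fst q) * Re (snd q))" "ok (\<lambda>q. Im (fst q) * Im (snd q))"
    by (rule okI[of "\<lambda>R. (R $ 1 $ 2 - R $ 2 $ 1) / 4"] okI[of "\<lambda>R. (R $ 1 $ 2 + R $ 2 $ 1) / 4"]
        okI[of "\<lambda>R. (R $ 3 $ 1 - R $ 1 $ 3) / 4"] okI[of "\<lambda>R. (R $ 3 $ 1 + R $ 1 $ 3) / 4"]
        okI[of "\<lambda>R. (R $ 2 $ 3 - R $ 3 $ 2) / 4"] okI[of "\<lambda>R. (R $ 2 $ 3 + R $ 3 $ 2) / 4"];
      (intro poly_intros)?; (simp add: rot_nth))+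
  have "ok (\<lambda>q. (q \<bullet> i) * (q \<bullet> j))"
    using assms sq mixed
    by (auto simp: Basis_prod_def Basis_complex_def inner_prod_def inner_complex_def mult.commute)
  then show ?thesis by (simp add: ok_def)
qed


section \<open>Covariants and generic orbits\<close>

definition binary_form :: "nat \<Rightarrow> (complex \<Rightarrow> complex \<Rightarrow> complex) \<Rightarrow> bool" where
  "binary_form d F \<longleftrightarrow> (\<exists>C. \<forall>x y. F x y = (\<Sum>j\<le>d. C j * x ^ j * y ^ (d - j)))"

lemma binary_form_add:
  assumes "binary_form d F" "binary_form d G"
  shows "binary_form d (\<lambda>x y. F x y + G x y)"
proof -
  obtain C E where "\<forall>x y. F x y = (\<Sum>j\<le>d. C j * x ^ j * y ^ (d - j))"
    "\<forall>x y. G x y = (\<Sum>j\<le>d. E j * x ^ j * y ^ (d - j))"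
    using assms unfolding binary_form_def by blast
  then show ?thesis unfolding binary_form_def
    by (intro exI[of _ "\<lambda>j. C j + E j"]) (simp add: sum.distrib algebra_simps)
qed

lemma binary_form_mult_linear:
  assumes "binary_form d F"
  shows "binary_form (Suc d) (\<lambda>x y. (e * x + f * y) * F x y)"
proof -
  obtain C where C: "\<And>x y. F x y = (\<Sum>j\<le>d. C j * x ^ j * y ^ (d - j))"
    using assms unfolding binary_form_def by blast
  have "binary_form (Suc d) (\<lambda>x y. e * x * F x y)"
    unfolding binary_form_def
  proof (intro exI[of _ "\<lambda>j. if j = 0 then 0 else e * C (j - 1)"] allI)
    fix x y
    show "e * x * F x y = (\<Sum>j\<le>Suc d. (if j = 0 then 0 else e * C (j - 1)) * x ^ j * y ^ (Suc d - j))"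
      by (subst sum.atMost_Suc_shift) (simp add: C sum_distrib_left algebra_simps)
  qed
  moreover have "binary_form (Suc d) (\<lambda>x y. f * y * F x y)"
    unfolding binary_form_def
  proof (intro exI[of _ "\<lambda>j. if j \<le> d then f * C j else 0"] allI)
    fix x y
    show "f * y * F x y = (\<Sum>j\<le>Suc d. (if j \<le> d then f * C j else 0) * x ^ j * y ^ (Suc d - j))"
      by (simp add: C sum_distrib_left Suc_diff_le algebra_simps)
  qed
  ultimately show ?thesis
    using binary_form_add by (fastforce simp: algebra_simps)
qed

lemma binary_form_mult_qform:
  assumes "binary_form d F"
  shows "binary_form (Suc (Suc d)) (\<lambda>x y. qform h x y * F x y)"
proof -
  let ?a = "cnj (fst h) - fst h"
  have "binary_form (Suc (Suc d)) (\<lambda>x y. (1 * x + 0 * y) * ((snd h * x + ?a * y) * F x y))"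
    by (intro binary_form_mult_linear assms)
  moreover have "binary_form (Suc (Suc d)) (\<lambda>x y. (0 * x + 1 * y) * ((0 * x + cnj (snd h) * y) * F x y))"
    by (intro binary_form_mult_linear assms)
  moreover have "qform h x y * F x y = (1 * x + 0 * y) * ((snd h * x + ?a * y) * F x y) +
      (0 * x + 1 * y) * ((0 * x + cnj (snd h) * y) * F x y)" for x y
    by (simp add: qform_def algebra_simps power2_eq_square)
  ultimately show ?thesis by (simp only: binary_form_add)
qed

lemma binary_form_mult_qform_power:
  "binary_form d F \<Longrightarrow> binary_form (d + 2 * p) (\<lambda>x y. F x y * qform h x y ^ p)"
proof (induction p)
  case (Suc p)
  from binary_form_mult_qform[OF Suc.IH[OF Suc.prems], of h] show ?case
    by (simp add: mult_ac)
qed simp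

lemma binary_form_monomial: "binary_form (i + j) (\<lambda>x y. x ^ i * y ^ j)"
  unfolding binary_form_def
proof (intro exI[of _ "\<lambda>n. if n = i then 1 else 0"] allI)
  fix x y :: complex
  have "(\<Sum>n\<le>i + j. (if n = i then 1 else 0) * x ^ n * y ^ (i + j - n)) =
      (\<Sum>n\<le>i + j. if n = i then x ^ i * y ^ j else 0)"
    by (intro sum.cong) auto
  then show "x ^ i * y ^ j = (\<Sum>n\<le>i + j. (if n = i then 1 else 0) * x ^ n * y ^ (i + j - n))"
    by simp
qed

context wigner_rep
begin

lemma ev_of_values:
  assumes "binary_form N F"
  shows "ev (of_values F) = F"
proof -
  obtain C where C: "\<And>x y. F x y = (\<Sum>j\<le>N. C j * x ^ j * y ^ (N - j))"
    using assms unfolding binary_form_def by blast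
  define v where "v = (\<chi> m. C (k m) / of_real (wt m))"
  have "ev v x y = (\<Sum>m\<in>UNIV. C (k m) * x ^ k m * y ^ (N - k m))" for x y
  proof -
    have "wt m \<noteq> 0" for m using wt_pos[of m] by simp
    then show ?thesis unfolding ev_def by (intro sum.cong refl) (simp add: v_def pv_nth)
  qed
  then have "ev v = F"
    using sum_k[of "\<lambda>j. C j * _ ^ j * _ ^ (N - j)"] by (intro ext) (simp add: C)
  then show ?thesis by (metis of_values_ev)
qed

lemma of_values_add: "of_values (\<lambda>x y. F x y + G x y) = of_values F + of_values G"
  and of_values_scale: "of_values (\<lambda>x y. c * F x y) = c *s of_values F"
proof -
  obtain Z e where Z: "of_values = (\<lambda>F. \<chi> m. \<Sum>z\<in>Z. e m z * F (fst z) (snd z))"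
    using of_values_spec by blast
  show "of_values (\<lambda>x y. F x y + G x y) = of_values F + of_values G"
    "of_values (\<lambda>x y. c * F x y) = c *s of_values F"
    by (simp_all add: Z vec_eq_iff algebra_simps sum.distrib sum_distrib_left)
qed

lemma of_values_monomial: "of_values (\<lambda>x y. c * x ^ k m * y ^ (N - k m)) = (c / of_real (wt m)) *s axis m 1"
proof -
  have "(\<lambda>x y. c * x ^ k m * y ^ (N - k m)) = ev ((c / of_real (wt m)) *s axis m 1)"
    using wt_pos[of m] by (intro ext) (simp add: ev_linear ev_axis pv_nth)
  then show ?thesis by (simp only: of_values_ev)
qed

text \<open>The adjoint of multiplication by the \<open>p\<close>-th power of the moment form: a covariant map from
  \<open>\<complex>\<^sup>2\<^sup>l\<^sup>+\<^sup>1\<close> to the dual of the binary forms of degree \<open>N - 2 p\<close>.\<close>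

definition covariant :: "nat \<Rightarrow> complex^'n \<Rightarrow> (complex \<Rightarrow> complex \<Rightarrow> complex) \<Rightarrow> complex" where
  "covariant p x F = herm x (of_values (\<lambda>a b. F a b * qform (moment x) a b ^ p))"

lemma covariant_linear:
  "covariant p x (\<lambda>a b. F a b + G a b) = covariant p x F + covariant p x G"
  "covariant p x (\<lambda>a b. c * F a b) = c * covariant p x F"
  by (simp_all add: covariant_def distrib_right of_values_add of_values_scale mult.assoc herm_linear)

lemma polynomial_function_covariant [poly_intros]:
  "polynomial_function (\<lambda>x. covariant p x F)"
  unfolding covariant_def by (intro poly_intros)

text \<open>\<open>herm_D\<close> moves \<open>D q\<close> to the other argument as
  \<open>D (qcnj q)\<close>; its substitution turns the moment form at \<open>D q *v x\<close> back
  into the one at \<open>x\<close>, so only \<open>F\<close> changes.\<close>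

lemma covariant_D:
  assumes F: "binary_form r F" "r + 2 * p = N" and q: "norm q = 1"
  shows "covariant p (D q *v x) F =
    covariant p x (\<lambda>a b. F (fst q * a - cnj (snd q) * b) (snd q * a + cnj (fst q) * b))"
proof -
  define F' where "F' = (\<lambda>a b. F a b * qform (moment (D q *v x)) a b ^ p)"
  have "binary_form N F'"
    unfolding F'_def F(2)[symmetric] by (rule binary_form_mult_qform_power[OF F(1)])
  then have ev: "ev (of_values F') = F'" by (rule ev_of_values)
  have n: "cnj (fst q) * fst q + cnj (snd q) * snd q = 1"
    using pair_mult_cnj[of q] q by (simp add: mult.commute)
  have "F' (fst q * a - cnj (snd q) * b) (snd q * a + cnj (fst q) * b) =
      F (fst q * a - cnj (snd q) * b) (snd q * a + cnj (fst q) * b) * qform (moment x) a b ^ p" for a b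
  proof -
    have "cnj (fst q) * (fst q * a - cnj (snd q) * b) + cnj (snd q) * (snd q * a + cnj (fst q) * b) = a"
      "- snd q * (fst q * a - cnj (snd q) * b) + fst q * (snd q * a + cnj (fst q) * b) = b"
      using n by algebra+
    then show ?thesis by (simp only: F'_def moment_D[OF q] qform_conj)
  qed
  then have "ev (D (qcnj q) *v of_values F') =
      (\<lambda>a b. F (fst q * a - cnj (snd q) * b) (snd q * a + cnj (fst q) * b) * qform (moment x) a b ^ p)"
    by (intro ext) (simp add: ev_D ev qcnj_def)
  then have "D (qcnj q) *v of_values F' = of_values
      (\<lambda>a b. F (fst q * a - cnj (snd q) * b) (snd q * a + cnj (fst q) * b) * qform (moment x) a b ^ p)"
    by (metis of_values_ev)
  then show ?thesis
    by (simp add: covariant_def herm_D F'_def[symmetric])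
qed

text \<open>At a weight vector the moment form is \<open>4 * \<i> * s * a * b\<close>, so monomials
  go to monomials and a single weight survives.\<close>

lemma covariant_axis:
  assumes m: "ix m = s" and ij: "i + j + 2 * p = N"
  shows "covariant p (axis m 1) (\<lambda>a b. a ^ i * b ^ j) =
    (if k m = i + p then (4 * \<i> * of_real s) ^ p / of_real (wt m) else 0)"
proof -
  obtain m' where m': "k m' = i + p"
    using bij_k ij by (metis atMost_iff bij_betw_iff_bijections le_add1 add.assoc add.commute mult_2)
  have "N - k m' = j + p" using ij m' by simp
  moreover have "qform (moment (axis m 1)) a b = (4 * \<i> * of_real s) * (a * b)" for a b
    by (simp add: moment_axis qform_def m algebra_simps)
  ultimately have eq: "(\<lambda>a b. a ^ i * b ^ j * qform (moment (axis m 1)) a b ^ p) =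
      (\<lambda>a b. (4 * \<i> * of_real s) ^ p * a ^ k m' * b ^ (N - k m'))"
    by (intro ext) (simp add: m' power_add power_mult_distrib mult_ac)
  have "covariant p (axis m 1) (\<lambda>a b. a ^ i * b ^ j) =
      ((4 * \<i> * of_real s) ^ p / of_real (wt m')) * (if m = m' then 1 else 0)"
    unfolding covariant_def eq of_values_monomial herm_linear herm_axis by (simp add: axis_def)
  then show ?thesis using k_inject[of m m'] m' by auto
qed

definition spinor :: "nat \<Rightarrow> complex^'n \<Rightarrow> complex \<times> complex" where
  "spinor p x = (covariant p x (\<lambda>a b. a ^ 1 * b ^ 0), covariant p x (\<lambda>a b. a ^ 0 * b ^ 1))"

lemma spinor_D:
  assumes p: "1 + 2 * p = N" and q: "norm q = 1"
  shows "spinor p (D q *v x) = qmul q (spinor p x)"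
proof -
  have a: "binary_form 1 (\<lambda>a b. a ^ 1 * b ^ 0)" and b: "binary_form 1 (\<lambda>a b. a ^ 0 * b ^ 1)"
    using binary_form_monomial[of 1 0] binary_form_monomial[of 0 1] by simp_all
  show ?thesis
    unfolding spinor_def covariant_D[OF a p q] covariant_D[OF b p q]
    using covariant_linear(1)[of p x "\<lambda>a b. fst q * a" "\<lambda>a b. - cnj (snd q) * b"]
      covariant_linear(1)[of p x "\<lambda>a b. snd q * a" "\<lambda>a b. cnj (fst q) * b"]
      covariant_linear(2)[of p x "- cnj (snd q)" "\<lambda>a b. b"]
      covariant_linear(2)[of p x _ "\<lambda>a b. a"] covariant_linear(2)[of p x _ "\<lambda>a b. b"]
    by (simp add: qmul_def)
qed

lemma orbit_SU2:
  assumes p: "1 + 2 * p = N" and v: "spinor p v \<noteq> 0"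
  shows "diffeomorphic (wigner_orbit l ix v) SU2"
proof -
  \<comment> \<open>Right division by the quaternion \<open>spinor p v\<close>.\<close>
  define G where "G x = (1 / (norm (spinor p v))\<^sup>2) *\<^sub>R qmul (spinor p x) (qcnj (spinor p v))" for x
  define H :: "complex^'n \<Rightarrow> complex^2^2" where "H x = (\<chi> i j. if i = 1 then if j = 1 then fst (G x) else - cnj (snd (G x))
      else if j = 1 then snd (G x) else cnj (fst (G x)))" for x
  have G: "G (D q *v v) = q" if "norm q = 1" for q
  proof -
    have "qmul q (of_real t, 0) = t *\<^sub>R q" for t
      by (simp add: qmul_def prod_eq_iff scaleR_conv_of_real mult.commute)
    then show ?thesis
      using v by (simp add: G_def spinor_D[OF p that] qmul_assoc qmul_qcnj del: of_real_power)
  qed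
  have H: "H x = hmat (fst (G x)) (snd (G x))" for x
    by (simp add: H_def vec_eq_iff forall_2)
  have polyG: "polynomial_function G"
    unfolding G_def spinor_def by (intro poly_intros)
  have "polynomial_function H"
    unfolding H_def
  proof (intro polynomial_function_vec_lambda)
    show "polynomial_function (\<lambda>x. if i = 1 then if j = 1 then fst (G x) else - cnj (snd (G x))
        else if j = 1 then snd (G x) else cnj (fst (G x)))" for i j :: 2
      by (cases "i = 1"; cases "j = 1") (simp_all add: poly_intros polyG)
  qed
  moreover have "polynomial_function (\<lambda>g. D (g $ 1 $ 1, g $ 2 $ 1) *v v)"
    by (intro poly_intros)
  ultimately have "diffeomorphism (wigner_orbit l ix v) SU2 H"
  proof (rule diffeomorphism_polynomial)
    show "H ` wigner_orbit l ix v = SU2"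
      unfolding wigner_orbit_eq SU2_image image_image H
      by (intro image_cong) (simp_all add: G del: split_paired_All)
    fix x assume "x \<in> wigner_orbit l ix v"
    then obtain q where "norm q = 1" "x = D q *v v" by (auto simp: wigner_orbit_eq)
    then show "D (H x $ 1 $ 1, H x $ 2 $ 1) *v v = x" by (simp add: H G)
  qed
  then show ?thesis unfolding diffeomorphic_def by blast
qed

text \<open>The symmetric matrix \<open>\<Gamma>\<close> of the covariant of degree 2 transforms to \<open>g \<Gamma> g\<^sup>T\<close>; multiplied by the
  symplectic matrix it is conjugated, and it is decomposed into its skew-Hermitian and
  Hermitian parts.\<close>

definition frame1 :: "nat \<Rightarrow> complex^'n \<Rightarrow> real^3" where
  "frame1 p x = (let \<beta> = - (covariant p x (\<lambda>a b. a ^ 0 * b ^ 2) + cnj (covariant p x (\<lambda>a b. a ^ 2 * b ^ 0))) / 2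
    in \<chi> i. if i = 1 then Re \<beta> else if i = 2 then Im \<beta> else - Im (covariant p x (\<lambda>a b. a ^ 1 * b ^ 1)))"

definition frame2 :: "nat \<Rightarrow> complex^'n \<Rightarrow> real^3" where
  "frame2 p x = (let \<beta> = (cnj (covariant p x (\<lambda>a b. a ^ 2 * b ^ 0)) - covariant p x (\<lambda>a b. a ^ 0 * b ^ 2)) / (2 * \<i>)
    in \<chi> i. if i = 1 then Re \<beta> else if i = 2 then Im \<beta> else Re (covariant p x (\<lambda>a b. a ^ 1 * b ^ 1)))"

lemma frame_D:
  assumes p: "2 + 2 * p = N" and q: "norm q = 1"
  shows "frame1 p (D q *v x) = rot q *v frame1 p x" "frame2 p (D q *v x) = rot q *v frame2 p x"
proof -
  have b: "binary_form 2 (\<lambda>a b. a ^ 2 * b ^ 0)" "binary_form 2 (\<lambda>a b. a ^ 1 * b ^ 1)"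
    "binary_form 2 (\<lambda>a b. a ^ 0 * b ^ 2)"
    using binary_form_monomial[of 2 0] binary_form_monomial[of 1 1] binary_form_monomial[of 0 2]
    by (simp_all add: numeral_2_eq_2)
  define P R S where "P = covariant p x (\<lambda>a b. a ^ 2 * b ^ 0)" and "R = covariant p x (\<lambda>a b. a ^ 1 * b ^ 1)"
    and "S = covariant p x (\<lambda>a b. a ^ 0 * b ^ 2)"
  note defs = P_def[symmetric] R_def[symmetric] S_def[symmetric]
  have quad: "covariant p x (\<lambda>a b. c * (a ^ 2 * b ^ 0) + (d * (a ^ 1 * b ^ 1) + e * (a ^ 0 * b ^ 2))) =
      c * P + (d * R + e * S)" for c d e
    by (simp only: covariant_linear defs)
  have 1: "covariant p (D q *v x) (\<lambda>a b. a ^ 2 * b ^ 0) =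
      (fst q)\<^sup>2 * P + (- 2 * fst q * cnj (snd q) * R + (cnj (snd q))\<^sup>2 * S)"
    unfolding covariant_D[OF b(1) p q] quad[symmetric]
    by (rule arg_cong[of _ _ "covariant p x"]) (simp add: fun_eq_iff algebra_simps power2_eq_square)
  have 2: "covariant p (D q *v x) (\<lambda>a b. a ^ 1 * b ^ 1) =
      fst q * snd q * P + ((fst q * cnj (fst q) - snd q * cnj (snd q)) * R + (- cnj (snd q) * cnj (fst q)) * S)"
    unfolding covariant_D[OF b(2) p q] quad[symmetric]
    by (rule arg_cong[of _ _ "covariant p x"]) (simp add: fun_eq_iff algebra_simps power2_eq_square)
  have 3: "covariant p (D q *v x) (\<lambda>a b. a ^ 0 * b ^ 2) =
      (snd q)\<^sup>2 * P + (2 * snd q * cnj (fst q) * R + (cnj (fst q))\<^sup>2 * S)"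
    unfolding covariant_D[OF b(3) p q] quad[symmetric]
    by (rule arg_cong[of _ _ "covariant p x"]) (simp add: fun_eq_iff algebra_simps power2_eq_square)
  show "frame1 p (D q *v x) = rot q *v frame1 p x"
    unfolding vec_eq_iff forall_3 frame1_def Let_def 1 2 3 defs
    by (simp add: matrix_vector_mult_def sum_3 rot_nth field_simps power2_eq_square)
  show "frame2 p (D q *v x) = rot q *v frame2 p x"
    unfolding vec_eq_iff forall_3 frame2_def Let_def 1 2 3 defs
    by (simp add: matrix_vector_mult_def sum_3 rot_nth Re_divide Im_divide field_simps power2_eq_square)
qed

text \<open>The cross product completes two vectors to an equivariant square matrix, since rotations
  preserve it; the determinant is the squared norm of the cross product.\<close>

definition frame :: "nat \<Rightarrow> complex^'n \<Rightarrow> real^3^3" where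
  "frame p x = (\<chi> i j. if j = 1 then frame1 p x $ i else if j = 2 then frame2 p x $ i
     else cross3 (frame1 p x) (frame2 p x) $ i)"

lemma frame_matrix_D:
  assumes p: "2 + 2 * p = N" and q: "norm q = 1"
  shows "frame p (D q *v x) = rot q ** frame p x"
proof -
  have "cross3 (rot q *v a) (rot q *v b) = rot q *v cross3 a b" for a b
    using cross_orthogonal_matrix[of "rot q" a b] rot_SO3[OF q] by (simp add: SO3_def)
  then have "frame p (D q *v x) $ i $ j = (rot q ** frame p x) $ i $ j" for i j
    unfolding frame_def frame_D[OF p q] using exhaust_3[of j]
    by (elim disjE) (simp_all add: matrix_matrix_mult_def matrix_vector_mult_def)
  then show ?thesis by (simp add: vec_eq_iff)
qed

lemma polynomial_function_frame [poly_intros]: "polynomial_function (frame p)"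
proof -
  have 1: "polynomial_function (\<lambda>x. frame1 p x $ i)" for i
    unfolding frame1_def Let_def using exhaust_3[of i] by (elim disjE) (simp_all add: poly_intros)
  have 2: "polynomial_function (\<lambda>x. frame2 p x $ i)" for i
    unfolding frame2_def Let_def using exhaust_3[of i] by (elim disjE) (simp_all add: poly_intros)
  have 3: "polynomial_function (\<lambda>x. cross3 (frame1 p x) (frame2 p x) $ i)" for i
    unfolding cross3_def using exhaust_3[of i] by (elim disjE) (simp_all add: poly_intros 1 2)
  have "polynomial_function (\<lambda>x. if j = 1 then frame1 p x $ i else if j = 2 then frame2 p x $ i
     else cross3 (frame1 p x) (frame2 p x) $ i)" for i j :: 3
    using exhaust_3[of j] by (elim disjE) (simp_all add: 1 2 3)
  then have "polynomial_function (\<lambda>x. frame p x)"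
    unfolding frame_def by (intro polynomial_function_vec_lambda)
  then show ?thesis by simp
qed

text \<open>Multiplying the frame by the inverse of its value at \<open>v\<close> leaves
  \<open>rot q\<close>. In the other direction the orbit map is even in \<open>q\<close>, since
  \<open>N\<close> is even, and so is polynomial in \<open>rot q\<close>.\<close>

lemma orbit_SO3:
  assumes p: "2 + 2 * p = N" and v: "det (frame p v) \<noteq> 0"
  shows "diffeomorphic (wigner_orbit l ix v) SO3"
proof -
  obtain B where inv: "frame p v ** B = mat 1"
    using v unfolding invertible_det_nz[symmetric] invertible_def by blast
  define G where "G x = frame p x ** B" for x
  have G: "G (D q *v v) = rot q" if "norm q = 1" for q
    by (simp add: G_def frame_matrix_D[OF p that] matrix_mul_assoc[symmetric] inv)
  have polyG: "polynomial_function G"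
    unfolding G_def matrix_matrix_mult_def by (intro poly_intros)
  have "even N" using p by presburger
  then have D_minus: "D (- q) *v v = D q *v v" for q
    using D_scale[of "- 1" q v] by simp
  have rot_minus: "rot (- q) = rot q" for q by (simp add: vec_eq_iff forall_3 rot_nth)
  have X: "- q \<in> sphere 0 1 \<and> rot (- q) = rot q \<and> D (- q) *v v = D q *v v"
    if "q \<in> sphere 0 1" for q
    using that by (simp add: D_minus rot_minus)
  obtain r where r: "polynomial_function r" "\<And>q. q \<in> sphere 0 1 \<Longrightarrow> D q *v v = r (rot q)"
    by (rule even_polynomial_function[OF polynomial_function_D_apply[of v] polynomial_quaternion_products],
        assumption, assumption, erule X, rule that)
  have "diffeomorphism (wigner_orbit l ix v) SO3 G"
    using polyG r(1)
  proof (rule diffeomorphism_polynomial)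
    show "G ` wigner_orbit l ix v = SO3"
      unfolding wigner_orbit_eq rot_surj[symmetric] image_image
      by (intro image_cong) (simp_all add: G del: split_paired_All)
    fix x assume "x \<in> wigner_orbit l ix v"
    then obtain q where q: "norm q = 1" "x = D q *v v" by (auto simp: wigner_orbit_eq)
    have "G x = rot q" unfolding q(2) by (rule G[OF q(1)])
    moreover have "x = r (rot q)" unfolding q(2) using q(1) by (intro r(2)) simp
    ultimately show "r (G x) = x" by simp
  qed
  then show ?thesis unfolding diffeomorphic_def by blast
qed

lemma AE_orbit:
  assumes "0 < l"
  shows "AE v in (lebesgue :: (complex^'n) measure).
           (l \<notin> \<nat> \<longrightarrow> diffeomorphic (wigner_orbit l ix v) SU2)
           \<and> (l \<in> \<nat> \<longrightarrow> diffeomorphic (wigner_orbit l ix v) SO3)"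
proof -
  have AE: "AE v in (lebesgue :: (complex^'n) measure). f v \<noteq> 0"
    if "polynomial_function f" "f v0 \<noteq> 0" for f :: "complex^'n \<Rightarrow> real" and v0
    using negligible_polynomial_zeros[OF that]
    by (intro AE_I'[of "{v. f v = 0}"]) (auto simp: negligible_iff_null_sets)
  have N0: "N > 0" using assms N by (cases N) auto
  show ?thesis
  proof (cases "odd N")
    case True
    then obtain p where p: "1 + 2 * p = N" by (metis oddE add.commute)
    have "l \<notin> \<nat>"
    proof
      assume "l \<in> \<nat>"
      then obtain j where "l = real j" by (auto elim: Nats_cases)
      then have "real N = real (2 * j)" using N by simp
      then have "N = 2 * j" by (simp only: of_nat_eq_iff)
      then show False using True by simp
    qed
    \<comment> \<open>Weight 1/2, the one that the covariant pairs with the monomial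
      \<open>a\<close>; the moment factor is \<open>2 * \<i>\<close>.\<close>
    obtain m where m: "k m = p + 1"
      using bij_k p by (metis atMost_iff bij_betw_iff_bijections add.commute le_add1 mult_2 add_le_mono1 add_left_mono)
    have "ix m = 1 / 2" using ix_k[of m] m p N by (simp add: field_simps)
    from covariant_axis[OF this, of 1 0 p] have "spinor p (axis m 1) \<noteq> 0"
      using p m wt_pos[of m] by (simp add: spinor_def zero_prod_def)
    then have "spinor p (axis m 1) \<bullet> spinor p (axis m 1) \<noteq> 0" by simp
    moreover have "polynomial_function (\<lambda>x. spinor p x \<bullet> spinor p x)"
      unfolding spinor_def by (intro poly_intros)
    ultimately have "AE v in (lebesgue :: (complex^'n) measure). spinor p v \<bullet> spinor p v \<noteq> 0"
      using AE[of "\<lambda>x. spinor p x \<bullet> spinor p x" "axis m 1"] by simp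
    then show ?thesis
      by (rule eventually_mono) (use \<open>l \<notin> \<nat>\<close> in \<open>auto intro: orbit_SU2[OF p]\<close>)
  next
    case False
    then obtain j where j: "N = 2 * j" by blast
    then obtain p where p: "2 + 2 * p = N" using N0 by (cases j) auto
    have "l = real j" using N j by simp
    then have "l \<in> \<nat>" by simp
    obtain m where m: "k m = p + 2"
      using bij_k p by (metis atMost_iff bij_betw_iff_bijections add.commute le_add1 mult_2 add_left_mono)
    have ixm: "ix m = 1" using ix_k[of m] m p N by (simp add: field_simps)
    define c :: complex where "c = (4 * \<i>) ^ p / of_real (wt m)"
    have c: "c \<noteq> 0" using wt_pos[of m] by (simp add: c_def)
    have cov: "covariant p (axis m 1) (\<lambda>a b. a ^ 2 * b ^ 0) = c"
      "covariant p (axis m 1) (\<lambda>a b. a ^ 1 * b ^ 1) = 0"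
      "covariant p (axis m 1) (\<lambda>a b. a ^ 0 * b ^ 2) = 0"
      using covariant_axis[OF ixm, of 2 0 p] covariant_axis[OF ixm, of 1 1 p]
        covariant_axis[OF ixm, of 0 2 p] p m by (simp_all add: c_def)
    \<comment> \<open>At weight 1 only \<open>a\<^sup>2\<close> pairs, and the two frame vectors are
      orthogonal of length \<open>cmod c / 2\<close>.\<close>
    have "det (frame p (axis m 1)) = (((Re c)\<^sup>2 + (Im c)\<^sup>2) / 4)\<^sup>2"
      unfolding det_3 frame_def frame1_def frame2_def Let_def cov cross3_def
      by (simp add: vector_3 Re_divide Im_divide field_simps power2_eq_square)
    moreover have "(Re c)\<^sup>2 + (Im c)\<^sup>2 > 0"
      using c by (simp only: sum_power2_gt_zero_iff) (auto simp: complex_eq_iff)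
    ultimately have "det (frame p (axis m 1)) \<noteq> 0" by auto
    moreover have "polynomial_function (\<lambda>x. det (frame p x))"
      unfolding det_3 by (intro poly_intros)
    ultimately have "AE v in (lebesgue :: (complex^'n) measure). det (frame p v) \<noteq> 0"
      using AE[of "\<lambda>x. det (frame p x)" "axis m 1"] by simp
    then show ?thesis
      by (rule eventually_mono) (use \<open>l \<in> \<nat>\<close> in \<open>auto intro: orbit_SO3[OF p]\<close>)
  qed
qed

end


section \<open>Pieces of orbits\<close>

lemma hausdorff_outer_hyperplane_section:
  fixes \<Phi> :: "'a::euclidean_space \<Rightarrow> complex^'n::finite"
  assumes \<Phi>: "polynomial_function \<Phi>" and hom: "\<And>t q. \<Phi> (t *\<^sub>R q) = t ^ r *\<^sub>R \<Phi> q"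
    and q0: "herm u (\<Phi> q0) \<noteq> 0" and n: "DIM('a) \<le> Suc n"
    and A: "A \<subseteq> \<Phi> ` sphere 0 1" "\<And>a. a \<in> A \<Longrightarrow> herm u a = 0"
  shows "hausdorff_outer n A = 0"
proof -
  \<comment> \<open>One real polynomial for the complex equation; by homogeneity its zero set is a
    cone.\<close>
  define p where "p q = (Re (herm u (\<Phi> q)))\<^sup>2 + (Im (herm u (\<Phi> q)))\<^sup>2" for q
  define Z where "Z = {q. p q = 0}"
  have Z: "q \<in> Z \<longleftrightarrow> herm u (\<Phi> q) = 0" for q
    by (simp add: Z_def p_def complex_eq_iff sum_power2_eq_zero_iff)
  have p: "polynomial_function p"
    unfolding p_def by (intro poly_intros \<Phi>)
  have "p q0 \<noteq> 0" using q0 Z[of q0] by (simp add: Z_def)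
  then have "negligible Z" unfolding Z_def by (rule negligible_polynomial_zeros[OF p])
  moreover have "closed Z"
    unfolding Z_def by (intro closed_Collect_eq continuous_on_polymonial_function[OF p] continuous_intros)
  moreover have "t *\<^sub>R q \<in> Z" if "q \<in> Z" "t > 0" for q t
    using that by (simp add: Z hom herm_linear)
  moreover obtain L where "L-lipschitz_on (cball 0 1) \<Phi>"
    by (rule polynomial_function_lipschitz_cball[OF \<Phi>, of 1])
  then have "L-lipschitz_on (sphere 0 1) \<Phi>"
    by (rule lipschitz_on_subset) auto
  ultimately have "hausdorff_outer n (\<Phi> ` (Z \<inter> sphere 0 1)) = 0"
    using n by (intro hausdorff_outer_cone_base)
  moreover have "A \<subseteq> \<Phi> ` (Z \<inter> sphere 0 1)"
    using A by (fastforce simp: Z)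
  ultimately show ?thesis
    using hausdorff_outer_mono[of A "\<Phi> ` (Z \<inter> sphere 0 1)" n] by simp
qed

context wigner_rep
begin

lemma D_smult: "D q *v (c *s v) = c *s (D q *v v)"
  by (rule ev_inject) (simp add: ev_D ev_linear)

lemma self_in_orbit: "v \<in> wigner_orbit l ix v"
  by (auto simp: wigner_orbit_eq D_one norm_Pair intro!: image_eqI[of _ _ "(1, 0)"])

lemma orbit_velocities:
  assumes M: "submanifold_of_dim n (wigner_orbit l ix v)"
  obtains T where "subspace T" "dim T \<le> n" "\<And>d. Re (fst d) = 0 \<Longrightarrow> dD d *v v \<in> T"
proof (rule submanifold_velocities[OF M self_in_orbit])
  fix T
  assume T: "subspace T" "dim T \<le> n"
    and vel: "\<And>\<gamma> w. \<lbrakk>\<And>t. \<gamma> t \<in> wigner_orbit l ix v; \<gamma> 0 = v;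
      (\<gamma> has_vector_derivative w) (at (0::real))\<rbrakk> \<Longrightarrow> w \<in> T"
  have "dD d *v v \<in> T" if d: "Re (fst d) = 0" for d
  proof (cases "d = 0")
    case True
    then show ?thesis using T(1) by (simp add: linear_0[OF linear_dD] subspace_0)
  next
    case False
    define e where "e = d /\<^sub>R norm d"
    have e: "norm e = 1" "Re (fst e) = 0" using False d by (simp_all add: e_def)
    \<comment> \<open>The great circle through the identity with velocity \<open>e\<close>.\<close>
    define q where "q t = (complex_of_real (cos t), 0) + sin t *\<^sub>R e" for t :: real
    have "norm (q t) = 1" for t
    proof -
      have "(norm (q t))\<^sup>2 = (cos t)\<^sup>2 + (sin t)\<^sup>2 * (norm e)\<^sup>2"
        unfolding norm_sq_quaternion by (simp add: q_def e(2) algebra_simps power_mult_distrib)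
      then have "(norm (q t))\<^sup>2 = 1\<^sup>2" using e(1) by simp
      then show ?thesis by (simp only: power2_eq_iff_nonneg norm_ge_zero zero_le_one)
    qed
    then have in_orbit: "D (q t) *v v \<in> wigner_orbit l ix v" for t
      by (auto simp: wigner_orbit_eq)
    have q0: "q 0 = (1, 0)" by (simp add: q_def zero_prod_def[symmetric])
    have "(q has_vector_derivative e) (at 0)"
    proof -
      have "((\<lambda>t. cos t *\<^sub>R (1::complex, 0::complex) + sin t *\<^sub>R e) has_vector_derivative e) (at 0)"
        by (auto intro!: derivative_eq_intros simp: zero_prod_def)
      then show ?thesis by (simp add: q_def[abs_def] scaleR_conv_of_real)
    qed
    then have "(q has_derivative (\<lambda>h. h *\<^sub>R e)) (at 0)" by (simp add: has_vector_derivative_def)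
    from has_derivative_compose[OF this, of "\<lambda>q. D q *v v" "\<lambda>d. dD d *v v"]
    have "((\<lambda>t. D (q t) *v v) has_vector_derivative dD e *v v) (at 0)"
      by (simp add: q0 has_derivative_D_apply has_vector_derivative_def linear_scale[OF linear_dD]
          scaleR_matrix_vector)
    then have "dD e *v v \<in> T"
      by (intro vel[of "\<lambda>t. D (q t) *v v"] in_orbit) (simp_all add: q0 D_one)
    then have "norm d *\<^sub>R (dD e *v v) \<in> T" using T(1) by (rule subspace_scale[rotated])
    moreover have "d = norm d *\<^sub>R e" using False by (simp add: e_def)
    then have "dD d = norm d *\<^sub>R dD e" by (metis linear_scale[OF linear_dD])
    ultimately show ?thesis by (simp add: scaleR_matrix_vector)
  qed
  with T show thesis by (rule that)
qed

lemma dD_torus_nth: "(dD (t, 0) *v x) $ m = (of_nat (k m) * cnj t + of_nat (N - k m) * t) * x $ m"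
proof -
  have eq: "dD (t, 0) $ m $ s = (if s = m then of_nat (k m) * cnj t + of_nat (N - k m) * t else 0)" for s
  proof -
    have "dD (t, 0) $ m $ s = (dD (t, 0) *v axis s 1) $ m"
      by (simp add: matrix_vector_mult_def axis_def if_distrib cong: if_cong)
    then show ?thesis unfolding dD_torus by (simp add: axis_def)
  qed
  show ?thesis
    unfolding matrix_vector_mult_def vec_lambda_beta eq by (simp add: if_distrib if_distribR cong: if_cong)
qed

lemma linear_dD_apply: "linear f \<Longrightarrow> linear (\<lambda>x. dD (f x) *v v)"
  unfolding linear_iff
  by (simp add: linear_add[OF linear_dD] linear_scale[OF linear_dD] matrix_vector_mult_add_rdistrib
      scaleR_matrix_vector)

text \<open>If the orbit has dimension at most 2, a rotation about some axis fixes \<open>v\<close>; moving that axis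
  to the third coordinate axis turns \<open>v\<close> into a vector of weight 0.\<close>

lemma small_orbit_zonal:
  assumes v: "v \<noteq> 0" and M: "submanifold_of_dim n (wigner_orbit l ix v)" and n: "n \<le> 2"
  obtains m c q where "2 * k m = N" "c \<noteq> 0" "norm q = 1" "D q *v v = c *s axis m 1"
proof -
  obtain T where T: "subspace T" "dim T \<le> n" "\<And>d. Re (fst d) = 0 \<Longrightarrow> dD d *v v \<in> T"
    by (rule orbit_velocities[OF M], rule that)
  define L where "L = (\<lambda>w. dD (im_q w) *v v)"
  have lin: "linear L"
    unfolding L_def by (intro linear_dD_apply) (simp add: linear_iff im_q_linear)
  have "range L \<subseteq> T" using T(3) by (auto simp: L_def intro!: T(3)[OF Re_fst_im_q])
  then have "dim (range L) \<le> 2" using dim_subset T(2) n by (meson order_trans)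
  \<comment> \<open>Three independent directions are mapped into a space of dimension at most
    2.\<close>
  then have "\<not> inj L" using dim_image_eq[OF lin, of UNIV] by (auto simp: inj_on_def)
  then obtain w where w: "w \<noteq> 0" "L w = 0" using linear_injective_0[OF lin] by blast
  define e where "e = w /\<^sub>R norm w"
  have e: "norm e = 1" using w by (simp add: e_def)
  have "L e = 0" unfolding e_def linear_scale[OF lin] w(2) by simp
  obtain q where q: "norm q = 1" "im_q e = qmul (qmul q (\<i>, 0)) (qcnj q)"
    using hopf_surj[of "im_q e"] e by (auto simp: norm_im_q)
  define x where "x = D (qcnj q) *v v"
  have "D q *v (dD (\<i>, 0) *v x) = 0"
    using \<open>L e = 0\<close> dD_conj[OF q(1), of "(\<i>, 0)" v] by (simp add: L_def q(2) x_def)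
  then have "dD (\<i>, 0) *v x = 0" using norm_D[OF q(1)] by (metis norm_eq_zero)
  then have "(of_nat (N - k m) - of_nat (k m)) * \<i> * x $ m = 0" for m
    using dD_torus_nth[of \<i> x m] by (auto simp: algebra_simps)
  then have 0: "x $ m = 0" if "2 * k m \<noteq> N" for m
    using that k_le[of m] by (force simp del: of_nat_diff)
  have "x \<noteq> 0" using v norm_D[of "qcnj q" v] q(1) by (auto simp: x_def)
  then obtain m where m: "x $ m \<noteq> 0" by (auto simp: vec_eq_iff)
  then have km: "2 * k m = N" using 0 by blast
  have xj: "x $ j = (x $ m *s axis m 1) $ j" for j
  proof (cases "j = m")
    case False
    then have "k j \<noteq> k m" by (simp add: k_inject)
    then have "2 * k j \<noteq> N" using km by simp
    then show ?thesis using 0 False by (simp add: axis_def)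
  qed (simp add: axis_def)
  have x: "x = x $ m *s axis m 1"
    by (rule iffD2[OF vec_eq_iff], rule allI, rule xj)
  show thesis
  proof (rule that[OF km m])
    show "norm (qcnj q) = 1" using q(1) by simp
    show "D (qcnj q) *v v = x $ m *s axis m 1" using x by (simp only: x_def[symmetric])
  qed
qed

lemma orbit_D:
  assumes "norm q = 1"
  shows "wigner_orbit l ix (D q *v v) = wigner_orbit l ix v"
proof (intro equalityI subsetI)
  fix y assume "y \<in> wigner_orbit l ix (D q *v v)"
  then obtain p where "norm p = 1" "y = D p *v (D q *v v)" by (auto simp: wigner_orbit_eq)
  then show "y \<in> wigner_orbit l ix v" using assms
    by (auto simp: wigner_orbit_eq D_mult norm_qmul intro!: image_eqI[of _ _ "qmul p q"])
next
  fix y assume "y \<in> wigner_orbit l ix v"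
  then obtain p where p: "norm p = 1" "y = D p *v v" by (auto simp: wigner_orbit_eq)
  then have "y = D (qmul p (qcnj q)) *v (D q *v v)"
    using assms by (simp add: D_mult[symmetric] D_qcnj)
  then show "y \<in> wigner_orbit l ix (D q *v v)" using assms p
    by (auto simp: wigner_orbit_eq norm_qmul intro!: image_eqI[of _ _ "qmul p (qcnj q)"])
qed

text \<open>The off-diagonal directions, a real plane, act injectively on a vector of weight 0. The
  bound makes \<open>n + 1\<close> at least the dimension of \<real>^3, on which the cone argument
  runs.\<close>

lemma zonal_orbit_dim:
  assumes m: "2 * k m = N" and N: "N > 0" and c: "c \<noteq> 0"
    and M: "submanifold_of_dim n (wigner_orbit l ix (c *s axis m 1))"
  shows "2 \<le> n"
proof -
  let ?x = "c *s axis m 1 :: complex^'n"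
  obtain T where T: "subspace T" "dim T \<le> n" "\<And>d. Re (fst d) = 0 \<Longrightarrow> dD d *v ?x \<in> T"
    by (rule orbit_velocities[OF M], rule that)
  define L where "L = (\<lambda>b::complex. dD (0, b) *v ?x)"
  have lin: "linear L"
    unfolding L_def by (intro linear_dD_apply) (simp add: linear_iff)
  have "b = 0" if "L b = 0" for b
  proof -
    have "L b = c *s (dD (0, b) *v axis m 1)"
      by (simp add: L_def vector_scalar_commute)
    then have "norm (dD (0, b) *v axis m 1) = 0" using that c by (simp add: norm_smult_complex)
    then have "norm b * norm (dD (0, 1) *v axis m 1) = 0" by (simp only: norm_dD_off_diagonal[OF m, of b])
    then show "b = 0" using dD_off_diagonal_nonzero[OF m N] by simp
  qed
  then have "inj L" using linear_injective_0[OF lin] by blast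
  then have "dim (range L) = 2" using dim_image_eq[OF lin, of UNIV] by (simp add: dim_UNIV)
  moreover have "range L \<subseteq> T" using T(3) by (auto simp: L_def)
  ultimately show ?thesis using dim_subset[of "range L" T] T(2) by simp
qed

lemma span_orbit_piece:
  assumes v: "v \<noteq> 0" and M: "submanifold_of_dim n (wigner_orbit l ix v)"
    and A: "A \<subseteq> wigner_orbit l ix v" "hausdorff_outer n A > 0"
  shows "vec.span A = UNIV"
proof (rule ccontr)
  assume "vec.span A \<noteq> UNIV"
  then obtain u where u: "u \<noteq> 0" "\<And>a. a \<in> A \<Longrightarrow> herm u a = 0"
    using vec_span_annihilator by blast
  obtain q0 where q0: "norm q0 = 1" "herm u (D q0 *v v) \<noteq> 0"
    using irreducible[OF v, of u] u(1) by blast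
  have "hausdorff_outer n A = 0"
  proof (cases "3 \<le> n")
    case True
    show ?thesis
    proof (rule hausdorff_outer_hyperplane_section[OF polynomial_function_D_apply D_scale q0(2) _ _ u(2)])
      show "DIM(complex \<times> complex) \<le> Suc n" using True by simp
      show "A \<subseteq> (\<lambda>q. D q *v v) ` sphere 0 1" using A(1) by (simp add: wigner_orbit_eq)
    qed
  next
    case False
    obtain m c q where m: "2 * k m = N" "c \<noteq> 0" "norm q = 1" "D q *v v = c *s axis m 1"
      using small_orbit_zonal[OF v M] False by (metis not_less_eq_eq numeral_2_eq_2 numeral_3_eq_3)
    define \<Phi> where "\<Phi> w = c *s zonal m (im_q w)" for w
    have orbit: "wigner_orbit l ix v = wigner_orbit l ix (c *s axis m 1)"
      using orbit_D[OF m(3), of v] m(4) by simp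
    also have "\<dots> = (*s) c ` wigner_orbit l ix (axis m 1)"
      by (simp add: wigner_orbit_eq D_smult image_image)
    finally have orbit': "wigner_orbit l ix v = \<Phi> ` sphere 0 1"
      by (simp add: zonal_orbit[OF m(1)] image_image \<Phi>_def)
    show ?thesis
    proof (cases "N = 0")
      case True
      \<comment> \<open>The trivial representation: the orbit is a single point, which
        \<open>u\<close> does not annihilate.\<close>
      have "D p *v y = y" for p and y :: "complex^'n"
      proof (rule ev_inject)
        show "ev (D p *v y) x 1 = ev y x 1" for x
          unfolding ev_D using True k_le by (simp add: ev_def pv_nth)
      qed
      then have "A \<subseteq> {v}" "herm u v \<noteq> 0" using A(1) q0(2) by (auto simp: wigner_orbit_eq)
      then have "A = {}" using u(2) by blast
      then show ?thesis by (simp add: hausdorff_outer_empty)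
    next
      case False
      then have "2 \<le> n" using zonal_orbit_dim[OF m(1) _ m(2)] M orbit by simp
      have "polynomial_function (\<lambda>w. \<chi> i. c * zonal m (im_q w) $ i)" by (intro poly_intros)
      then have poly: "polynomial_function \<Phi>"
        by (simp add: \<Phi>_def[abs_def] vector_scalar_mult_def)
      have hom: "\<Phi> (t *\<^sub>R w) = t ^ k m *\<^sub>R \<Phi> w" for t w
        by (simp add: \<Phi>_def im_q_linear zonal_scale vec_eq_iff)
      obtain w0 where w0: "herm u (\<Phi> w0) \<noteq> 0"
      proof -
        have "D q0 *v v \<in> \<Phi> ` sphere 0 1"
          unfolding orbit'[symmetric] wigner_orbit_eq using q0(1) by simp
        then show thesis using q0(2) that by auto
      qed
      show ?thesis
      proof (rule hausdorff_outer_hyperplane_section[OF poly hom w0 _ _ u(2)])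
        show "DIM(real^3) \<le> Suc n" using \<open>2 \<le> n\<close> by simp
        show "A \<subseteq> \<Phi> ` sphere 0 1" using A(1) by (simp add: orbit')
      qed
    qed
  qed
  then show False using A(2) by simp
qed

end

theorem theorem11:
  fixes l :: real and ix :: "'n::finite \<Rightarrow> real"
  assumes half_integer: "2 * l \<in> \<nat>"
    and labelling: "bij_betw ix UNIV (weights l)"
  shows
    "(\<forall>s \<in> weights l - {0}. real CARD('k::finite) = 2 * \<bar>s\<bar> \<longrightarrow>
        (\<exists>F. smooth_embedding (circle_bundle s :: ((complex^2^2) \<times> (complex^('k \<Rightarrow> 2))) set)
                (sphere (0::complex^'n) 1) F
             \<and> F ` circle_bundle s = wigner_orbit l ix (basis_vec ix s)
             \<and> (\<forall>g\<in>SU2. F (tau_power s g) = wigner l ix g *v basis_vec ix s)))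
     \<and> (0 \<in> weights l \<and> 0 < l \<longrightarrow>
        ((\<exists>j::nat. l = 2 * real j) \<longrightarrow> diffeomorphic (wigner_orbit l ix (basis_vec ix 0)) RP2)
        \<and> (\<not> (\<exists>j::nat. l = 2 * real j) \<longrightarrow> diffeomorphic (wigner_orbit l ix (basis_vec ix 0)) S2))
     \<and> (0 < l \<longrightarrow>
        (AE v in (lebesgue :: (complex^'n) measure).
           (l \<notin> \<nat> \<longrightarrow> diffeomorphic (wigner_orbit l ix v) SU2)
           \<and> (l \<in> \<nat> \<longrightarrow> diffeomorphic (wigner_orbit l ix v) SO3)))
     \<and> (\<forall>(v::complex^'n) n A. v \<noteq> 0 \<and> submanifold_of_dim n (wigner_orbit l ix v)
          \<and> A \<subseteq> wigner_orbit l ix v \<and> hausdorff_measurable n A \<and> hausdorff_outer n A > 0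
          \<longrightarrow> vec.span A = UNIV)"
proof -
  interpret wigner_rep l ix using half_integer labelling by unfold_locales
  have two: "((\<exists>j::nat. l = 2 * real j) \<longrightarrow> diffeomorphic (wigner_orbit l ix (basis_vec ix 0)) RP2)
      \<and> (\<not> (\<exists>j::nat. l = 2 * real j) \<longrightarrow> diffeomorphic (wigner_orbit l ix (basis_vec ix 0)) S2)"
    if "0 \<in> weights l" "0 < l"
  proof -
    have "0 \<in> range ix" using that(1) bij_betw_imp_surj_on[OF labelling] by simp
    then obtain m where m: "ix m = 0" by (metis imageE)
    have e: "basis_vec ix 0 = axis m 1" using axis_eq_basis_vec[OF inj_ix, of m] by (simp add: m)
    have lk: "l = real (k m)" using ix_k[of m] m by simp
    then have "real N = real (2 * k m)" using N by simp
    then have kN: "2 * k m = N" by (simp only: of_nat_eq_iff)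
    \<comment> \<open>At weight 0 the degree \<open>k m\<close> of the zonal form is
      \<open>l\<close> itself.\<close>
    have "(\<exists>j::nat. l = 2 * real j) \<longleftrightarrow> even (k m)"
    proof -
      have "l = 2 * real j \<longleftrightarrow> k m = 2 * j" for j
        using lk by linarith
      then show ?thesis by (auto elim: evenE)
    qed
    then show ?thesis
      using orbit_RP2[OF kN] orbit_S2[OF kN] that(2) lk kN by (auto simp: e)
  qed
  show ?thesis
  proof (intro conjI[OF _ conjI[OF _ conjI]])
    show "\<forall>s \<in> weights l - {0}. real CARD('k::finite) = 2 * \<bar>s\<bar> \<longrightarrow>
        (\<exists>F. smooth_embedding (circle_bundle s :: ((complex^2^2) \<times> (complex^('k \<Rightarrow> 2))) set)
                (sphere (0::complex^'n) 1) F
             \<and> F ` circle_bundle s = wigner_orbit l ix (basis_vec ix s)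
             \<and> (\<forall>g\<in>SU2. F (tau_power s g) = wigner l ix g *v basis_vec ix s))"
      by (intro ballI impI, rule circle_bundle_embedding) simp_all
  qed (use two AE_orbit in simp, use AE_orbit in simp, use span_orbit_piece in auto)
qed

end
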